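(* For every integer $d\geq 4$, the number of LU-equivalence classes of 2-unitary matrices of size $d^2$ (equivalently, the number of LU-equivalence classes of AME$(4,d)$ states) is infinite.
   Context: For a matrix $U$ on $\mathbb{C}^d\otimes\mathbb{C}^d$ with entries $\langle i\alpha|U|j\beta\rangle$ in the computational product basis, its realignment $U^R$ is defined by $\langle ij|U^R|\alpha\beta\rangle=\langle i\alpha|U|j\beta\rangle$ and its partial transpose $U^\Gamma$ by $\langle i\beta|U^\Gamma|j\alpha\rangle=\langle i\alpha|U|j\beta\rangle$. $U$ is 2-unitary if $U$, $U^R$ and $U^\Gamma$ are all unitary. Two matrices $U,U'$ of size $d^2$ are LU-equivalent if $U'=(u_1\otimes u_2)U(v_1\otimes v_2)$ for some $d\times d$ unitaries $u_1,u_2,v_1,v_2$. An AME$(4,d)$ state is a pure state $|\psi\rangle\in(\mathbb{C}^d)^{\otimes 4}$ such that the reduced density matrix of every subset of at most two of the four parties is maximally mixed; two such states are LU-equivalent if one is obtained from the other by applying $w_1\otimes w_2\otimes w_3\otimes w_4$ with $w_k$ single-qudit unitaries. A unitary $U$ of size $d^2$ defines the state $|\Psi_U\rangle=\frac1d\sum_{i,\alpha,j,\beta}\langle i\alpha|U|j\beta\rangle\,|i\alpha j\beta\rangle$, which is AME$(4,d)$ when $U$ is 2-unitary. *)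

theory Defs
  imports Complex_Main "Jordan_Normal_Form.Matrix"
begin

text \<open>Matrices on C^d (x) C^d are complex (d*d)x(d*d) matrices; the computational
  product basis vector |i alpha> (i, alpha < d) has index i*d + alpha.\<close>

definition adj_mat :: "complex mat \<Rightarrow> complex mat" where
  "adj_mat A = mat (dim_col A) (dim_row A) (\<lambda>(i,j). cnj (A $$ (j,i)))"

definition unitary_mat :: "nat \<Rightarrow> complex mat \<Rightarrow> bool" where
  "unitary_mat n A \<longleftrightarrow> A \<in> carrier_mat n n \<and> A * adj_mat A = 1\<^sub>m n \<and> adj_mat A * A = 1\<^sub>m n"

text \<open>Realignment: <ij|U^R|alpha beta> = <i alpha|U|j beta>.\<close>
definition realign :: "nat \<Rightarrow> complex mat \<Rightarrow> complex mat" where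
  "realign d U = mat (d*d) (d*d)
     (\<lambda>(r,c). U $$ ((r div d) * d + c div d, (r mod d) * d + c mod d))"

text \<open>Partial transpose: <i beta|U^Gamma|j alpha> = <i alpha|U|j beta>.\<close>
definition ptrans :: "nat \<Rightarrow> complex mat \<Rightarrow> complex mat" where
  "ptrans d U = mat (d*d) (d*d)
     (\<lambda>(r,c). U $$ ((r div d) * d + c mod d, (c div d) * d + r mod d))"

definition two_unitary :: "nat \<Rightarrow> complex mat \<Rightarrow> bool" where
  "two_unitary d U \<longleftrightarrow> unitary_mat (d*d) U \<and> unitary_mat (d*d) (realign d U)
                        \<and> unitary_mat (d*d) (ptrans d U)"

definition tensor_mat :: "nat \<Rightarrow> complex mat \<Rightarrow> complex mat \<Rightarrow> complex mat" where
  "tensor_mat d A B = mat (d*d) (d*d)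
     (\<lambda>(r,c). A $$ (r div d, c div d) * B $$ (r mod d, c mod d))"

definition LU_equiv :: "nat \<Rightarrow> complex mat \<Rightarrow> complex mat \<Rightarrow> bool" where
  "LU_equiv d U U' \<longleftrightarrow> (\<exists>u1 u2 v1 v2. unitary_mat d u1 \<and> unitary_mat d u2 \<and>
      unitary_mat d v1 \<and> unitary_mat d v2 \<and>
      U' = tensor_mat d u1 u2 * U * tensor_mat d v1 v2)"

definition LU_rel :: "nat \<Rightarrow> (complex mat \<times> complex mat) set" where
  "LU_rel d = {(U, U'). LU_equiv d U U'}"

end

theory Submission
  imports "Jordan_Normal_Form.Determinant" "HOL-Analysis.L2_Norm" Defs
begin

text \<open>A 2-unitary matrix is a tensor on four parties whose two-party reductions are all scalar. For such
  a tensor \<open>\<psi>\<close> the vectors \<open>X \<psi>\<close>, with \<open>X\<close> a traceless operator on one party, are orthogonal for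
  different parties and have norm proportional to that of \<open>X\<close>. Hence if \<open>\<psi>' = w \<psi>\<close> with \<open>w\<close> a product of
  local unitaries at distance about \<open>\<delta>\<close> from the scalars, then \<open>\<psi>'\<close> leaves the line of \<open>\<psi>\<close> by an
  amount of order \<open>\<delta>\<close>, but leaves the span of all \<open>X \<psi>\<close> only by an amount of order \<open>\<delta>\<^sup>2\<close>. So a family
  whose members are displaced from each other transversally to these spans contains no two members
  related by a \<open>w\<close> near the scalars, and by total boundedness of the unitary group each LU class
  contains only finitely many of them.

  If there are two orthogonal Latin squares of order \<open>d\<close>, that is for all \<open>d \<ge> 4\<close> except 6, the family
  multiplies one entry of the corresponding permutation matrix by a phase; the displacement is
  transversal because \<open>d\<^sup>2 > 4 d - 3\<close>. For \<open>d = 6\<close> the family consists of matrices invariant under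
  translations of the Weyl-Heisenberg type, which makes every displacement transversal; it is
  parametrised by unit complex numbers \<open>v\<^sub>0, v\<^sub>1, v\<^sub>2\<close> with sum \<open>sqrt 3\<close>.\<close>

section \<open>Rigidity of absolutely maximally entangled tensors\<close>

text \<open>No LU invariant is computed. All that is shown is that two different members of the
  family cannot be joined by local factors close to scalars, with one constant \<open>\<rho>\<close>
  for all pairs. It must not depend on the pair, because the grid that discretises the local
  unitaries is fixed before the pigeonhole argument produces one. Uniformity is possible since both
  sides of the separation inequality scale linearly with the displacement, so that members lying
  arbitrarily close together do no harm.

  Let \<delta> be the largest deviation of the four local factors from scalars. Testing
  \<open>\<psi>'\<close> against the perturbation by the worst factor bounds the displacement below
  by a multiple of \<delta>; orthogonality between the parties keeps the four first-order terms from
  cancelling. Testing against \<open>\<phi>\<close>, which annihilates the terms of order zero and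
  one, bounds it above by a multiple of \<delta> squared over \<rho>.

  Order 6 is exceptional because there is no pair of orthogonal Latin squares of that order (Euler's
  36 officers). The number \<open>sqrt 3\<close> enters there because one of the correlations
  vanishes only if the sum of the three parameters has squared modulus 3.\<close>

text \<open>With the party as argument, a local operator acts through a function update and all six
  pairs of parties are handled by one statement. Extensionality makes the index set finite.\<close>

definition idx :: "nat \<Rightarrow> (nat \<Rightarrow> nat) set" where
  "idx d = {..<4} \<rightarrow>\<^sub>E {..<d}"

definition ip :: "nat \<Rightarrow> ((nat \<Rightarrow> nat) \<Rightarrow> complex) \<Rightarrow> ((nat \<Rightarrow> nat) \<Rightarrow> complex) \<Rightarrow> complex" where
  "ip d \<phi> \<psi> = (\<Sum>q\<in>idx d. cnj (\<phi> q) * \<psi> q)"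

definition nrm :: "nat \<Rightarrow> ((nat \<Rightarrow> nat) \<Rightarrow> complex) \<Rightarrow> real" where
  "nrm d \<psi> = L2_set (\<lambda>q. cmod (\<psi> q)) (idx d)"

definition act :: "nat \<Rightarrow> nat \<Rightarrow> (nat \<Rightarrow> nat \<Rightarrow> complex) \<Rightarrow> ((nat \<Rightarrow> nat) \<Rightarrow> complex)
    \<Rightarrow> (nat \<Rightarrow> nat) \<Rightarrow> complex" where
  "act d i X \<psi> q = (\<Sum>x<d. X (q i) x * \<psi> (q(i := x)))"

definition hs :: "nat \<Rightarrow> (nat \<Rightarrow> nat \<Rightarrow> complex) \<Rightarrow> real" where
  "hs d X = sqrt (\<Sum>x<d. \<Sum>y<d. (cmod (X x y))\<^sup>2)"

text \<open>The two-party reductions are normalised to the identity, so that the entries of a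
  2-unitary matrix need no rescaling; the norm of the tensor is then d.\<close>

definition ame :: "nat \<Rightarrow> ((nat \<Rightarrow> nat) \<Rightarrow> complex) \<Rightarrow> bool" where
  "ame d \<psi> \<longleftrightarrow> (\<forall>i<4. \<forall>j<4. i \<noteq> j \<longrightarrow> (\<forall>x<d. \<forall>y<d. \<forall>x'<d. \<forall>y'<d.
     (\<Sum>q | q \<in> idx d \<and> q i = x \<and> q j = y. \<psi> q * cnj (\<psi> (q(i := x', j := y'))))
       = (if x = x' \<and> y = y' then 1 else 0)))"

section \<open>Norms, inner products and one-party operators\<close>

lemma finite_idx [simp, intro]: "finite (idx d)"
  unfolding idx_def by (intro finite_PiE) auto

lemma idx_upd: "q \<in> idx d \<Longrightarrow> i < 4 \<Longrightarrow> x < d \<Longrightarrow> q(i := x) \<in> idx d"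
  unfolding idx_def by (auto simp: PiE_iff extensional_def)

lemma idx_less: "q \<in> idx d \<Longrightarrow> i < 4 \<Longrightarrow> q i < d"
  unfolding idx_def by (auto simp: PiE_iff)

lemma nrm_nonneg [simp]: "0 \<le> nrm d \<psi>"
  unfolding nrm_def by simp

lemma hs_nonneg [simp]: "0 \<le> hs d X"
  unfolding hs_def by (simp add: sum_nonneg)

lemma ip_cong: "(\<And>q. q \<in> idx d \<Longrightarrow> \<psi> q = \<chi> q) \<Longrightarrow> ip d \<phi> \<psi> = ip d \<phi> \<chi>"
  unfolding ip_def by (rule sum.cong) auto

lemma act_cong:
  assumes "\<And>q. q \<in> idx d \<Longrightarrow> \<psi> q = \<chi> q" "q \<in> idx d" "i < 4"
  shows "act d i X \<psi> q = act d i X \<chi> q"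
  unfolding act_def using assms by (intro sum.cong refl) (auto simp: idx_upd)

lemma ip_self: "ip d \<psi> \<psi> = complex_of_real ((nrm d \<psi>)\<^sup>2)"
  unfolding ip_def nrm_def L2_set_def
  by (simp add: sum_nonneg mult.commute flip: complex_norm_square)

lemma ip_Cauchy_Schwarz: "cmod (ip d \<phi> \<psi>) \<le> nrm d \<phi> * nrm d \<psi>"
proof -
  have "cmod (ip d \<phi> \<psi>) \<le> (\<Sum>q\<in>idx d. cmod (\<phi> q) * cmod (\<psi> q))"
    unfolding ip_def by (rule sum_norm_le) (simp add: norm_mult)
  also have "\<dots> \<le> nrm d \<phi> * nrm d \<psi>"
    unfolding nrm_def using L2_set_mult_ineq[of "\<lambda>q. cmod (\<phi> q)" "\<lambda>q. cmod (\<psi> q)" "idx d"] by simp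
  finally show ?thesis .
qed

lemma nrm_add: "nrm d (\<lambda>q. \<phi> q + \<psi> q) \<le> nrm d \<phi> + nrm d \<psi>"
proof -
  have "nrm d (\<lambda>q. \<phi> q + \<psi> q) \<le> L2_set (\<lambda>q. cmod (\<phi> q) + cmod (\<psi> q)) (idx d)"
    unfolding nrm_def by (rule L2_set_mono) (auto simp: norm_triangle_ineq)
  also have "\<dots> \<le> nrm d \<phi> + nrm d \<psi>"
    unfolding nrm_def by (rule L2_set_triangle_ineq)
  finally show ?thesis .
qed

lemma nrm_scale: "nrm d (\<lambda>q. c * \<psi> q) = cmod c * nrm d \<psi>"
  unfolding nrm_def using L2_set_right_distrib[of "cmod c" "\<lambda>q. cmod (\<psi> q)" "idx d"]
  by (simp add: norm_mult)

lemma nrm_zero [simp]: "nrm d (\<lambda>q. 0) = 0"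
  unfolding nrm_def by (simp add: L2_set_def)

lemma nrm_sum:
  assumes "finite I"
  shows "nrm d (\<lambda>q. \<Sum>i\<in>I. f i q) \<le> (\<Sum>i\<in>I. nrm d (f i))"
  using assms
proof (induction I rule: finite_induct)
  case (insert i I)
  have "nrm d (\<lambda>q. \<Sum>i\<in>insert i I. f i q) = nrm d (\<lambda>q. f i q + (\<Sum>i\<in>I. f i q))"
    using insert by simp
  also have "\<dots> \<le> nrm d (f i) + nrm d (\<lambda>q. \<Sum>i\<in>I. f i q)" by (rule nrm_add)
  finally show ?case using insert by simp
qed simp

lemma act_add: "act d i X (\<lambda>q. \<phi> q + \<psi> q) q = act d i X \<phi> q + act d i X \<psi> q"
  unfolding act_def by (simp add: distrib_left sum.distrib)

lemma act_scale: "act d i X (\<lambda>q. c * \<psi> q) q = c * act d i X \<psi> q"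
  unfolding act_def by (simp add: sum_distrib_left mult_ac)

lemma act_one:
  assumes "q \<in> idx d" "i < 4"
  shows "act d i (\<lambda>x y. if x = y then 1 else 0) \<psi> q = \<psi> q"
proof -
  have "act d i (\<lambda>x y. if x = y then 1 else 0) \<psi> q
      = (\<Sum>x<d. if x = q i then \<psi> (q(i := x)) else 0)"
    unfolding act_def by (intro sum.cong) auto
  then show ?thesis using idx_less[OF assms] by (simp add: sum.delta)
qed

lemma ip_add: "ip d \<phi> (\<lambda>q. \<psi> q + \<chi> q) = ip d \<phi> \<psi> + ip d \<phi> \<chi>"
  unfolding ip_def by (simp add: distrib_left sum.distrib)

lemma ip_scale: "ip d \<phi> (\<lambda>q. c * \<psi> q) = c * ip d \<phi> \<psi>"
  unfolding ip_def by (simp add: sum_distrib_left mult_ac)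

lemma ip_sum: "ip d \<phi> (\<lambda>q. \<Sum>k\<in>I. f k q) = (\<Sum>k\<in>I. ip d \<phi> (f k))"
  unfolding ip_def by (simp add: sum_distrib_left) (rule sum.swap)

text \<open>The exchange of \<open>(q, x)\<close> with \<open>(q(i := x), q i)\<close> is an
  involution. It serves to move an operator on party i from one side of an inner product to the
  other.\<close>

lemma idx_swap_sum:
  assumes "i < 4"
  shows "(\<Sum>q\<in>idx d. \<Sum>x<d. H q (q(i := x))) = (\<Sum>q\<in>idx d. \<Sum>x<d. H (q(i := x)) q)"
proof -
  have "(\<Sum>(q, x)\<in>idx d \<times> {..<d}. H q (q(i := x))) = (\<Sum>(q, x)\<in>idx d \<times> {..<d}. H (q(i := x)) q)"
    by (rule sum.reindex_bij_witness[of _ "\<lambda>(q, x). (q(i := x), q i)" "\<lambda>(q, x). (q(i := x), q i)"])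
      (use assms in \<open>auto simp: idx_upd idx_less\<close>)
  then show ?thesis by (simp add: sum.cartesian_product)
qed

lemma idx_group_sum:
  assumes "i < 4" "j < 4"
  shows "(\<Sum>q\<in>idx d. F q) = (\<Sum>a<d. \<Sum>b<d. \<Sum>q | q \<in> idx d \<and> q i = a \<and> q j = b. F q)"
proof -
  have "(\<Sum>q\<in>idx d. F q) = (\<Sum>p\<in>{..<d} \<times> {..<d}. \<Sum>q | q \<in> idx d \<and> (q i, q j) = p. F q)"
    by (rule sum.group[symmetric]) (use assms in \<open>auto simp: idx_less\<close>)
  also have "\<dots> = (\<Sum>a<d. \<Sum>b<d. \<Sum>q | q \<in> idx d \<and> (q i, q j) = (a, b). F q)"
    by (simp only: sum.cartesian_product split_def prod.collapse)
  finally show ?thesis by simp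
qed

text \<open>The Hilbert-Schmidt norm dominates the operator norm: Cauchy-Schwarz in the coordinate
  that the operator changes, then \<open>idx_swap_sum\<close> separates the two factors.\<close>

lemma nrm_act:
  assumes "i < 4"
  shows "nrm d (act d i X \<psi>) \<le> hs d X * nrm d \<psi>"
proof -
  have CS: "(cmod (act d i X \<psi> q))\<^sup>2
      \<le> (\<Sum>y<d. (cmod (X (q i) y))\<^sup>2) * (\<Sum>x<d. (cmod (\<psi> (q(i := x))))\<^sup>2)" for q
  proof -
    have "cmod (act d i X \<psi> q) \<le> (\<Sum>x<d. cmod (X (q i) x) * cmod (\<psi> (q(i := x))))"
      unfolding act_def by (rule sum_norm_le) (simp add: norm_mult)
    also have "\<dots> \<le> L2_set (\<lambda>y. cmod (X (q i) y)) {..<d} * L2_set (\<lambda>x. cmod (\<psi> (q(i := x)))) {..<d}"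
      using L2_set_mult_ineq[of "\<lambda>y. cmod (X (q i) y)" "\<lambda>x. cmod (\<psi> (q(i := x)))" "{..<d}"] by simp
    finally have "(cmod (act d i X \<psi> q))\<^sup>2
        \<le> (L2_set (\<lambda>y. cmod (X (q i) y)) {..<d} * L2_set (\<lambda>x. cmod (\<psi> (q(i := x)))) {..<d})\<^sup>2"
      by (intro power_mono) auto
    also have "\<dots> = (\<Sum>y<d. (cmod (X (q i) y))\<^sup>2) * (\<Sum>x<d. (cmod (\<psi> (q(i := x))))\<^sup>2)"
      unfolding L2_set_def by (simp add: power_mult_distrib sum_nonneg)
    finally show ?thesis .
  qed
  have "(nrm d (act d i X \<psi>))\<^sup>2 = (\<Sum>q\<in>idx d. (cmod (act d i X \<psi> q))\<^sup>2)"
    unfolding nrm_def L2_set_def by (simp add: sum_nonneg)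
  also have "\<dots> \<le> (\<Sum>q\<in>idx d. (\<Sum>y<d. (cmod (X (q i) y))\<^sup>2) * (\<Sum>x<d. (cmod (\<psi> (q(i := x))))\<^sup>2))"
    by (rule sum_mono) (rule CS)
  also have "\<dots> = (\<Sum>q\<in>idx d. \<Sum>x<d. (\<Sum>y<d. (cmod (X (q i) y))\<^sup>2) * (cmod (\<psi> (q(i := x))))\<^sup>2)"
    by (simp add: sum_distrib_left)
  also have "\<dots> = (\<Sum>q\<in>idx d. \<Sum>x<d. (\<Sum>y<d. (cmod (X x y))\<^sup>2) * (cmod (\<psi> q))\<^sup>2)"
    by (subst idx_swap_sum[OF assms, of "\<lambda>q r. (\<Sum>y<d. (cmod (X (q i) y))\<^sup>2) * (cmod (\<psi> r))\<^sup>2"]) simp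
  also have "\<dots> = (hs d X)\<^sup>2 * (nrm d \<psi>)\<^sup>2"
    unfolding nrm_def L2_set_def hs_def
    by (simp add: sum_nonneg flip: sum_distrib_left sum_distrib_right)
  finally have "(nrm d (act d i X \<psi>))\<^sup>2 \<le> (hs d X * nrm d \<psi>)\<^sup>2"
    by (simp add: power_mult_distrib)
  then show ?thesis by (rule power2_le_imp_le) simp
qed

section \<open>Inner products of one-party perturbations\<close>

lemma ameD:
  assumes "ame d \<psi>" "i < 4" "j < 4" "i \<noteq> j" "x < d" "y < d" "x' < d" "y' < d"
  shows "(\<Sum>q | q \<in> idx d \<and> q i = x \<and> q j = y. \<psi> q * cnj (\<psi> (q(i := x', j := y'))))
       = (if x = x' \<and> y = y' then 1 else 0)"
  using assms unfolding ame_def by blast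

text \<open>The inner product is the trace of the adjoint of X tensor Y against the reduction to
  parties i and j. That reduction is the identity, so the trace factorises; in particular traceless
  perturbations on different parties are orthogonal.\<close>

lemma ame_ip_act_distinct:
  assumes "ame d \<psi>" and ij: "i < 4" "j < 4" "i \<noteq> j"
  shows "ip d (act d i X \<psi>) (act d j Y \<psi>) = cnj (\<Sum>x<d. X x x) * (\<Sum>y<d. Y y y)"
proof -
  have "ip d (act d i X \<psi>) (act d j Y \<psi>)
      = (\<Sum>q\<in>idx d. \<Sum>x<d. \<Sum>y<d. cnj (X (q i) x) * cnj (\<psi> (q(i := x))) * Y (q j) y * \<psi> (q(j := y)))"
    unfolding ip_def act_def cnj_sum sum_product by (intro sum.cong refl) (simp add: mult_ac)
  also have "\<dots> = (\<Sum>x<d. \<Sum>q\<in>idx d. \<Sum>y<d. cnj (X (q i) x) * cnj (\<psi> (q(i := x))) * Y (q j) y * \<psi> (q(j := y)))"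
    by (rule sum.swap)
  also have "\<dots> = (\<Sum>x<d. \<Sum>q\<in>idx d. \<Sum>y<d. cnj (X (q i) x) * cnj (\<psi> (q(i := x, j := y))) * Y y (q j) * \<psi> q)"
  proof (rule sum.cong[OF refl])
    fix x
    show "(\<Sum>q\<in>idx d. \<Sum>y<d. cnj (X (q i) x) * cnj (\<psi> (q(i := x))) * Y (q j) y * \<psi> (q(j := y)))
        = (\<Sum>q\<in>idx d. \<Sum>y<d. cnj (X (q i) x) * cnj (\<psi> (q(i := x, j := y))) * Y y (q j) * \<psi> q)"
      using idx_swap_sum[OF ij(2), of "\<lambda>q r. cnj (X (q i) x) * cnj (\<psi> (q(i := x))) * Y (q j) (r j) * \<psi> r" d] ij(3)
      by (simp add: fun_upd_twist)
  qed
  also have "\<dots> = (\<Sum>x<d. \<Sum>y<d. \<Sum>q\<in>idx d. cnj (X (q i) x) * cnj (\<psi> (q(i := x, j := y))) * Y y (q j) * \<psi> q)"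
    by (intro sum.cong refl sum.swap)
  also have "\<dots> = (\<Sum>x<d. \<Sum>y<d. \<Sum>a<d. \<Sum>b<d. \<Sum>q | q \<in> idx d \<and> q i = a \<and> q j = b.
      cnj (X (q i) x) * cnj (\<psi> (q(i := x, j := y))) * Y y (q j) * \<psi> q)"
    by (simp only: idx_group_sum[OF ij(1,2)])
  also have "\<dots> = (\<Sum>x<d. \<Sum>y<d. \<Sum>a<d. \<Sum>b<d. cnj (X a x) * Y y b *
      (\<Sum>q | q \<in> idx d \<and> q i = a \<and> q j = b. \<psi> q * cnj (\<psi> (q(i := x, j := y)))))"
    by (intro sum.cong refl) (auto simp: sum_distrib_left mult_ac intro!: sum.cong)
  also have "\<dots> = (\<Sum>x<d. \<Sum>y<d. \<Sum>a<d. \<Sum>b<d. cnj (X a x) * Y y b * (if a = x \<and> b = y then 1 else 0))"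
    by (intro sum.cong refl) (simp add: ameD[OF assms])
  also have "\<dots> = (\<Sum>x<d. \<Sum>y<d. cnj (X x x) * Y y y)"
  proof (intro sum.cong refl)
    fix x y assume "x \<in> {..<d}" "y \<in> {..<d}"
    have "(\<Sum>b<d. cnj (X a x) * Y y b * (if a = x \<and> b = y then 1 else 0))
      = (if a = x then cnj (X a x) * Y y y else 0)" for a
      using \<open>y \<in> {..<d}\<close> by (simp add: if_distrib[of "(*) _"] cong: if_cong)
    then show "(\<Sum>a<d. \<Sum>b<d. cnj (X a x) * Y y b * (if a = x \<and> b = y then 1 else 0)) = cnj (X x x) * Y y y"
      using \<open>x \<in> {..<d}\<close> \<open>y \<in> {..<d}\<close> by simp
  qed
  finally show ?thesis by (simp add: sum_product)
qed

text \<open>The reduction to one party is d times the identity, and the trace of the adjoint of X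
  times X is the squared Hilbert-Schmidt norm.\<close>

lemma ame_ip_act_same:
  assumes "ame d \<psi>" and i: "i < 4"
  shows "ip d (act d i X \<psi>) (act d i X \<psi>) = complex_of_real (real d * (hs d X)\<^sup>2)"
proof -
  \<comment> \<open>The one-party reduction is obtained from a two-party one by summing over the
    index of an auxiliary party j that is left unchanged; this sum produces the factor d.\<close>
  obtain j :: nat where j: "j < 4" "i \<noteq> j"
    using that[of 0] that[of 1] by fastforce
  have "ip d (act d i X \<psi>) (act d i X \<psi>)
      = (\<Sum>q\<in>idx d. \<Sum>x<d. \<Sum>y<d. cnj (X (q i) x) * cnj (\<psi> (q(i := x))) * X (q i) y * \<psi> (q(i := y)))"
    unfolding ip_def act_def cnj_sum sum_product by (intro sum.cong refl) (simp add: mult_ac)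
  also have "\<dots> = (\<Sum>x<d. \<Sum>q\<in>idx d. \<Sum>y<d. cnj (X (q i) x) * cnj (\<psi> (q(i := x))) * X (q i) y * \<psi> (q(i := y)))"
    by (rule sum.swap)
  also have "\<dots> = (\<Sum>x<d. \<Sum>q\<in>idx d. \<Sum>y<d. cnj (X y x) * cnj (\<psi> (q(i := x))) * X y (q i) * \<psi> q)"
  proof (rule sum.cong[OF refl])
    fix x
    show "(\<Sum>q\<in>idx d. \<Sum>y<d. cnj (X (q i) x) * cnj (\<psi> (q(i := x))) * X (q i) y * \<psi> (q(i := y)))
        = (\<Sum>q\<in>idx d. \<Sum>y<d. cnj (X y x) * cnj (\<psi> (q(i := x))) * X y (q i) * \<psi> q)"
      using idx_swap_sum[OF i, of "\<lambda>q r. cnj (X (q i) x) * cnj (\<psi> (q(i := x))) * X (q i) (r i) * \<psi> r" d]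
      by simp
  qed
  also have "\<dots> = (\<Sum>x<d. \<Sum>y<d. \<Sum>q\<in>idx d. cnj (X y x) * cnj (\<psi> (q(i := x))) * X y (q i) * \<psi> q)"
    by (intro sum.cong refl sum.swap)
  also have "\<dots> = (\<Sum>x<d. \<Sum>y<d. \<Sum>a<d. \<Sum>b<d. \<Sum>q | q \<in> idx d \<and> q i = a \<and> q j = b.
      cnj (X y x) * cnj (\<psi> (q(i := x))) * X y (q i) * \<psi> q)"
    by (simp only: idx_group_sum[OF i j(1)])
  also have "\<dots> = (\<Sum>x<d. \<Sum>y<d. \<Sum>a<d. \<Sum>b<d. cnj (X y x) * X y a *
      (\<Sum>q | q \<in> idx d \<and> q i = a \<and> q j = b. \<psi> q * cnj (\<psi> (q(i := x, j := b)))))"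
  proof (intro sum.cong refl)
    fix x y a b
    have "q(i := x, j := b) = q(i := x)" if "q j = b" for q :: "nat \<Rightarrow> nat"
      using that j(2) by (metis fun_upd_other fun_upd_triv)
    then show "(\<Sum>q | q \<in> idx d \<and> q i = a \<and> q j = b. cnj (X y x) * cnj (\<psi> (q(i := x))) * X y (q i) * \<psi> q)
      = cnj (X y x) * X y a * (\<Sum>q | q \<in> idx d \<and> q i = a \<and> q j = b. \<psi> q * cnj (\<psi> (q(i := x, j := b))))"
      unfolding sum_distrib_left by (intro sum.cong refl) (simp add: mult_ac)
  qed
  also have "\<dots> = (\<Sum>x<d. \<Sum>y<d. \<Sum>a<d. \<Sum>b<d. cnj (X y x) * X y a * (if a = x then 1 else 0))"
    by (intro sum.cong refl) (simp add: ameD[OF assms(1) i j])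
  also have "\<dots> = (\<Sum>x<d. \<Sum>y<d. of_nat d * (cnj (X y x) * X y x))"
  proof (intro sum.cong refl)
    fix x y assume "x \<in> {..<d}"
    have "(\<Sum>a<d. \<Sum>b<d. cnj (X y x) * X y a * (if a = x then 1 else 0))
      = (\<Sum>a<d. if a = x then of_nat d * (cnj (X y x) * X y a) else 0)"
      by (intro sum.cong refl) auto
    then show "(\<Sum>a<d. \<Sum>b<d. cnj (X y x) * X y a * (if a = x then 1 else 0))
      = of_nat d * (cnj (X y x) * X y x)"
      using \<open>x \<in> {..<d}\<close> by simp
  qed
  also have "\<dots> = complex_of_real (real d * (\<Sum>x<d. \<Sum>y<d. (cmod (X y x))\<^sup>2))"
    by (simp only: complex_norm_square of_real_mult of_real_sum of_real_of_nat_eq sum_distrib_left mult.commute)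
  also have "(\<Sum>x<d. \<Sum>y<d. (cmod (X y x))\<^sup>2) = (hs d X)\<^sup>2"
    unfolding hs_def by (subst sum.swap) (simp add: sum_nonneg)
  finally show ?thesis .
qed

lemma ame_nrm:
  assumes ame: "ame d \<psi>"
  shows "nrm d \<psi> = real d"
proof -
  define one where "one = (\<lambda>x y :: nat. if x = y then 1 else 0 :: complex)"
  have "ip d \<psi> \<psi> = ip d (act d 0 one \<psi>) (act d 0 one \<psi>)"
    unfolding ip_def one_def by (intro sum.cong refl) (simp add: act_one)
  then have "complex_of_real ((nrm d \<psi>)\<^sup>2) = complex_of_real (real d * (hs d one)\<^sup>2)"
    using ip_self[of d \<psi>] ame_ip_act_same[OF ame, of 0 one] by simp
  moreover have "(hs d one)\<^sup>2 = real d"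
  proof -
    have "(\<Sum>x<d. \<Sum>y<d. (cmod (one x y))\<^sup>2) = (\<Sum>x<d. \<Sum>y<d. if y = x then 1 else 0)"
      unfolding one_def by (intro sum.cong) auto
    then show ?thesis unfolding hs_def by simp
  qed
  ultimately have "(nrm d \<psi>)\<^sup>2 = (real d)\<^sup>2" unfolding of_real_eq_iff by (simp add: power2_eq_square)
  then show ?thesis by simp
qed

section \<open>First-order expansion of a product of near-scalar operators\<close>

text \<open>The parameter m counts the factors applied so far, each with a scalar part of modulus
  between 1/2 and 2. The lower bounds on the coefficients matter as much as the upper ones: they
  keep the first-order terms from being damped away.\<close>

definition first_order :: "nat \<Rightarrow> (nat \<Rightarrow> nat \<Rightarrow> nat \<Rightarrow> complex) \<Rightarrow> ((nat \<Rightarrow> nat) \<Rightarrow> complex)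
    \<Rightarrow> nat set \<Rightarrow> nat \<Rightarrow> real \<Rightarrow> ((nat \<Rightarrow> nat) \<Rightarrow> complex) \<Rightarrow> bool" where
  "first_order d \<epsilon> \<psi> I m K R \<longleftrightarrow> (\<exists>c b Y.
     cmod c \<le> 2 ^ m \<and> 1 / 2 ^ m \<le> cmod c \<and> (\<forall>i\<in>I. cmod (b i) \<le> 2 ^ m \<and> 1 / 2 ^ m \<le> cmod (b i)) \<and>
     nrm d Y \<le> K \<and> (\<forall>q\<in>idx d. R q = c * \<psi> q + (\<Sum>i\<in>I. b i * act d i (\<epsilon> i) \<psi> q) + Y q))"

text \<open>The new constant collects three errors: at most \<open>2 * K\<close> from the scalar
  part on the old remainder, at most K from the deviation on it as \<delta> is at most 1, and
  \<open>card I * 2 ^ m * nrm d \<psi>\<close> from the deviation on the old first-order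
  terms.\<close>

lemma first_order_step:
  assumes R: "first_order d \<epsilon> \<psi> I m (K * \<delta>\<^sup>2) R"
    and j: "j < 4" "j \<notin> I" "finite I" "I \<subseteq> {..<4}"
    and eps: "\<And>i. i < 4 \<Longrightarrow> hs d (\<epsilon> i) \<le> \<delta>" and \<delta>: "0 \<le> \<delta>" "\<delta> \<le> 1"
    and \<tau>: "cmod \<tau> \<le> 2" "1 / 2 \<le> cmod \<tau>" and K: "0 \<le> K"
    and S: "\<And>q. q \<in> idx d \<Longrightarrow> S q = \<tau> * R q + act d j (\<epsilon> j) R q"
  shows "first_order d \<epsilon> \<psi> (insert j I) (Suc m) ((3 * K + card I * 2 ^ m * nrm d \<psi>) * \<delta>\<^sup>2) S"
proof -
  obtain c b Y where c: "cmod c \<le> 2 ^ m" "1 / 2 ^ m \<le> cmod c"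
    and b: "\<And>i. i \<in> I \<Longrightarrow> cmod (b i) \<le> 2 ^ m" "\<And>i. i \<in> I \<Longrightarrow> 1 / 2 ^ m \<le> cmod (b i)"
    and Y: "nrm d Y \<le> K * \<delta>\<^sup>2"
    and Req: "\<And>q. q \<in> idx d \<Longrightarrow> R q = c * \<psi> q + (\<Sum>i\<in>I. b i * act d i (\<epsilon> i) \<psi> q) + Y q"
    using R unfolding first_order_def by blast
  define L where "L = (\<lambda>q. \<Sum>i\<in>I. b i * act d i (\<epsilon> i) \<psi> q)"
  define E where "E = act d j (\<epsilon> j)"
  define Y' where "Y' = (\<lambda>q. \<tau> * Y q + (E L q + E Y q))"
  \<comment> \<open>The new party enters through its deviation acting on the zeroth-order term
    \<open>c * \<psi>\<close>, hence with coefficient c.\<close>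
  define b' where "b' = (\<lambda>i. if i = j then c else \<tau> * b i)"
  have E: "E R q = c * E \<psi> q + E L q + E Y q" if "q \<in> idx d" for q
  proof -
    have "E R q = E (\<lambda>q. (c * \<psi> q + L q) + Y q) q"
      unfolding E_def by (rule act_cong) (use that j Req in \<open>auto simp: L_def\<close>)
    then show ?thesis unfolding E_def act_add act_scale .
  qed
  have nE: "nrm d (E \<chi>) \<le> \<delta> * nrm d \<chi>" for \<chi>
    unfolding E_def using nrm_act[OF j(1), of d "\<epsilon> j" \<chi>] eps[OF j(1)]
      mult_right_mono[OF eps[OF j(1)] nrm_nonneg[of d \<chi>]] by linarith
  have nL: "nrm d L \<le> card I * 2 ^ m * nrm d \<psi> * \<delta>"
  proof -
    have "nrm d L \<le> (\<Sum>i\<in>I. nrm d (\<lambda>q. b i * act d i (\<epsilon> i) \<psi> q))"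
      unfolding L_def by (rule nrm_sum[OF j(3)])
    also have "\<dots> \<le> (\<Sum>i\<in>I. 2 ^ m * (\<delta> * nrm d \<psi>))"
    proof (rule sum_mono)
      fix i assume i: "i \<in> I"
      then have i4: "i < 4" using j(4) by auto
      have "nrm d (act d i (\<epsilon> i) \<psi>) \<le> \<delta> * nrm d \<psi>"
        using nrm_act[OF i4, of d "\<epsilon> i" \<psi>] mult_right_mono[OF eps[OF i4] nrm_nonneg[of d \<psi>]]
        by linarith
      then show "nrm d (\<lambda>q. b i * act d i (\<epsilon> i) \<psi> q) \<le> 2 ^ m * (\<delta> * nrm d \<psi>)"
        unfolding nrm_scale using b(1)[OF i] by (intro mult_mono) auto
    qed
    finally show ?thesis by (simp add: mult_ac)
  qed
  have "nrm d Y' \<le> 2 * (K * \<delta>\<^sup>2) + (\<delta> * (card I * 2 ^ m * nrm d \<psi> * \<delta>) + K * \<delta>\<^sup>2)"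
  proof -
    have "nrm d Y' \<le> nrm d (\<lambda>q. \<tau> * Y q) + (nrm d (E L) + nrm d (E Y))"
      unfolding Y'_def
      using nrm_add[of d "\<lambda>q. \<tau> * Y q" "\<lambda>q. E L q + E Y q"] nrm_add[of d "E L" "E Y"] by simp
    moreover have "nrm d (\<lambda>q. \<tau> * Y q) \<le> 2 * (K * \<delta>\<^sup>2)"
      unfolding nrm_scale using \<tau>(1) Y by (intro mult_mono) auto
    moreover have "nrm d (E L) \<le> \<delta> * (card I * 2 ^ m * nrm d \<psi> * \<delta>)"
      using nE[of L] mult_left_mono[OF nL \<delta>(1)] by linarith
    moreover have "nrm d (E Y) \<le> K * \<delta>\<^sup>2"
      using nE[of Y] mult_mono[OF \<delta>(2) Y] \<delta> K by auto
    ultimately show ?thesis by linarith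
  qed
  then have nY': "nrm d Y' \<le> (3 * K + card I * 2 ^ m * nrm d \<psi>) * \<delta>\<^sup>2"
    by (simp add: algebra_simps power2_eq_square)
  have "S q = (\<tau> * c) * \<psi> q + (\<Sum>i\<in>insert j I. b' i * act d i (\<epsilon> i) \<psi> q) + Y' q" if q: "q \<in> idx d" for q
  proof -
    have "(\<Sum>i\<in>insert j I. b' i * act d i (\<epsilon> i) \<psi> q) = c * E \<psi> q + (\<Sum>i\<in>I. b' i * act d i (\<epsilon> i) \<psi> q)"
      using j by (simp add: b'_def E_def)
    also have "(\<Sum>i\<in>I. b' i * act d i (\<epsilon> i) \<psi> q) = (\<Sum>i\<in>I. \<tau> * (b i * act d i (\<epsilon> i) \<psi> q))"
      using j by (intro sum.cong) (auto simp: b'_def)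
    also have "\<dots> = \<tau> * L q" by (simp add: L_def sum_distrib_left)
    finally have "(\<Sum>i\<in>insert j I. b' i * act d i (\<epsilon> i) \<psi> q) = c * E \<psi> q + \<tau> * L q" .
    moreover have "R q = c * \<psi> q + L q + Y q" using Req[OF q] by (simp add: L_def)
    moreover have "S q = \<tau> * R q + E R q" using S[OF q] by (simp add: E_def)
    ultimately show ?thesis
      using E[OF q] unfolding Y'_def by (simp add: algebra_simps)
  qed
  moreover have tm: "cmod (\<tau> * z) \<le> 2 ^ Suc m \<and> 1 / 2 ^ Suc m \<le> cmod (\<tau> * z)"
    if "cmod z \<le> 2 ^ m" "1 / 2 ^ m \<le> cmod z" for z
  proof
    show "cmod (\<tau> * z) \<le> 2 ^ Suc m"
      unfolding norm_mult power_Suc using that \<tau> by (intro mult_mono) auto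
    have "(1 / 2) * (1 / 2 ^ m) \<le> cmod \<tau> * cmod z"
      using that \<tau> by (intro mult_mono) auto
    then show "1 / 2 ^ Suc m \<le> cmod (\<tau> * z)" by (simp add: norm_mult)
  qed
  moreover have "cmod (b' i) \<le> 2 ^ Suc m \<and> 1 / 2 ^ Suc m \<le> cmod (b' i)" if "i \<in> insert j I" for i
  proof (cases "i = j")
    case True
    have "(2::real) ^ m \<le> 2 ^ Suc m" "1 / 2 ^ Suc m \<le> (1 / 2 ^ m :: real)"
      by (simp_all add: field_simps)
    then have "cmod c \<le> 2 ^ Suc m" "1 / 2 ^ Suc m \<le> cmod c" using c by linarith+
    then show ?thesis using True unfolding b'_def by simp
  next
    case False
    then show ?thesis using tm[of "b i"] b that unfolding b'_def by simp
  qed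
  ultimately show ?thesis
    unfolding first_order_def using tm[OF c] nY' by blast
qed

text \<open>The scalar s is free, so the displacement may be measured from any convenient multiple
  of \<open>\<psi>\<close>. The first bound on \<open>\<kappa>\<close> makes the quadratic error
  lose against the linear lower bound, the second keeps the scalar parts of the factors near
  1.\<close>

lemma rigidity:
  fixes w :: "nat \<Rightarrow> nat \<Rightarrow> nat \<Rightarrow> complex"
  assumes ame: "ame d \<psi>" and d: "1 \<le> d" and \<rho>: "0 < \<rho>"
    and near: "\<And>i x y. i < 4 \<Longrightarrow> x < d \<Longrightarrow> y < d \<Longrightarrow> cmod (w i x y - (if x = y then 1 else 0)) \<le> \<kappa>"
    and \<kappa>: "2 * real d * \<kappa> * (1056 * real d * (1 + \<rho>)) < \<rho>"  "2 * real d * \<kappa> \<le> 1"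
    and orth: "\<And>i X. i < 4 \<Longrightarrow> ip d \<phi> (act d i X \<psi>) = 0"
    and \<psi>': "\<And>q. q \<in> idx d \<Longrightarrow> \<psi>' q = act d 0 (w 0) (act d 1 (w 1) (act d 2 (w 2) (act d 3 (w 3) \<psi>))) q"
    and ne: "ip d \<phi> \<psi>' \<noteq> 0"
    and ge: "\<rho> * (nrm d \<phi> * nrm d (\<lambda>q. \<psi>' q - s * \<psi> q)) \<le> cmod (ip d \<phi> \<psi>')"
  shows False
proof -
  have \<kappa>0: "0 \<le> \<kappa>" using near[of 0 0 0] d by (auto intro: order_trans[OF norm_ge_zero])
  define one where "one = (\<lambda>x y :: nat. if x = y then 1 else 0 :: complex)"
  \<comment> \<open>The normalised trace is split off so that the deviations are traceless, as the
    orthogonality relations require.\<close>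
  define \<tau> where "\<tau> = (\<lambda>i. (\<Sum>x<d. w i x x) / of_nat d)"
  define \<epsilon> where "\<epsilon> = (\<lambda>i x y. w i x y - \<tau> i * one x y)"
  have \<tau>1: "cmod (\<tau> i - 1) \<le> \<kappa>" if "i < 4" for i
  proof -
    have "\<tau> i - 1 = (\<Sum>x<d. w i x x - 1) / of_nat d"
      unfolding \<tau>_def using d by (simp add: sum_subtractf field_simps)
    then have "cmod (\<tau> i - 1) = cmod (\<Sum>x<d. w i x x - 1) / real d" by (simp add: norm_divide)
    moreover have "cmod (\<Sum>x<d. w i x x - 1) \<le> (\<Sum>x<d. \<kappa>)"
      by (rule sum_norm_le) (use near[OF that] in force)
    ultimately show ?thesis using d by (simp add: divide_le_eq mult.commute)
  qed
  have \<kappa>half: "\<kappa> \<le> 1 / 2" using \<kappa>(2) d \<kappa>0 mult_right_mono[of 1 "real d" "2 * \<kappa>"] by (simp add: mult_ac)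
  have \<tau>: "cmod (\<tau> i) \<le> 2" "1 / 2 \<le> cmod (\<tau> i)" if "i < 4" for i
    using \<tau>1[OF that] \<kappa>half norm_triangle_ineq2[of "\<tau> i" 1] norm_triangle_ineq2[of 1 "\<tau> i"]
    by (auto simp: norm_minus_commute)
  have tr0: "(\<Sum>x<d. \<epsilon> i x x) = 0" for i
    unfolding \<epsilon>_def one_def \<tau>_def using d by (simp add: sum_subtractf)
  have hs_le: "hs d (\<epsilon> i) \<le> 2 * real d * \<kappa>" if i: "i < 4" for i
  proof -
    have "cmod (\<epsilon> i x y) \<le> 2 * \<kappa>" if "x < d" "y < d" for x y
    proof -
      have "\<epsilon> i x y = (w i x y - one x y) - (\<tau> i - 1) * one x y"
        unfolding \<epsilon>_def by (simp add: algebra_simps)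
      also have "cmod \<dots> \<le> cmod (w i x y - one x y) + cmod ((\<tau> i - 1) * one x y)"
        by (rule norm_triangle_ineq4)
      also have "cmod ((\<tau> i - 1) * one x y) \<le> \<kappa>"
        using \<tau>1[OF i] \<kappa>0 unfolding one_def by auto
      also have "cmod (w i x y - one x y) \<le> \<kappa>" unfolding one_def by (rule near[OF i that])
      finally show ?thesis by simp
    qed
    then have "(\<Sum>x<d. \<Sum>y<d. (cmod (\<epsilon> i x y))\<^sup>2) \<le> (\<Sum>x<d. \<Sum>y<d. (2 * \<kappa>)\<^sup>2)"
      by (intro sum_mono power_mono) auto
    also have "\<dots> = (2 * real d * \<kappa>)\<^sup>2" by (simp add: power2_eq_square)
    finally show ?thesis unfolding hs_def using \<kappa>0 by (intro real_le_lsqrt) auto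
  qed
  \<comment> \<open>All errors are measured by the largest deviation; the party k attaining it
    supplies the test vector e.\<close>
  define \<delta> where "\<delta> = Max ((\<lambda>i. hs d (\<epsilon> i)) ` {..<4})"
  have \<delta>_ge: "hs d (\<epsilon> i) \<le> \<delta>" if "i < 4" for i
    unfolding \<delta>_def using that by (intro Max_ge) auto
  have "\<delta> \<in> (\<lambda>i. hs d (\<epsilon> i)) ` {..<4}"
    unfolding \<delta>_def by (rule Max_in) (auto simp: lessThan_empty_iff)
  then obtain k where k: "k < 4" "hs d (\<epsilon> k) = \<delta>" by auto
  have \<delta>: "0 \<le> \<delta>" "\<delta> \<le> 2 * real d * \<kappa>" "\<delta> \<le> 1"
    using hs_nonneg[of d "\<epsilon> k"] hs_le[OF k(1)] \<kappa>(2) unfolding k(2) by auto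
  have w: "act d i (w i) \<chi> q = \<tau> i * \<chi> q + act d i (\<epsilon> i) \<chi> q" if "i < 4" "q \<in> idx d" for i \<chi> q
  proof -
    have "act d i (w i) \<chi> q = (\<Sum>x<d. \<tau> i * (one (q i) x * \<chi> (q(i := x))) + \<epsilon> i (q i) x * \<chi> (q(i := x)))"
      unfolding act_def \<epsilon>_def by (intro sum.cong refl) (simp add: algebra_simps)
    also have "\<dots> = \<tau> i * act d i one \<chi> q + act d i (\<epsilon> i) \<chi> q"
      unfolding act_def by (simp add: sum.distrib sum_distrib_left)
    finally show ?thesis using act_one[OF that(2,1), of \<chi>] unfolding one_def by simp
  qed
  define N where "N = nrm d \<psi>"
  have N: "N = real d" unfolding N_def by (rule ame_nrm[OF ame])
  note step = first_order_step[OF _ _ _ _ _ \<delta>_ge \<delta>(1,3) \<tau>]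
  \<comment> \<open>The recursion \<open>3 * K + card I * 2 ^ m * N\<close> for the error constant
    runs through 0, 0, 2 N, 14 N, 66 N.\<close>
  have "first_order d \<epsilon> \<psi> {} 0 (0 * \<delta>\<^sup>2) \<psi>"
    unfolding first_order_def by (intro exI[of _ 1] exI[of _ "\<lambda>_. 0"]) auto
  from step[OF this, of 3 3 "act d 3 (w 3) \<psi>"] w[of 3]
  have "first_order d \<epsilon> \<psi> {3} 1 (0 * \<delta>\<^sup>2) (act d 3 (w 3) \<psi>)" by simp
  from step[OF this, of 2 2 "act d 2 (w 2) (act d 3 (w 3) \<psi>)"] w[of 2]
  have "first_order d \<epsilon> \<psi> {2,3} 2 ((2 * N) * \<delta>\<^sup>2) (act d 2 (w 2) (act d 3 (w 3) \<psi>))"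
    by (simp add: N_def numeral_2_eq_2)
  from step[OF this, of 1 1 "act d 1 (w 1) (act d 2 (w 2) (act d 3 (w 3) \<psi>))"] w[of 1]
  have "first_order d \<epsilon> \<psi> {1,2,3} 3 ((14 * N) * \<delta>\<^sup>2) (act d 1 (w 1) (act d 2 (w 2) (act d 3 (w 3) \<psi>)))"
    by (simp add: N_def numeral_3_eq_3)
  from step[OF this, of 0 0 \<psi>'] w[of 0] \<psi>'
  have fo: "first_order d \<epsilon> \<psi> {0,1,2,3} 4 ((66 * N) * \<delta>\<^sup>2) \<psi>'"
    by (simp add: N_def)
  then obtain c b Y where b: "1 / 2 ^ 4 \<le> cmod (b k)" and Y: "nrm d Y \<le> (66 * N) * \<delta>\<^sup>2"
    and eq: "\<And>q. q \<in> idx d \<Longrightarrow> \<psi>' q = c * \<psi> q + (\<Sum>i\<in>{0,1,2,3}. b i * act d i (\<epsilon> i) \<psi> q) + Y q"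
    unfolding first_order_def using k(1) by (auto simp: less_Suc_eq numeral_eq_Suc)
  have ip_\<psi>': "ip d \<chi> \<psi>' = c * ip d \<chi> \<psi> + (\<Sum>i\<in>{0,1,2,3}. b i * ip d \<chi> (act d i (\<epsilon> i) \<psi>)) + ip d \<chi> Y" for \<chi>
  proof -
    have "ip d \<chi> \<psi>' = ip d \<chi> (\<lambda>q. c * \<psi> q + (\<Sum>i\<in>{0,1,2,3}. b i * act d i (\<epsilon> i) \<psi> q) + Y q)"
      by (rule ip_cong) (rule eq)
    then show ?thesis unfolding ip_add ip_sum ip_scale .
  qed
  have one_act: "ip d \<chi> (act d j one \<psi>) = ip d \<chi> \<psi>" if "j < 4" for \<chi> j
    unfolding one_def by (rule ip_cong) (simp add: act_one that)
  \<comment> \<open>Orthogonality for the identity operator removes the multiple of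
    \<open>\<psi>\<close>, for the deviations the first-order terms. Only the quadratic remainder is
    seen by \<open>\<phi>\<close>.\<close>
  have "ip d \<phi> \<psi>' = ip d \<phi> Y"
    using ip_\<psi>'[of \<phi>] one_act[of 0 \<phi>] orth by simp
  then have up: "cmod (ip d \<phi> \<psi>') \<le> nrm d \<phi> * (66 * real d * \<delta>\<^sup>2)" and \<phi>0: "nrm d \<phi> \<noteq> 0" and Y0: "nrm d Y \<noteq> 0"
    using ip_Cauchy_Schwarz[of d \<phi> Y] mult_left_mono[OF Y nrm_nonneg[of d \<phi>]] ne N by auto
  \<comment> \<open>With all deviations zero the remainder would vanish, and with it the inner
    product of \<open>\<phi>\<close> and \<open>\<psi>'\<close>.\<close>
  have \<delta>0: "\<delta> \<noteq> 0"
    using Y Y0 nrm_nonneg[of d Y] by (intro notI) simp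
  \<comment> \<open>This vector is orthogonal to \<open>\<psi>\<close> and to the other three
    first-order terms, so it isolates the coefficient \<open>b k\<close>.\<close>
  define e where "e = act d k (\<epsilon> k) \<psi>"
  define D where "D = nrm d (\<lambda>q. \<psi>' q - s * \<psi> q)"
  have ne2: "(nrm d e)\<^sup>2 = real d * \<delta>\<^sup>2"
    using ip_self[of d e] ame_ip_act_same[OF ame k(1), of "\<epsilon> k"] k(2) unfolding e_def by (metis of_real_eq_iff)
  \<comment> \<open>The exact norm is \<open>sqrt d * \<delta>\<close>; weakening it to
    \<open>real d * \<delta>\<close> provides a factor that cancels below.\<close>
  have "(nrm d e)\<^sup>2 \<le> (real d * \<delta>)\<^sup>2"
    unfolding ne2 power_mult_distrib using d by (intro mult_right_mono) (auto simp: power2_eq_square)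
  then have ne_le: "nrm d e \<le> real d * \<delta>" by (rule power2_le_imp_le) (use \<delta> in simp)
  obtain j :: nat where j: "j < 4" "k \<noteq> j" using that[of 0] that[of 1] by fastforce
  have e_\<psi>: "ip d e \<psi> = 0"
    using ame_ip_act_distinct[OF ame k(1) j, of "\<epsilon> k" one] one_act[OF j(1), of e] tr0 unfolding e_def by simp
  have e_act: "ip d e (act d i (\<epsilon> i) \<psi>) = (if i = k then of_real (real d * \<delta>\<^sup>2) else 0)" if "i < 4" for i
    using ame_ip_act_distinct[OF ame k(1) that, of "\<epsilon> k" "\<epsilon> i"] ame_ip_act_same[OF ame k(1), of "\<epsilon> k"] tr0 k(2)
    unfolding e_def by auto
  have "(\<Sum>i\<in>{0,1,2,3}. b i * ip d e (act d i (\<epsilon> i) \<psi>)) = (\<Sum>i\<in>{0,1,2,3}. if i = k then b i * of_real (real d * \<delta>\<^sup>2) else 0)"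
    by (intro sum.cong refl) (auto simp: e_act)
  also have "\<dots> = b k * of_real (real d * \<delta>\<^sup>2)"
    using k(1) by (subst sum.delta) (auto simp: less_Suc_eq numeral_eq_Suc)
  finally have "ip d e (\<lambda>q. \<psi>' q - s * \<psi> q) = b k * of_real (real d * \<delta>\<^sup>2) + ip d e Y"
    using ip_\<psi>'[of e] ip_add[of d e \<psi>' "\<lambda>q. (- s) * \<psi> q"] e_\<psi> unfolding ip_scale by simp
  then have "cmod (b k * of_real (real d * \<delta>\<^sup>2)) \<le> cmod (ip d e (\<lambda>q. \<psi>' q - s * \<psi> q)) + cmod (ip d e Y)"
    by (metis add_diff_cancel_right' norm_triangle_ineq4)
  also have "\<dots> \<le> nrm d e * D + nrm d e * nrm d Y"
    unfolding D_def by (intro add_mono ip_Cauchy_Schwarz)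
  also have "\<dots> \<le> (real d * \<delta>) * (D + 66 * real d * \<delta>\<^sup>2)"
    using mult_mono[OF ne_le add_left_mono[OF Y, of D]] \<delta> unfolding N D_def by (simp add: distrib_left)
  finally have "(real d * \<delta>) * (cmod (b k) * \<delta>) \<le> (real d * \<delta>) * (D + 66 * real d * \<delta>\<^sup>2)"
    by (simp add: norm_mult power2_eq_square mult_ac)
  then have "cmod (b k) * \<delta> \<le> D + 66 * real d * \<delta>\<^sup>2"
    by (rule mult_left_le_imp_le) (use d \<delta> \<delta>0 in auto)
  then have "\<delta> / 16 \<le> D + 66 * real d * \<delta>\<^sup>2"
    using mult_right_mono[OF b \<delta>(1)] by simp
  moreover have "\<rho> * D \<le> 66 * real d * \<delta>\<^sup>2"
  proof -
    have "nrm d \<phi> * (\<rho> * D) \<le> nrm d \<phi> * (66 * real d * \<delta>\<^sup>2)"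
      using ge up unfolding D_def by (simp add: mult_ac)
    then show ?thesis by (rule mult_left_le_imp_le) (use \<phi>0 nrm_nonneg[of d \<phi>] in linarith)
  qed
  \<comment> \<open>Eliminating D leaves one inequality in \<delta>; the constant 1056 is 16 times
    66.\<close>
  ultimately have "\<rho> * (\<delta> / 16) \<le> 66 * real d * \<delta>\<^sup>2 + \<rho> * (66 * real d * \<delta>\<^sup>2)"
    using mult_left_mono[of "\<delta> / 16" "D + 66 * real d * \<delta>\<^sup>2" \<rho>] \<rho> by (simp add: distrib_left)
  then have "\<delta> * \<rho> \<le> \<delta> * (\<delta> * (1056 * real d * (1 + \<rho>)))"
    by (simp add: power2_eq_square algebra_simps)
  then have "\<rho> \<le> \<delta> * (1056 * real d * (1 + \<rho>))"
    by (rule mult_left_le_imp_le) (use \<delta> \<delta>0 in simp)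
  also have "\<dots> \<le> 2 * real d * \<kappa> * (1056 * real d * (1 + \<rho>))"
    using \<delta> \<rho> by (intro mult_right_mono) auto
  finally show False using \<kappa>(1) by simp
qed

section \<open>Two-unitary matrices as tensors\<close>

definition of_tens :: "nat \<Rightarrow> (nat \<Rightarrow> nat \<Rightarrow> nat \<Rightarrow> nat \<Rightarrow> complex) \<Rightarrow> complex mat" where
  "of_tens d T = mat (d*d) (d*d) (\<lambda>(r, c). T (r div d) (r mod d) (c div d) (c mod d))"

definition tens :: "nat \<Rightarrow> complex mat \<Rightarrow> (nat \<Rightarrow> nat) \<Rightarrow> complex" where
  "tens d U q = U $$ (q 0 * d + q 1, q 2 * d + q 3)"

lemma pair_less:
  fixes a b d :: nat
  assumes "a < d" "b < d"
  shows "a * d + b < d * d"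
proof -
  have "a * d + b < Suc a * d" using assms(2) by simp
  also have "\<dots> \<le> d * d" using assms(1) by (intro mult_right_mono) auto
  finally show ?thesis .
qed

lemma sum_pair:
  fixes d :: nat
  shows "(\<Sum>k<d*d. F (k div d) (k mod d)) = (\<Sum>a<d. \<Sum>b<d. F a b)"
proof -
  have "(\<Sum>k<d*d. F (k div d) (k mod d)) = (\<Sum>(a, b)\<in>{..<d} \<times> {..<d}. F a b)"
    by (rule sum.reindex_bij_witness[of _ "\<lambda>(a, b). a * d + b" "\<lambda>k. (k div d, k mod d)"])
      (auto simp: pair_less less_mult_imp_div_less intro!: mod_less_divisor intro: gr_zeroI)
  then show ?thesis by (simp add: sum.cartesian_product)
qed

lemma of_tens_carrier [simp]: "of_tens d T \<in> carrier_mat (d*d) (d*d)"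
  unfolding of_tens_def by simp

lemma of_tens_index: "a < d \<Longrightarrow> b < d \<Longrightarrow> c < d \<Longrightarrow> e < d \<Longrightarrow> of_tens d T $$ (a*d+b, c*d+e) = T a b c e"
  unfolding of_tens_def by (simp add: pair_less)

lemma realign_of_tens: "realign d (of_tens d T) = of_tens d (\<lambda>a b c e. T a c b e)"
proof (rule eq_matI)
  fix r c assume "r < dim_row (of_tens d (\<lambda>a b c e. T a c b e))" "c < dim_col (of_tens d (\<lambda>a b c e. T a c b e))"
  then have rc: "r < d*d" "c < d*d" by (auto simp: of_tens_def)
  then have d: "0 < d" by (cases d) auto
  show "realign d (of_tens d T) $$ (r, c) = of_tens d (\<lambda>a b c e. T a c b e) $$ (r, c)"
    using rc d of_tens_index[of "r div d" d "c div d" "r mod d" "c mod d" T]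
    by (simp add: realign_def of_tens_def[of d "\<lambda>a b c e. T a c b e"] less_mult_imp_div_less)
qed (auto simp: realign_def of_tens_def)

lemma ptrans_of_tens: "ptrans d (of_tens d T) = of_tens d (\<lambda>a b c e. T a e c b)"
proof (rule eq_matI)
  fix r c assume "r < dim_row (of_tens d (\<lambda>a b c e. T a e c b))" "c < dim_col (of_tens d (\<lambda>a b c e. T a e c b))"
  then have rc: "r < d*d" "c < d*d" by (auto simp: of_tens_def)
  then have d: "0 < d" by (cases d) auto
  show "ptrans d (of_tens d T) $$ (r, c) = of_tens d (\<lambda>a b c e. T a e c b) $$ (r, c)"
    using rc d of_tens_index[of "r div d" d "c mod d" "c div d" "r mod d" T]
    by (simp add: ptrans_def of_tens_def[of d "\<lambda>a b c e. T a e c b"] less_mult_imp_div_less)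
qed (auto simp: ptrans_def of_tens_def)

lemma adj_mat_carrier [simp]: "A \<in> carrier_mat n m \<Longrightarrow> adj_mat A \<in> carrier_mat m n"
  unfolding adj_mat_def by auto

lemma mult_adj_index:
  assumes "A \<in> carrier_mat n m" "r < n" "r' < n"
  shows "(A * adj_mat A) $$ (r, r') = (\<Sum>k<m. A $$ (r, k) * cnj (A $$ (r', k)))"
  using assms by (auto simp: adj_mat_def scalar_prod_def lessThan_atLeast0 intro!: sum.cong)

lemma adj_mult_index:
  assumes "A \<in> carrier_mat m n" "c < n" "c' < n"
  shows "(adj_mat A * A) $$ (c, c') = (\<Sum>k<m. cnj (A $$ (k, c)) * A $$ (k, c'))"
  using assms by (auto simp: adj_mat_def scalar_prod_def lessThan_atLeast0 intro!: sum.cong)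

lemma unitary_matI:
  assumes "A \<in> carrier_mat n n" "A * adj_mat A = 1\<^sub>m n"
  shows "unitary_mat n A"
  unfolding unitary_mat_def using assms mat_mult_left_right_inverse[of A n "adj_mat A"] by simp

text \<open>One of the two unitarity equations; for a square matrix it implies the other
  one.\<close>

definition row_orthonormal :: "nat \<Rightarrow> (nat \<Rightarrow> nat \<Rightarrow> nat \<Rightarrow> nat \<Rightarrow> complex) \<Rightarrow> bool" where
  "row_orthonormal d T \<longleftrightarrow> (\<forall>a<d. \<forall>b<d. \<forall>a'<d. \<forall>b'<d.
     (\<Sum>c<d. \<Sum>e<d. T a b c e * cnj (T a' b' c e)) = (if a = a' \<and> b = b' then 1 else 0))"

lemma pair_eq_iff: "r = r' \<longleftrightarrow> r div d = r' div d \<and> r mod d = r' mod d" for r r' d :: nat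
  by (metis div_mult_mod_eq)

lemma unitary_of_tens_iff: "unitary_mat (d*d) (of_tens d T) \<longleftrightarrow> row_orthonormal d T"
proof -
  have idx: "(of_tens d T * adj_mat (of_tens d T)) $$ (r, r')
      = (\<Sum>c<d. \<Sum>e<d. T (r div d) (r mod d) c e * cnj (T (r' div d) (r' mod d) c e))"
    if "r < d*d" "r' < d*d" for r r'
    unfolding mult_adj_index[OF of_tens_carrier that]
    by (subst sum_pair[symmetric]) (use that in \<open>auto simp: of_tens_def intro!: sum.cong\<close>)
  show ?thesis
  proof
    assume "unitary_mat (d*d) (of_tens d T)"
    then have one: "of_tens d T * adj_mat (of_tens d T) = 1\<^sub>m (d*d)" unfolding unitary_mat_def by simp
    show "row_orthonormal d T"
      unfolding row_orthonormal_def
    proof (intro allI impI)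
      fix a b a' b' assume *: "a < d" "b < d" "a' < d" "b' < d"
      show "(\<Sum>c<d. \<Sum>e<d. T a b c e * cnj (T a' b' c e)) = (if a = a' \<and> b = b' then 1 else 0)"
        using idx[of "a*d+b" "a'*d+b'"] * pair_eq_iff[of "a*d+b" "a'*d+b'" d] unfolding one
        by (simp add: pair_less)
    qed
  next
    assume T: "row_orthonormal d T"
    show "unitary_mat (d*d) (of_tens d T)"
    proof (rule unitary_matI[OF of_tens_carrier], rule eq_matI)
      fix r r' assume "r < dim_row (1\<^sub>m (d*d))" "r' < dim_col (1\<^sub>m (d*d))"
      then have r: "r < d*d" "r' < d*d" by auto
      then have d: "0 < d" by (cases d) auto
      show "(of_tens d T * adj_mat (of_tens d T)) $$ (r, r') = 1\<^sub>m (d*d) $$ (r, r')"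
        using r d T[unfolded row_orthonormal_def, rule_format, of "r div d" "r mod d" "r' div d" "r' mod d"]
          pair_eq_iff[of r r' d]
        by (simp add: idx less_mult_imp_div_less)
    qed (auto simp: of_tens_def adj_mat_def)
  qed
qed

lemma unitary_of_tens_cols:
  assumes "unitary_mat (d*d) (of_tens d T)" and *: "c < d" "e < d" "c' < d" "e' < d"
  shows "(\<Sum>a<d. \<Sum>b<d. T a b c e * cnj (T a b c' e')) = (if c = c' \<and> e = e' then 1 else 0)"
proof -
  have one: "adj_mat (of_tens d T) * of_tens d T = 1\<^sub>m (d*d)" using assms unfolding unitary_mat_def by simp
  have "(adj_mat (of_tens d T) * of_tens d T) $$ (c'*d+e', c*d+e)
      = (\<Sum>a<d. \<Sum>b<d. cnj (T a b c' e') * T a b c e)"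
    unfolding adj_mult_index[OF of_tens_carrier pair_less[OF *(3,4)] pair_less[OF *(1,2)]]
    by (subst sum_pair[symmetric]) (use * in \<open>auto simp: of_tens_def pair_less intro!: sum.cong\<close>)
  then show ?thesis
    using * pair_eq_iff[of "c*d+e" "c'*d+e'" d] unfolding one by (auto simp: pair_less mult.commute)
qed

lemma two_unitary_of_tens_iff:
  "two_unitary d (of_tens d T) \<longleftrightarrow> row_orthonormal d T \<and> row_orthonormal d (\<lambda>a b c e. T a c b e)
     \<and> row_orthonormal d (\<lambda>a b c e. T a e c b)"
  unfolding two_unitary_def realign_of_tens ptrans_of_tens unitary_of_tens_iff ..

lemma of_tens_cover:
  assumes "U \<in> carrier_mat (d*d) (d*d)"
  shows "U = of_tens d (\<lambda>a b c e. U $$ (a*d+b, c*d+e))"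
  using assms by (auto simp: of_tens_def)

lemma tens_of_tens:
  assumes "q \<in> idx d"
  shows "tens d (of_tens d T) q = T (q 0) (q 1) (q 2) (q 3)"
  unfolding tens_def using idx_less[OF assms] by (intro of_tens_index) auto

section \<open>From 2-unitarity to the six two-party reductions\<close>

definition quad :: "nat \<Rightarrow> nat \<Rightarrow> nat \<Rightarrow> nat \<Rightarrow> nat \<Rightarrow> nat" where
  "quad a b c e = (\<lambda>i. undefined)(0 := a, 1 := b, 2 := c, 3 := e)"

lemma quad_simps [simp]:
  "quad a b c e 0 = a" "quad a b c e (Suc 0) = b" "quad a b c e 2 = c" "quad a b c e 3 = e"
  "(quad a b c e)(0 := x) = quad x b c e" "(quad a b c e)(Suc 0 := x) = quad a x c e"
  "(quad a b c e)(2 := x) = quad a b x e" "(quad a b c e)(3 := x) = quad a b c x"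
  unfolding quad_def by (auto simp: fun_eq_iff)

lemma quad_in_idx [simp]: "quad a b c e \<in> idx d \<longleftrightarrow> a < d \<and> b < d \<and> c < d \<and> e < d"
  unfolding idx_def quad_def by (auto simp: PiE_iff extensional_def less_Suc_eq numeral_eq_Suc)

lemma less4_cases: "i < 4 \<longleftrightarrow> i = 0 \<or> i = Suc 0 \<or> i = 2 \<or> i = 3" for i :: nat
  by auto

lemma quad_collapse: "q \<in> idx d \<Longrightarrow> quad (q 0) (q 1) (q 2) (q 3) = q"
  unfolding quad_def idx_def by (auto simp: fun_eq_iff PiE_iff extensional_def less4_cases)

lemma sum_idx_fix:
  fixes F :: "(nat \<Rightarrow> nat) \<Rightarrow> complex"
  assumes "x < d" "y < d"
  shows
    "(\<Sum>q | q \<in> idx d \<and> q 0 = x \<and> q (Suc 0) = y. F q) = (\<Sum>a<d. \<Sum>b<d. F (quad x y a b))"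
    "(\<Sum>q | q \<in> idx d \<and> q 0 = x \<and> q 2 = y. F q) = (\<Sum>a<d. \<Sum>b<d. F (quad x a y b))"
    "(\<Sum>q | q \<in> idx d \<and> q 0 = x \<and> q 3 = y. F q) = (\<Sum>a<d. \<Sum>b<d. F (quad x a b y))"
    "(\<Sum>q | q \<in> idx d \<and> q (Suc 0) = x \<and> q 2 = y. F q) = (\<Sum>a<d. \<Sum>b<d. F (quad a x y b))"
    "(\<Sum>q | q \<in> idx d \<and> q (Suc 0) = x \<and> q 3 = y. F q) = (\<Sum>a<d. \<Sum>b<d. F (quad a x b y))"
    "(\<Sum>q | q \<in> idx d \<and> q 2 = x \<and> q 3 = y. F q) = (\<Sum>a<d. \<Sum>b<d. F (quad a b x y))"
  unfolding sum.cartesian_product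
  subgoal by (rule sum.reindex_bij_witness[of _ "\<lambda>(a, b). quad x y a b" "\<lambda>q. (q (2), q (3))"]) (use assms in \<open>auto simp: idx_less quad_collapse[unfolded One_nat_def]\<close>)
  subgoal by (rule sum.reindex_bij_witness[of _ "\<lambda>(a, b). quad x a y b" "\<lambda>q. (q (Suc 0), q (3))"]) (use assms in \<open>auto simp: idx_less quad_collapse[unfolded One_nat_def]\<close>)
  subgoal by (rule sum.reindex_bij_witness[of _ "\<lambda>(a, b). quad x a b y" "\<lambda>q. (q (Suc 0), q (2))"]) (use assms in \<open>auto simp: idx_less quad_collapse[unfolded One_nat_def]\<close>)
  subgoal by (rule sum.reindex_bij_witness[of _ "\<lambda>(a, b). quad a x y b" "\<lambda>q. (q (0), q (3))"]) (use assms in \<open>auto simp: idx_less quad_collapse[unfolded One_nat_def]\<close>)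
  subgoal by (rule sum.reindex_bij_witness[of _ "\<lambda>(a, b). quad a x b y" "\<lambda>q. (q (0), q (2))"]) (use assms in \<open>auto simp: idx_less quad_collapse[unfolded One_nat_def]\<close>)
  subgoal by (rule sum.reindex_bij_witness[of _ "\<lambda>(a, b). quad a b x y" "\<lambda>q. (q (0), q (Suc 0))"]) (use assms in \<open>auto simp: idx_less quad_collapse[unfolded One_nat_def]\<close>)
  done

text \<open>The rows of U, its realignment and its partial transpose give the pairs of parties 01,
  02 and 03; the columns give the complementary pairs 23, 13 and 12.\<close>

lemma two_unitary_imp_ame:
  assumes "two_unitary d U"
  shows "ame d (tens d U)"
proof -
  define T where "T = (\<lambda>a b c e. U $$ (a*d+b, c*d+e))"
  have "U \<in> carrier_mat (d*d) (d*d)" using assms unfolding two_unitary_def unitary_mat_def by simp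
  then have U: "U = of_tens d T" unfolding T_def by (rule of_tens_cover)
  have un: "unitary_mat (d*d) (of_tens d T)" "unitary_mat (d*d) (of_tens d (\<lambda>a b c e. T a c b e))"
    "unitary_mat (d*d) (of_tens d (\<lambda>a b c e. T a e c b))"
    using assms unfolding two_unitary_def U realign_of_tens ptrans_of_tens by auto
  note rows = un[unfolded unitary_of_tens_iff row_orthonormal_def, rule_format]
  note cols = un[THEN unitary_of_tens_cols]
  have tens: "tens d U q = T (q 0) (q 1) (q 2) (q 3)" for q unfolding tens_def T_def by simp
  show ?thesis
    unfolding ame_def
  proof (intro allI impI)
    fix i j x y x' y' :: nat
    assume ij: "i < 4" "j < 4" "i \<noteq> j" and xy: "x < d" "y < d" "x' < d" "y' < d"
    have main: "(\<Sum>q | q \<in> idx d \<and> q i = x \<and> q j = y. tens d U q * cnj (tens d U (q(i := x', j := y'))))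
         = (if x = x' \<and> y = y' then 1 else 0)"
      if "i < j" "j < 4" "x < d" "y < d" "x' < d" "y' < d" for i j x y x' y' :: nat
    proof -
      have "i = 0 \<and> j = Suc 0 \<or> i = 0 \<and> j = 2 \<or> i = 0 \<and> j = 3 \<or> i = Suc 0 \<and> j = 2 \<or> i = Suc 0 \<and> j = 3 \<or> i = 2 \<and> j = 3"
        using that(1,2) by auto
      \<comment> \<open>The partial transpose lists the two free indices in the opposite order; for
        the same reason its columns are used below with both pairs of arguments exchanged.\<close>
      moreover have "(\<Sum>a<d. \<Sum>b<d. T x a b y * cnj (T x' a b y')) = (if x = x' \<and> y = y' then 1 else 0)"
        by (subst sum.swap) (rule rows(3)[OF that(3-6)])
      ultimately show ?thesis
        using that rows[of x y x' y'] cols[of x y x' y'] cols[of y x y' x']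
        by (elim disjE conjE) (simp_all add: sum_idx_fix tens conj_commute)
    qed
    show "(\<Sum>q | q \<in> idx d \<and> q i = x \<and> q j = y. tens d U q * cnj (tens d U (q(i := x', j := y'))))
         = (if x = x' \<and> y = y' then 1 else 0)"
    proof (cases "i < j")
      case False
      then show ?thesis
        using main[of j i y x y' x'] ij xy fun_upd_twist[OF ij(3), of _ x' y'] by (simp add: conj_ac)
    qed (use main ij xy in simp)
  qed
qed

section \<open>Local unitaries acting on tensors\<close>

lemma tensor_mat_carrier [simp]: "tensor_mat d A B \<in> carrier_mat (d*d) (d*d)"
  unfolding tensor_mat_def by simp

lemma tensor_mat_mult:
  assumes "A \<in> carrier_mat d d" "B \<in> carrier_mat d d" "C \<in> carrier_mat d d" "D \<in> carrier_mat d d"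
  shows "tensor_mat d A B * tensor_mat d C D = tensor_mat d (A * C) (B * D)"
proof (rule eq_matI)
  fix r c assume "r < dim_row (tensor_mat d (A * C) (B * D))" "c < dim_col (tensor_mat d (A * C) (B * D))"
  then have rc: "r < d*d" "c < d*d" by (auto simp: tensor_mat_def)
  then have d: "0 < d" by (cases d) auto
  have "(tensor_mat d A B * tensor_mat d C D) $$ (r, c)
    = (\<Sum>k<d*d. (A $$ (r div d, k div d) * B $$ (r mod d, k mod d)) * (C $$ (k div d, c div d) * D $$ (k mod d, c mod d)))"
    using rc by (auto simp: tensor_mat_def scalar_prod_def lessThan_atLeast0 intro!: sum.cong)
  also have "\<dots> = (\<Sum>a<d. \<Sum>b<d. (A $$ (r div d, a) * B $$ (r mod d, b)) * (C $$ (a, c div d) * D $$ (b, c mod d)))"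
    by (rule sum_pair)
  also have "\<dots> = (\<Sum>a<d. A $$ (r div d, a) * C $$ (a, c div d)) * (\<Sum>b<d. B $$ (r mod d, b) * D $$ (b, c mod d))"
    by (simp add: sum_product mult_ac)
  also have "\<dots> = tensor_mat d (A * C) (B * D) $$ (r, c)"
    using assms rc d less_mult_imp_div_less[OF rc(1)] less_mult_imp_div_less[OF rc(2)]
    by (simp add: tensor_mat_def scalar_prod_def lessThan_atLeast0)
  finally show "(tensor_mat d A B * tensor_mat d C D) $$ (r, c) = tensor_mat d (A * C) (B * D) $$ (r, c)" .
qed (auto simp: tensor_mat_def)

lemma tensor_mat_one: "tensor_mat d (1\<^sub>m d) (1\<^sub>m d) = 1\<^sub>m (d*d)"
proof (rule eq_matI)
  fix r c assume "r < dim_row (1\<^sub>m (d*d))" "c < dim_col (1\<^sub>m (d*d))"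
  then have rc: "r < d*d" "c < d*d" by auto
  then have d: "0 < d" by (cases d) auto
  show "tensor_mat d (1\<^sub>m d) (1\<^sub>m d) $$ (r, c) = 1\<^sub>m (d*d) $$ (r, c)"
    using rc d less_mult_imp_div_less[OF rc(1)] less_mult_imp_div_less[OF rc(2)] pair_eq_iff[of r c d]
    by (simp add: tensor_mat_def)
qed (auto simp: tensor_mat_def)

lemma unitary_matD:
  assumes "unitary_mat n A"
  shows "A \<in> carrier_mat n n" "adj_mat A \<in> carrier_mat n n" "A * adj_mat A = 1\<^sub>m n" "adj_mat A * A = 1\<^sub>m n"
  using assms unfolding unitary_mat_def by auto

text \<open>Two members of the class of V are related by the quotients of their transformations from
  V. If these transformations are close, the quotients are close to the identity, which is the
  situation of \<open>rigidity\<close>.\<close>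

lemma LU_transport:
  assumes u: "unitary_mat d u1" "unitary_mat d u2" "unitary_mat d v1" "unitary_mat d v2"
    and u': "u1' \<in> carrier_mat d d" "u2' \<in> carrier_mat d d" "v1' \<in> carrier_mat d d" "v2' \<in> carrier_mat d d"
    and V: "V \<in> carrier_mat (d*d) (d*d)"
    and U: "U = tensor_mat d u1 u2 * V * tensor_mat d v1 v2"
    and U': "U' = tensor_mat d u1' u2' * V * tensor_mat d v1' v2'"
  shows "U' = tensor_mat d (u1' * adj_mat u1) (u2' * adj_mat u2) * U
            * tensor_mat d (adj_mat v1 * v1') (adj_mat v2 * v2')"
proof -
  note [simp] = u[THEN unitary_matD(1)] u[THEN unitary_matD(2)] u' V
  let ?n = "d * d"
  note [simp] = assoc_mult_mat[of _ ?n ?n _ ?n _ ?n] mult_carrier_mat[of _ ?n ?n _ ?n]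
  have l: "tensor_mat d (adj_mat u1) (adj_mat u2) * (tensor_mat d u1 u2 * X) = X" if "X \<in> carrier_mat ?n ?n" for X
    using that by (subst assoc_mult_mat[symmetric, of _ ?n ?n _ ?n _ ?n])
      (auto simp: tensor_mat_mult u[THEN unitary_matD(4)] tensor_mat_one)
  have r: "tensor_mat d v1 v2 * (tensor_mat d (adj_mat v1) (adj_mat v2) * X) = X" if "X \<in> carrier_mat ?n ?n" for X
    using that by (subst assoc_mult_mat[symmetric, of _ ?n ?n _ ?n _ ?n])
      (auto simp: tensor_mat_mult u[THEN unitary_matD(3)] tensor_mat_one)
  have "tensor_mat d (u1' * adj_mat u1) (u2' * adj_mat u2) * U * tensor_mat d (adj_mat v1 * v1') (adj_mat v2 * v2')
     = (tensor_mat d u1' u2' * tensor_mat d (adj_mat u1) (adj_mat u2)) * U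
       * (tensor_mat d (adj_mat v1) (adj_mat v2) * tensor_mat d v1' v2')"
    by (simp add: tensor_mat_mult)
  also have "\<dots> = U'" unfolding U U' by (simp add: l r)
  finally show ?thesis ..
qed

text \<open>Parties 2 and 3 are column indices, so right multiplication acts on them by the
  transposes of the factors.\<close>

lemma tens_LU:
  assumes U: "U \<in> carrier_mat (d*d) (d*d)" and q: "q \<in> idx d"
    and c: "v1 \<in> carrier_mat d d" "v2 \<in> carrier_mat d d"
  shows "tens d (tensor_mat d u1 u2 * U * tensor_mat d v1 v2) q
    = act d 0 (\<lambda>x y. u1 $$ (x, y)) (act d 1 (\<lambda>x y. u2 $$ (x, y))
       (act d 2 (\<lambda>x y. v1 $$ (y, x)) (act d 3 (\<lambda>x y. v2 $$ (y, x)) (tens d U)))) q"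
proof -
  define T where "T = (\<lambda>a b c e. U $$ (a*d+b, c*d+e))"
  have Ut: "U $$ (k, l) = T (k div d) (k mod d) (l div d) (l mod d)" for k l
    unfolding T_def by simp
  have ql: "q 0 < d" "q 1 < d" "q 2 < d" "q 3 < d" using idx_less[OF q] by auto
  then have d: "0 < d" by simp
  have r: "q 0 * d + q 1 < d*d" and s: "q 2 * d + q 3 < d*d" using ql by (auto simp: pair_less)
  have left: "(tensor_mat d u1 u2 * U) $$ (q 0 * d + q 1, l) = (\<Sum>x<d. \<Sum>y<d. u1 $$ (q 0, x) * u2 $$ (q 1, y) * T x y (l div d) (l mod d))"
    if "l < d*d" for l
  proof -
    have "(tensor_mat d u1 u2 * U) $$ (q 0 * d + q 1, l)
      = (\<Sum>k<d*d. u1 $$ (q 0, k div d) * u2 $$ (q 1, k mod d) * T (k div d) (k mod d) (l div d) (l mod d))"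
      using U r that ql by (auto simp: tensor_mat_def scalar_prod_def lessThan_atLeast0 Ut intro!: sum.cong)
    also have "\<dots> = (\<Sum>x<d. \<Sum>y<d. u1 $$ (q 0, x) * u2 $$ (q 1, y) * T x y (l div d) (l mod d))"
      by (rule sum_pair)
    finally show ?thesis .
  qed
  have "tens d (tensor_mat d u1 u2 * U * tensor_mat d v1 v2) q
      = (\<Sum>l<d*d. (tensor_mat d u1 u2 * U) $$ (q 0 * d + q 1, l) * (v1 $$ (l div d, q 2) * v2 $$ (l mod d, q 3)))"
    unfolding tens_def using U r s ql
    by (auto simp: tensor_mat_def scalar_prod_def lessThan_atLeast0 intro!: sum.cong)
  also have "\<dots> = (\<Sum>l<d*d. (\<Sum>x<d. \<Sum>y<d. u1 $$ (q 0, x) * u2 $$ (q 1, y) * T x y (l div d) (l mod d))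
      * (v1 $$ (l div d, q 2) * v2 $$ (l mod d, q 3)))"
    by (intro sum.cong refl) (simp only: left lessThan_iff)
  also have "\<dots> = (\<Sum>z<d. \<Sum>t<d. (\<Sum>x<d. \<Sum>y<d. u1 $$ (q 0, x) * u2 $$ (q 1, y) * T x y z t) * (v1 $$ (z, q 2) * v2 $$ (t, q 3)))"
    by (rule sum_pair)
  also have "\<dots> = (\<Sum>z<d. \<Sum>t<d. \<Sum>x<d. \<Sum>y<d. u1 $$ (q 0, x) * (u2 $$ (q 1, y) * (v1 $$ (z, q 2) * (v2 $$ (t, q 3) * T x y z t))))"
    unfolding sum_distrib_right by (intro sum.cong refl) (simp add: mult_ac)
  also have "\<dots> = (\<Sum>z<d. \<Sum>x<d. \<Sum>t<d. \<Sum>y<d. u1 $$ (q 0, x) * (u2 $$ (q 1, y) * (v1 $$ (z, q 2) * (v2 $$ (t, q 3) * T x y z t))))"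
    by (intro sum.cong refl sum.swap)
  also have "\<dots> = (\<Sum>x<d. \<Sum>z<d. \<Sum>t<d. \<Sum>y<d. u1 $$ (q 0, x) * (u2 $$ (q 1, y) * (v1 $$ (z, q 2) * (v2 $$ (t, q 3) * T x y z t))))"
    by (rule sum.swap)
  also have "\<dots> = (\<Sum>x<d. \<Sum>z<d. \<Sum>y<d. \<Sum>t<d. u1 $$ (q 0, x) * (u2 $$ (q 1, y) * (v1 $$ (z, q 2) * (v2 $$ (t, q 3) * T x y z t))))"
    by (intro sum.cong refl sum.swap)
  also have "\<dots> = (\<Sum>x<d. \<Sum>y<d. \<Sum>z<d. \<Sum>t<d. u1 $$ (q 0, x) * (u2 $$ (q 1, y) * (v1 $$ (z, q 2) * (v2 $$ (t, q 3) * T x y z t))))"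
    by (intro sum.cong refl sum.swap)
  finally show ?thesis
    unfolding act_def tens_def T_def by (simp add: sum_distrib_left)
qed

section \<open>Total boundedness of the unitary group\<close>

lemma unitary_entry_le:
  assumes "unitary_mat n A" "i < n" "j < n"
  shows "cmod (A $$ (i, j)) \<le> 1" "cmod (adj_mat A $$ (i, j)) \<le> 1"
proof -
  have *: "cmod (A $$ (i, j)) \<le> 1" if "i < n" "j < n" for i j
  proof -
    have "(A * adj_mat A) $$ (i, i) = 1" using unitary_matD[OF assms(1)] that by simp
    then have "(\<Sum>k<n. A $$ (i, k) * cnj (A $$ (i, k))) = 1"
      using mult_adj_index[OF unitary_matD(1)[OF assms(1)] that(1) that(1)] by simp
    then have "complex_of_real (\<Sum>k<n. (cmod (A $$ (i, k)))\<^sup>2) = 1"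
      unfolding of_real_sum complex_norm_square .
    then have "(\<Sum>k<n. (cmod (A $$ (i, k)))\<^sup>2) = 1" by (simp only: of_real_eq_1_iff)
    moreover have "(cmod (A $$ (i, j)))\<^sup>2 \<le> (\<Sum>k<n. (cmod (A $$ (i, k)))\<^sup>2)"
      by (rule member_le_sum) (use that in auto)
    ultimately have "(cmod (A $$ (i, j)))\<^sup>2 \<le> 1\<^sup>2" by simp
    then show ?thesis by (rule power2_le_imp_le) simp
  qed
  show "cmod (A $$ (i, j)) \<le> 1" by (rule *) (use assms in auto)
  show "cmod (adj_mat A $$ (i, j)) \<le> 1"
    using *[OF assms(3,2)] assms unitary_matD(1)[OF assms(1)] by (simp add: adj_mat_def)
qed

text \<open>Subtracting the unitarity relation of u leaves \<open>u' - u\<close> times a unitary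
  matrix, whose entries have modulus at most 1; the factor d counts the summands.\<close>

lemma near_unitary_quotient:
  assumes u: "unitary_mat d u" and u': "unitary_mat d u'"
    and near: "\<And>i j. i < d \<Longrightarrow> j < d \<Longrightarrow> cmod (u' $$ (i, j) - u $$ (i, j)) \<le> \<theta>"
    and ij: "i < d" "j < d"
  shows "cmod ((u' * adj_mat u) $$ (i, j) - (if i = j then 1 else 0)) \<le> real d * \<theta>"
    "cmod ((adj_mat u * u') $$ (i, j) - (if i = j then 1 else 0)) \<le> real d * \<theta>"
proof -
  note [simp] = unitary_matD(1,2)[OF u] unitary_matD(1)[OF u']
  have p: "(A * B) $$ (i, j) = (\<Sum>k<d. A $$ (i, k) * B $$ (k, j))"
    if "A \<in> carrier_mat d d" "B \<in> carrier_mat d d" for A B :: "complex mat"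
    using that ij by (auto simp: scalar_prod_def lessThan_atLeast0 intro!: sum.cong)
  have "(u' * adj_mat u) $$ (i, j) - (if i = j then 1 else 0) = (u' * adj_mat u) $$ (i, j) - (u * adj_mat u) $$ (i, j)"
    using ij unitary_matD(3)[OF u] by simp
  also have "\<dots> = (\<Sum>k<d. (u' $$ (i, k) - u $$ (i, k)) * adj_mat u $$ (k, j))"
    by (simp add: p sum_subtractf left_diff_distrib)
  also have "cmod \<dots> \<le> (\<Sum>k<d. \<theta> * 1)"
  proof (rule sum_norm_le)
    fix k assume "k \<in> {..<d}"
    then show "cmod ((u' $$ (i, k) - u $$ (i, k)) * adj_mat u $$ (k, j)) \<le> \<theta> * 1"
      unfolding norm_mult using near[OF ij(1), of k] unitary_entry_le(2)[OF u, of k j] ij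
      by (intro mult_mono) (auto intro: order_trans[OF norm_ge_zero])
  qed
  finally show "cmod ((u' * adj_mat u) $$ (i, j) - (if i = j then 1 else 0)) \<le> real d * \<theta>" by simp
  have "(adj_mat u * u') $$ (i, j) - (if i = j then 1 else 0) = (adj_mat u * u') $$ (i, j) - (adj_mat u * u) $$ (i, j)"
    using ij unitary_matD(4)[OF u] by simp
  also have "\<dots> = (\<Sum>k<d. adj_mat u $$ (i, k) * (u' $$ (k, j) - u $$ (k, j)))"
    by (simp add: p sum_subtractf right_diff_distrib)
  also have "cmod \<dots> \<le> (\<Sum>k<d. 1 * \<theta>)"
  proof (rule sum_norm_le)
    fix k assume "k \<in> {..<d}"
    then show "cmod (adj_mat u $$ (i, k) * (u' $$ (k, j) - u $$ (k, j))) \<le> 1 * \<theta>"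
      unfolding norm_mult using near[of k j] unitary_entry_le(2)[OF u, of i k] ij
      by (intro mult_mono) auto
  qed
  finally show "cmod ((adj_mat u * u') $$ (i, j) - (if i = j then 1 else 0)) \<le> real d * \<theta>" by simp
qed

text \<open>The cell of side h that contains each entry, real and imaginary parts separately.
  Unitary matrices meet only finitely many cells, and two in the same cell differ by at most 2 h in
  every entry.\<close>

definition grid :: "nat \<Rightarrow> real \<Rightarrow> complex mat \<Rightarrow> nat \<times> nat \<Rightarrow> int \<times> int" where
  "grid d h A = (\<lambda>(i, j)\<in>{..<d} \<times> {..<d}. (\<lfloor>Re (A $$ (i, j)) / h\<rfloor>, \<lfloor>Im (A $$ (i, j)) / h\<rfloor>))"

lemma finite_grid:
  assumes h: "0 < h"
  shows "finite (grid d h ` {A. unitary_mat d A})"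
proof -
  define N where "N = \<lceil>1 / h\<rceil> + 1"
  have "\<lfloor>x / h\<rfloor> \<in> {-N..N}" if "\<bar>x\<bar> \<le> 1" for x
  proof -
    have "x / h \<le> 1 / h" "- (1 / h) \<le> x / h"
      using divide_right_mono[of x 1 h] divide_right_mono[of "- 1" x h] that h by auto
    then show ?thesis unfolding N_def by (auto simp: floor_le_iff le_floor_iff) linarith+
  qed
  then have "grid d h A \<in> ({..<d} \<times> {..<d}) \<rightarrow>\<^sub>E ({-N..N} \<times> {-N..N})" if "unitary_mat d A" for A
    using order_trans[OF abs_Re_le_cmod unitary_entry_le(1)[OF that]]
      order_trans[OF abs_Im_le_cmod unitary_entry_le(1)[OF that]]
    unfolding grid_def by (intro restrict_PiE_iff[THEN iffD2] ballI) (auto simp del: atLeastAtMost_iff)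
  then have "grid d h ` {A. unitary_mat d A} \<subseteq> ({..<d} \<times> {..<d}) \<rightarrow>\<^sub>E ({-N..N} \<times> {-N..N})" by blast
  then show ?thesis by (rule finite_subset) (intro finite_PiE, auto)
qed

lemma grid_near:
  assumes "grid d h A = grid d h B" "i < d" "j < d" "0 < h"
  shows "cmod (A $$ (i, j) - B $$ (i, j)) \<le> 2 * h"
proof -
  have *: "\<lfloor>Re (A $$ (i, j)) / h\<rfloor> = \<lfloor>Re (B $$ (i, j)) / h\<rfloor>" "\<lfloor>Im (A $$ (i, j)) / h\<rfloor> = \<lfloor>Im (B $$ (i, j)) / h\<rfloor>"
    using fun_cong[OF assms(1), of "(i, j)"] assms(2,3) unfolding grid_def by auto
  have "\<bar>x - y\<bar> \<le> h" if "\<lfloor>x / h\<rfloor> = \<lfloor>y / h\<rfloor>" for x y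
  proof -
    have "\<bar>x / h - y / h\<bar> \<le> 1" using that by linarith
    then show ?thesis using assms(4) by (simp add: diff_divide_distrib[symmetric] abs_divide divide_le_eq)
  qed
  from this[OF *(1)] this[OF *(2)] show ?thesis
    using cmod_le[of "A $$ (i, j) - B $$ (i, j)"] by simp
qed

section \<open>From uniform separation to infinitely many classes\<close>

lemma unitary_one: "unitary_mat d (1\<^sub>m d)"
proof -
  have "adj_mat (1\<^sub>m d) = 1\<^sub>m d" by (rule eq_matI) (auto simp: adj_mat_def)
  then show ?thesis unfolding unitary_mat_def by simp
qed

lemma LU_equiv_refl:
  assumes "U \<in> carrier_mat (d*d) (d*d)"
  shows "LU_equiv d U U"
  unfolding LU_equiv_def
  by (intro exI[of _ "1\<^sub>m d"]) (use assms in \<open>simp add: unitary_one tensor_mat_one\<close>)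

lemma ex_small_radius:
  assumes "0 < \<rho>" "1 \<le> d"
  shows "\<exists>\<kappa>>0. 2 * real d * \<kappa> * (1056 * real d * (1 + \<rho>)) < \<rho> \<and> 2 * real d * \<kappa> \<le> 1"
proof -
  \<comment> \<open>The first summand stands for the main bound, the second for the requirement that
    \<open>2 * real d * \<kappa>\<close> be at most 1, multiplied by \<rho>. Both products are
    nonnegative with sum \<open>\<rho> / 2\<close>, hence each is below \<rho>.\<close>
  define C where "C = 2 * real d * (1056 * real d * (1 + \<rho>)) + 2 * real d * \<rho>"
  have C: "0 < C" unfolding C_def using assms by (intro add_pos_pos mult_pos_pos) auto
  define \<kappa> where "\<kappa> = \<rho> / (2 * C)"
  have \<kappa>: "0 < \<kappa>" "\<kappa> * C = \<rho> / 2" unfolding \<kappa>_def using C assms by auto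
  have e: "2 * real d * \<kappa> * (1056 * real d * (1 + \<rho>)) + (2 * real d * \<kappa>) * \<rho> = \<rho> / 2"
    using \<kappa>(2) unfolding C_def by (simp add: algebra_simps)
  have p: "0 \<le> 2 * real d * \<kappa> * (1056 * real d * (1 + \<rho>))" "0 \<le> (2 * real d * \<kappa>) * \<rho>"
    using assms \<kappa> by (auto intro!: mult_nonneg_nonneg)
  have "(2 * real d * \<kappa>) * \<rho> \<le> 1 * \<rho>" using e p assms by linarith
  then have "2 * real d * \<kappa> \<le> 1" using assms(1) by (rule mult_right_le_imp_le)
  then show ?thesis using e p assms \<kappa>(1) by (intro exI[of _ \<kappa>]) linarith
qed

text \<open>The pigeonhole principle is applied twice: some class contains infinitely many members
  of F, and among these two have transformations from a common V in the same grid cell. They are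
  related by local factors near the identity, against \<open>rigidity\<close>.\<close>

lemma infinite_LU_classes:
  assumes inf: "infinite F" and F: "F \<subseteq> {U. two_unitary d U}" and d: "1 \<le> d" and \<rho>: "0 < \<rho>"
    and sep: "\<And>U U'. U \<in> F \<Longrightarrow> U' \<in> F \<Longrightarrow> U \<noteq> U' \<Longrightarrow> \<exists>\<phi> s.
      (\<forall>i<4. \<forall>X. ip d \<phi> (act d i X (tens d U)) = 0) \<and> ip d \<phi> (tens d U') \<noteq> 0 \<and>
      \<rho> * (nrm d \<phi> * nrm d (\<lambda>q. tens d U' q - s * tens d U q)) \<le> cmod (ip d \<phi> (tens d U'))"
  shows "infinite ({U. two_unitary d U} // LU_rel d)"
proof
  assume fin: "finite ({U. two_unitary d U} // LU_rel d)"
  have carr: "U \<in> carrier_mat (d*d) (d*d)" if "U \<in> F" for U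
    using that F unfolding two_unitary_def unitary_mat_def by auto
  have "finite ((\<lambda>U. LU_rel d `` {U}) ` F)"
    by (rule finite_subset[OF _ fin]) (use F in \<open>auto intro: quotientI\<close>)
  then obtain V where V: "V \<in> F" and infV: "infinite {U \<in> F. LU_rel d `` {U} = LU_rel d `` {V}}"
    using pigeonhole_infinite[OF inf] by blast
  define G where "G = {U \<in> F. LU_rel d `` {U} = LU_rel d `` {V}}"
  define P where "P = (\<lambda>U (u1, u2, v1, v2). unitary_mat d u1 \<and> unitary_mat d u2 \<and>
      unitary_mat d v1 \<and> unitary_mat d v2 \<and> U = tensor_mat d u1 u2 * V * tensor_mat d v1 v2)"
  define g where "g = (\<lambda>U. SOME g. P U g)"
  have g: "P U (g U)" if "U \<in> G" for U
  proof -
    \<comment> \<open>Reflexivity puts U into its own image, which is also the image of V.\<close>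
    have "U \<in> LU_rel d `` {U}" using LU_equiv_refl[OF carr, of U] that unfolding LU_rel_def G_def by auto
    then have "LU_equiv d V U" using that unfolding G_def LU_rel_def by auto
    then obtain u1 u2 v1 v2 where "P U (u1, u2, v1, v2)" unfolding LU_equiv_def P_def by auto
    then show ?thesis unfolding g_def by (rule someI)
  qed
  obtain \<kappa> where \<kappa>: "0 < \<kappa>" "2 * real d * \<kappa> * (1056 * real d * (1 + \<rho>)) < \<rho>" "2 * real d * \<kappa> \<le> 1"
    using ex_small_radius[OF \<rho> d] by blast
  \<comment> \<open>Sharing a cell means entrywise distance at most 2 h, and passing to the quotient
    costs a factor d.\<close>
  define h where "h = \<kappa> / (2 * real d)"
  have h: "0 < h" "real d * (2 * h) = \<kappa>" unfolding h_def using \<kappa> d by auto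
  define code where "code = (\<lambda>U. case g U of (u1, u2, v1, v2) \<Rightarrow> (grid d h u1, grid d h u2, grid d h v1, grid d h v2))"
  let ?R = "grid d h ` {A. unitary_mat d A}"
  have "code ` G \<subseteq> ?R \<times> ?R \<times> ?R \<times> ?R"
  proof (rule image_subsetI)
    fix U assume "U \<in> G"
    from g[OF this] show "code U \<in> ?R \<times> ?R \<times> ?R \<times> ?R"
      unfolding code_def P_def by (cases "g U") auto
  qed
  then have "finite (code ` G)"
    by (rule finite_subset) (intro finite_cartesian_product finite_grid h)
  then obtain U where U: "U \<in> G" and "infinite {U' \<in> G. code U' = code U}"
    using pigeonhole_infinite[of G code] infV unfolding G_def[symmetric] by blast
  then have "infinite ({U' \<in> G. code U' = code U} - {U})" by simp
  then obtain U' where U': "U' \<in> G" "code U' = code U" "U' \<noteq> U"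
    by (cases "{U' \<in> G. code U' = code U} - {U} = {}") auto
  obtain u1 u2 v1 v2 where gU: "g U = (u1, u2, v1, v2)" by (cases "g U")
  obtain w1 w2 x1 x2 where gU': "g U' = (w1, w2, x1, x2)" by (cases "g U'")
  have u: "unitary_mat d u1" "unitary_mat d u2" "unitary_mat d v1" "unitary_mat d v2"
    "U = tensor_mat d u1 u2 * V * tensor_mat d v1 v2"
    using g[OF U] unfolding gU P_def by auto
  have w: "unitary_mat d w1" "unitary_mat d w2" "unitary_mat d x1" "unitary_mat d x2"
    "U' = tensor_mat d w1 w2 * V * tensor_mat d x1 x2"
    using g[OF U'(1)] unfolding gU' P_def by auto
  have codes: "grid d h w1 = grid d h u1" "grid d h w2 = grid d h u2" "grid d h x1 = grid d h v1" "grid d h x2 = grid d h v2"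
    using U'(2) unfolding code_def gU gU' by auto
  have UF: "U \<in> F" "U' \<in> F" using U U' unfolding G_def by auto
  have U'eq: "U' = tensor_mat d (w1 * adj_mat u1) (w2 * adj_mat u2) * U * tensor_mat d (adj_mat v1 * x1) (adj_mat v2 * x2)"
    by (rule LU_transport[OF u(1-4) w(1-4)[THEN unitary_matD(1)] carr[OF V] u(5) w(5)])
  define W :: "nat \<Rightarrow> nat \<Rightarrow> nat \<Rightarrow> complex" where
    "W = (\<lambda>i x y. if i = 0 then (w1 * adj_mat u1) $$ (x, y) else if i = 1 then (w2 * adj_mat u2) $$ (x, y)
      else if i = 2 then (adj_mat v1 * x1) $$ (y, x) else (adj_mat v2 * x2) $$ (y, x))"
  have near: "cmod (W i x y - (if x = y then 1 else 0)) \<le> \<kappa>" if "i < 4" "x < d" "y < d" for i x y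
    using near_unitary_quotient(1)[OF u(1) w(1) grid_near[OF codes(1) _ _ h(1)] that(2,3)]
      near_unitary_quotient(1)[OF u(2) w(2) grid_near[OF codes(2) _ _ h(1)] that(2,3)]
      near_unitary_quotient(2)[OF u(3) w(3) grid_near[OF codes(3) _ _ h(1)] that(3,2)]
      near_unitary_quotient(2)[OF u(4) w(4) grid_near[OF codes(4) _ _ h(1)] that(3,2)]
    unfolding h(2) W_def by (cases "x = y") (simp_all add: eq_commute[of y x])
  obtain \<phi> s where \<phi>: "\<And>i X. i < 4 \<Longrightarrow> ip d \<phi> (act d i X (tens d U)) = 0" "ip d \<phi> (tens d U') \<noteq> 0"
      "\<rho> * (nrm d \<phi> * nrm d (\<lambda>q. tens d U' q - s * tens d U q)) \<le> cmod (ip d \<phi> (tens d U'))"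
    using sep[OF UF] U'(3) by metis
  have c: "adj_mat v1 * x1 \<in> carrier_mat d d" "adj_mat v2 * x2 \<in> carrier_mat d d"
    by (rule mult_carrier_mat[OF unitary_matD(2)[OF u(3)] unitary_matD(1)[OF w(3)]],
        rule mult_carrier_mat[OF unitary_matD(2)[OF u(4)] unitary_matD(1)[OF w(4)]])
  have act: "tens d U' q = act d 0 (W 0) (act d 1 (W 1) (act d 2 (W 2) (act d 3 (W 3) (tens d U)))) q"
    if "q \<in> idx d" for q
    by (subst U'eq, subst tens_LU[OF carr[OF UF(1)] that c]) (simp add: W_def)
  have "ame d (tens d U)" using two_unitary_imp_ame F UF(1) by blast
  then show False
    by (rule rigidity[OF _ d \<rho> near \<kappa>(2,3) \<phi>(1) act \<phi>(2,3)])
qed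

section \<open>Phase families on orthogonal arrays\<close>

text \<open>An orthogonal array of strength 2 and index 1, given by its set of rows. For s = 4 it is
  a pair of orthogonal Latin squares: coordinates 0 and 1 name a cell, 2 and 3 its two
  symbols.\<close>

definition orth_array :: "nat \<Rightarrow> nat \<Rightarrow> (nat \<Rightarrow> nat) set \<Rightarrow> bool" where
  "orth_array s n B \<longleftrightarrow> B \<subseteq> {..<s} \<rightarrow>\<^sub>E {..<n} \<and>
     (\<forall>i<s. \<forall>j<s. i \<noteq> j \<longrightarrow> (\<forall>x<n. \<forall>y<n. \<exists>!q. q \<in> B \<and> q i = x \<and> q j = y))"

lemma infinite_unit_circle: "infinite {z :: complex. cmod z = 1}"
proof
  assume "finite {z :: complex. cmod z = 1}"
  moreover have "(\<lambda>t. Complex t (sqrt (1 - t\<^sup>2))) ` {0<..<1} \<subseteq> {z. cmod z = 1}"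
    by (auto simp: cmod_def power_le_one)
  ultimately have "finite ((\<lambda>t. Complex t (sqrt (1 - t\<^sup>2))) ` {0<..<1::real})"
    by (rule rev_finite_subset)
  moreover have "inj_on (\<lambda>t. Complex t (sqrt (1 - t\<^sup>2))) {0<..<1::real}"
    by (auto simp: inj_on_def)
  ultimately have "finite {0<..<1::real}" by (rule finite_imageD)
  then show False using infinite_Ioo[of 0 "1::real"] by simp
qed

context
  fixes d :: nat and B :: "(nat \<Rightarrow> nat) set"
  assumes B: "orth_array 4 d B"
begin

lemma block_idx: "q \<in> B \<Longrightarrow> q \<in> idx d"
  using B unfolding orth_array_def idx_def by auto

lemma block_less: "q \<in> B \<Longrightarrow> i < 4 \<Longrightarrow> q i < d"
  using block_idx idx_less by blast

lemma block_collapse: "q \<in> B \<Longrightarrow> quad (q 0) (q (Suc 0)) (q 2) (q 3) = q"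
  using quad_collapse[OF block_idx] by simp

lemma finite_blocks: "finite B"
  by (rule finite_subset[OF _ finite_idx[of d]]) (use block_idx in auto)

lemma block_unique:
  assumes "q \<in> B" "r \<in> B" "i < 4" "j < 4" "i \<noteq> j" "q i = r i" "q j = r j"
  shows "q = r"
proof -
  have "r i < d" "r j < d" using assms block_less by auto
  then have "\<exists>!q. q \<in> B \<and> q i = r i \<and> q j = r j" using B assms(3-5) unfolding orth_array_def by blast
  then show ?thesis using assms by blast
qed

lemma block_exists:
  assumes "i < 4" "j < 4" "i \<noteq> j" "x < d" "y < d"
  obtains q where "q \<in> B" "q i = x" "q j = y"
proof -
  have "\<exists>!q. q \<in> B \<and> q i = x \<and> q j = y" using B assms unfolding orth_array_def by blast
  then show ?thesis using that by blast
qed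

text \<open>Two coordinates determine a block, and a change in one coordinate leaves three in
  place.\<close>

lemma block_upd:
  assumes "q \<in> B" "i < 4"
  shows "q(i := x) \<in> B \<longleftrightarrow> x = q i"
proof
  assume *: "q(i := x) \<in> B"
  obtain j k :: nat where jk: "j < 4" "k < 4" "j \<noteq> k" "j \<noteq> i" "k \<noteq> i"
    by (rule that[of "if i = 0 then 1 else 0" "if i \<le> 1 then 2 else 1"]) auto
  have "q(i := x) = q" by (rule block_unique[OF * assms(1) jk(1-3)]) (use jk in auto)
  then show "x = q i" by (metis fun_upd_same)
qed (use assms in simp)

lemma block_pair_sum:
  fixes c :: "'a :: comm_monoid_add"
  assumes "i < 4" "j < 4" "i \<noteq> j" "x < d" "y < d"
  shows "(\<Sum>q\<in>B. if q i = x \<and> q j = y then c else 0) = c"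
proof -
  obtain q0 where q0: "q0 \<in> B" "q0 i = x" "q0 j = y" using block_exists[OF assms] by blast
  have "q i = x \<and> q j = y \<longleftrightarrow> q = q0" if "q \<in> B" for q
    using block_unique[OF that q0(1) assms(1-3)] q0 by auto
  then have "(\<Sum>q\<in>B. if q i = x \<and> q j = y then c else 0) = (\<Sum>q\<in>B. if q = q0 then c else 0)"
    by (intro sum.cong) auto
  then show ?thesis using q0 finite_blocks by simp
qed

lemma block_line_sum:
  fixes c :: complex
  assumes "i < 4" "x < d"
  shows "(\<Sum>q\<in>B. if q i = x then c else 0) = of_nat d * c"
proof -
  obtain j :: nat where j: "j < 4" "i \<noteq> j" by (rule that[of "if i = 0 then 1 else 0"]) auto
  have "(\<Sum>q\<in>B. if q i = x then c else 0) = (\<Sum>q\<in>B. \<Sum>y<d. if q i = x \<and> q j = y then c else 0)"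
  proof (intro sum.cong refl)
    fix q assume "q \<in> B"
    then have "(\<Sum>y<d. if y = q j then (if q i = x then c else 0) else 0) = (if q i = x then c else 0)"
      using block_less[of q j] j by simp
    moreover have "(\<Sum>y<d. if q i = x \<and> q j = y then c else 0) = (\<Sum>y<d. if y = q j then (if q i = x then c else 0) else 0)"
      by (intro sum.cong) auto
    ultimately show "(if q i = x then c else 0) = (\<Sum>y<d. if q i = x \<and> q j = y then c else 0)" by simp
  qed
  also have "\<dots> = (\<Sum>y<d. \<Sum>q\<in>B. if q i = x \<and> q j = y then c else 0)" by (rule sum.swap)
  also have "\<dots> = (\<Sum>y<d. c)" by (intro sum.cong refl block_pair_sum) (use assms j in auto)
  finally show ?thesis by simp
qed

section \<open>Permutation tensors with one phase\<close>

definition phase_tens :: "(nat \<Rightarrow> nat) \<Rightarrow> complex \<Rightarrow> (nat \<Rightarrow> nat) \<Rightarrow> complex" where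
  "phase_tens q0 z q = (if q \<in> B then if q = q0 then z else 1 else 0)"

text \<open>The map f distributes row and column indices over the four slots, so one argument covers
  U, its realignment and its partial transpose. Off the diagonal no product survives since two
  blocks agreeing in slots k and l coincide; on it the phases cancel.\<close>

lemma phase_tens_rows:
  fixes f :: "nat \<Rightarrow> nat \<Rightarrow> nat \<Rightarrow> nat \<Rightarrow> nat \<Rightarrow> nat"
  assumes z: "cmod z = 1" and i: "i < 4" "j < 4" "i \<noteq> j" "k < 4" "l < 4" "k \<noteq> l"
    and f: "\<And>a b c e. f a b c e i = a" "\<And>a b c e. f a b c e j = b" "\<And>a b c e. f a b c e k = c" "\<And>a b c e. f a b c e l = e"
    and collapse: "\<And>q. q \<in> B \<Longrightarrow> f (q i) (q j) (q k) (q l) = q"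
  shows "row_orthonormal d (\<lambda>a b c e. phase_tens q0 z (f a b c e))"
  unfolding row_orthonormal_def
proof (intro allI impI)
  fix a b a' b' assume ab: "a < d" "b < d" "a' < d" "b' < d"
  let ?P = "phase_tens q0 z"
  have PP: "?P q * cnj (?P q) = (if q \<in> B then 1 else 0)" for q
    using z complex_norm_square[of z] by (simp add: phase_tens_def)
  show "(\<Sum>c<d. \<Sum>e<d. ?P (f a b c e) * cnj (?P (f a' b' c e))) = (if a = a' \<and> b = b' then 1 else 0)"
  proof (cases "a = a' \<and> b = b'")
    case True
    obtain q where q: "q \<in> B" "q i = a" "q j = b" using block_exists[OF i(1-3) ab(1,2)] by blast
    have "?P (f a b c e) * cnj (?P (f a b c e)) = (if e = q l then if c = q k then 1 else 0 else 0)" for c e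
    proof -
      have "f a b c e \<in> B \<longleftrightarrow> c = q k \<and> e = q l"
      proof
        assume "f a b c e \<in> B"
        then have "f a b c e = q" using block_unique[OF _ q(1) i(1-3)] f q by simp
        then show "c = q k \<and> e = q l" using f(3,4)[of a b c e] by simp
      next
        assume "c = q k \<and> e = q l"
        then show "f a b c e \<in> B" using q collapse[OF q(1)] by simp
      qed
      then show ?thesis unfolding PP by simp
    qed
    then have "(\<Sum>c<d. \<Sum>e<d. ?P (f a b c e) * cnj (?P (f a b c e))) = (\<Sum>c<d. if c = q k then 1 else 0)"
      using block_less[OF q(1) i(5)] by simp
    then show ?thesis using True block_less[OF q(1) i(4)] by simp
  next
    case False
    have "?P (f a b c e) * cnj (?P (f a' b' c e)) = 0" for c e
    proof (rule ccontr)
      assume "?P (f a b c e) * cnj (?P (f a' b' c e)) \<noteq> 0"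
      then have *: "f a b c e \<in> B" "f a' b' c e \<in> B" unfolding phase_tens_def by (auto split: if_splits)
      have "f a b c e = f a' b' c e" by (rule block_unique[OF * i(4-6)]) (simp_all add: f)
      then show False using False f(1,2)[of a b c e] f(1,2)[of a' b' c e] by simp
    qed
    then have "(\<Sum>c<d. \<Sum>e<d. ?P (f a b c e) * cnj (?P (f a' b' c e))) = 0"
      by (intro sum.neutral ballI)
    then show ?thesis using False by simp
  qed
qed

definition phase_mat :: "(nat \<Rightarrow> nat) \<Rightarrow> complex \<Rightarrow> complex mat" where
  "phase_mat q0 z = of_tens d (\<lambda>a b c e. phase_tens q0 z (quad a b c e))"

lemma two_unitary_phase_mat:
  assumes "cmod z = 1"
  shows "two_unitary d (phase_mat q0 z)"
  unfolding phase_mat_def two_unitary_of_tens_iff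
  by (intro conjI phase_tens_rows[OF assms, of 0 1 2 3 quad] phase_tens_rows[OF assms, of 0 2 1 3 "\<lambda>a b c e. quad a c b e"]
      phase_tens_rows[OF assms, of 0 3 2 1 "\<lambda>a b c e. quad a e c b"])
    (simp_all add: block_collapse)

lemma tens_phase_mat: "q \<in> idx d \<Longrightarrow> tens d (phase_mat q0 z) q = phase_tens q0 z q"
  unfolding phase_mat_def by (simp only: tens_of_tens quad_collapse)

text \<open>The weight is the component of the indicator of \<^term>\<open>q0\<close> that is orthogonal to all
  functions of a single coordinate; it is nonzero at \<^term>\<open>q0\<close> precisely when \<open>d > 3\<close>.\<close>

definition weight :: "(nat \<Rightarrow> nat) \<Rightarrow> (nat \<Rightarrow> nat) \<Rightarrow> complex" where
  "weight q0 q = (if q = q0 then 1 else 0) - (\<Sum>j<4. if q j = q0 j then 1 else 0) / of_nat d + 3 / (of_nat d)\<^sup>2"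

text \<open>On the line \<open>q i = x\<close> the indicator of coordinate i adds up to d or 0, and
  each of the three others to 1 because exactly one block meets both conditions. The constant 3 over
  d squared, summed over d blocks, balances these three.\<close>

lemma weight_line_sum:
  assumes q0: "q0 \<in> B" and i: "i < 4" and x: "x < d"
  shows "(\<Sum>q\<in>B. if q i = x then weight q0 q else 0) = 0"
proof -
  have d: "d \<noteq> 0" using x by simp
  have line: "(\<Sum>q\<in>B. if q i = x then (if q j = q0 j then 1 else 0) else 0 :: complex)
      = (if j = i then (if x = q0 i then of_nat d else 0) else 1)" if "j < 4" for j
  proof (cases "j = i")
    case True
    then have "(\<Sum>q\<in>B. if q i = x then (if q j = q0 j then 1 else 0) else 0 :: complex)
      = (\<Sum>q\<in>B. if q i = x then (if x = q0 i then 1 else 0) else 0)"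
      by (intro sum.cong) auto
    then show ?thesis using True by (simp only: block_line_sum[OF i x]) simp
  next
    case False
    have "(\<Sum>q\<in>B. if q i = x then (if q j = q0 j then 1 else 0) else 0 :: complex)
      = (\<Sum>q\<in>B. if q i = x \<and> q j = q0 j then 1 else 0)"
      by (intro sum.cong) auto
    also have "\<dots> = 1" by (rule block_pair_sum) (use False that i x block_less[OF q0] in auto)
    finally show ?thesis using False by simp
  qed
  have "(\<Sum>q\<in>B. if q i = x then weight q0 q else 0)
    = (\<Sum>q\<in>B. (if q = q0 then (if x = q0 i then 1 else 0) else 0)
        - (\<Sum>j<4. if q i = x then (if q j = q0 j then 1 else 0) else 0) / of_nat d
        + (if q i = x then 3 / (of_nat d)\<^sup>2 else 0))"
    unfolding weight_def by (intro sum.cong refl) auto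
  also have "\<dots> = (\<Sum>q\<in>B. if q = q0 then (if x = q0 i then 1 else 0) else 0)
      - (\<Sum>j<4. \<Sum>q\<in>B. if q i = x then (if q j = q0 j then 1 else 0) else 0) / of_nat d
      + (\<Sum>q\<in>B. if q i = x then 3 / (of_nat d)\<^sup>2 else 0)"
    unfolding sum.distrib sum_subtractf sum_divide_distrib[symmetric] by (subst sum.swap) simp
  also have "(\<Sum>q\<in>B. if q = q0 then (if x = q0 i then 1 else 0) else 0 :: complex) = (if x = q0 i then 1 else 0)"
    using q0 finite_blocks by simp
  also have "(\<Sum>j<4. \<Sum>q\<in>B. if q i = x then (if q j = q0 j then 1 else 0) else 0 :: complex)
      = (\<Sum>j<4. if j = i then (if x = q0 i then of_nat d else 0) else 1)"
    by (intro sum.cong refl line) simp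
  also have "\<dots> = (if x = q0 i then of_nat d else 0) + 3"
    using i unfolding less4_cases by (auto simp: numeral_eq_Suc)
  also have "(\<Sum>q\<in>B. if q i = x then 3 / (of_nat d)\<^sup>2 else 0) = of_nat d * (3 / (of_nat d)\<^sup>2 :: complex)"
    by (rule block_line_sum[OF i x])
  finally show ?thesis using d by (cases "x = q0 i") (simp_all add: field_simps power2_eq_square)
qed

lemma weight_self: "weight q0 q0 = of_real ((real d - 1) * (real d - 3) / (real d)\<^sup>2)" if "d \<noteq> 0"
proof -
  have "weight q0 q0 = 1 - 4 / of_nat d + 3 / (of_nat d)\<^sup>2" unfolding weight_def by simp
  also have "\<dots> = of_real ((real d - 1) * (real d - 3) / (real d)\<^sup>2)"
    using that by (simp add: field_simps power2_eq_square)
  finally show ?thesis .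
qed

lemma infinite_LU_classes_orth_array:
  assumes d: "4 \<le> d"
  shows "infinite ({U. two_unitary d U} // LU_rel d)"
proof -
  obtain q0 where q0: "q0 \<in> B" using block_exists[of 0 1 0 0] d by auto
  define M where "M = nrm d (\<lambda>q. if q \<in> B then weight q0 q else 0)"
  define f0 where "f0 = (real d - 1) * (real d - 3) / (real d)\<^sup>2"
  have f0: "0 < f0" "weight q0 q0 = of_real f0" using d weight_self[of q0] unfolding f0_def by auto
  \<comment> \<open>Below, the inner product has modulus \<open>f0 * cmod (z' - z)\<close>, while
    \<open>\<phi>\<close> has norm M and the displacement norm \<open>cmod (z' - z)\<close>. The
    ratio is thus \<open>f0 / M\<close> for every pair; adding 1 only keeps the denominator
    positive.\<close>
  define \<rho> where "\<rho> = f0 / (M + 1)"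
  have M: "0 < M + 1" unfolding M_def by (rule add_nonneg_pos) simp_all
  have \<rho>: "0 < \<rho>" "\<rho> * M \<le> f0" unfolding \<rho>_def using M f0 by (auto simp: field_simps)
  let ?F = "phase_mat q0 ` {z. cmod z = 1}"
  have tens0: "tens d (phase_mat q0 z) q0 = z" for z
    using q0 by (simp add: tens_phase_mat block_idx phase_tens_def)
  have "inj_on (phase_mat q0) {z. cmod z = 1}" by (rule inj_onI) (metis tens0)
  then have inf: "infinite ?F" using infinite_unit_circle finite_imageD by blast
  show ?thesis
  proof (rule infinite_LU_classes[OF inf _ _ \<rho>(1)])
    show "?F \<subseteq> {U. two_unitary d U}" using two_unitary_phase_mat by auto
    show "1 \<le> d" using d by simp
  next
    fix U U' assume "U \<in> ?F" "U' \<in> ?F" "U \<noteq> U'"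
    then obtain z z' where z: "cmod z = 1" "cmod z' = 1" "U = phase_mat q0 z" "U' = phase_mat q0 z'" "z \<noteq> z'" by blast
    \<comment> \<open>The factor \<open>phase_tens q0 z\<close> cancels the phases of U, so
      orthogonality becomes a property of the weight alone.\<close>
    define \<phi> where "\<phi> = (\<lambda>q. weight q0 q * phase_tens q0 z q)"
    have idx_B: "(\<Sum>q\<in>idx d. if q \<in> B then F q else 0) = (\<Sum>q\<in>B. F q)" for F :: "(nat \<Rightarrow> nat) \<Rightarrow> complex"
      using block_idx by (subst sum.inter_restrict[symmetric]) (auto intro: sum.cong)
    have cw: "cnj (weight q0 q) = weight q0 q" for q
      unfolding weight_def by (simp add: if_distrib[of cnj] cong: if_cong)
    have zz: "cnj z * z = 1" using z(1) complex_norm_square[of z] by (simp add: mult.commute)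
    have orth: "ip d \<phi> (act d i X (tens d U)) = 0" if i: "i < 4" for i X
    proof -
      \<comment> \<open>By \<open>block_upd\<close> no other block differs from q in coordinate i
        only, so just a diagonal entry of X contributes: a function of the single coordinate
        \<open>q i\<close>, which the weight annihilates.\<close>
      have a: "act d i X (tens d U) q = X (q i) (q i) * phase_tens q0 z q" if q: "q \<in> B" for q
      proof -
        have "act d i X (tens d U) q = (\<Sum>x<d. if x = q i then X (q i) (q i) * phase_tens q0 z q else 0)"
          unfolding act_def z(3)
        proof (intro sum.cong refl)
          fix x assume "x \<in> {..<d}"
          then have "tens d (phase_mat q0 z) (q(i := x)) = phase_tens q0 z (q(i := x))"
            using q i by (intro tens_phase_mat idx_upd block_idx) auto
          moreover have "phase_tens q0 z (q(i := x)) = 0" if "x \<noteq> q i"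
            using block_upd[OF q i, of x] that unfolding phase_tens_def by simp
          ultimately show "X (q i) x * tens d (phase_mat q0 z) (q(i := x)) = (if x = q i then X (q i) (q i) * phase_tens q0 z q else 0)"
            by simp
        qed
        then show ?thesis using block_less[OF q i] by simp
      qed
      have "ip d \<phi> (act d i X (tens d U)) = (\<Sum>q\<in>idx d. if q \<in> B then weight q0 q * X (q i) (q i) else 0)"
        unfolding ip_def
      proof (intro sum.cong refl)
        fix q assume "q \<in> idx d"
        show "cnj (\<phi> q) * act d i X (tens d U) q = (if q \<in> B then weight q0 q * X (q i) (q i) else 0)"
        proof (cases "q \<in> B")
          case True
          then show ?thesis using a[OF True] zz by (simp add: \<phi>_def cw phase_tens_def mult_ac)
        qed (simp add: \<phi>_def phase_tens_def)
      qed
      also have "\<dots> = (\<Sum>q\<in>B. \<Sum>x<d. if q i = x then weight q0 q * X x x else 0)"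
        unfolding idx_B by (intro sum.cong refl) (use block_less i in auto)
      also have "\<dots> = (\<Sum>x<d. \<Sum>q\<in>B. (if q i = x then weight q0 q else 0) * X x x)"
        by (subst sum.swap) (auto intro!: sum.cong)
      also have "\<dots> = 0"
        unfolding sum_distrib_right[symmetric] using weight_line_sum[OF q0 i] by simp
      finally show ?thesis .
    qed
    \<comment> \<open>U' differs from U only at q0; with total weight zero only the change of phase
      there survives in the inner product.\<close>
    have total: "(\<Sum>q\<in>B. weight q0 q) = 0"
    proof -
      have "(\<Sum>q\<in>B. weight q0 q) = (\<Sum>q\<in>B. \<Sum>x<d. if q 0 = x then weight q0 q else 0)"
        by (intro sum.cong refl) (use block_less in auto)
      also have "\<dots> = (\<Sum>x<d. \<Sum>q\<in>B. if q 0 = x then weight q0 q else 0)" by (rule sum.swap)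
      finally show ?thesis using weight_line_sum[OF q0, of 0] by simp
    qed
    have "ip d \<phi> (tens d U') = (\<Sum>q\<in>idx d. if q \<in> B then weight q0 q + (if q = q0 then of_real f0 * (cnj z * z' - 1) else 0) else 0)"
      unfolding ip_def
    proof (intro sum.cong refl)
      fix q assume "q \<in> idx d"
      then show "cnj (\<phi> q) * tens d U' q = (if q \<in> B then weight q0 q + (if q = q0 then of_real f0 * (cnj z * z' - 1) else 0) else 0)"
        unfolding z(4) by (simp add: tens_phase_mat \<phi>_def cw phase_tens_def f0(2) algebra_simps)
    qed
    also have "\<dots> = of_real f0 * (cnj z * z' - 1)"
      unfolding idx_B sum.distrib total using q0 finite_blocks by simp
    finally have ip: "ip d \<phi> (tens d U') = of_real f0 * (cnj z * z' - 1)" .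
    have "cnj z * z' - 1 = cnj z * (z' - z)" using zz by (simp add: algebra_simps)
    then have cm: "cmod (ip d \<phi> (tens d U')) = f0 * cmod (z' - z)"
      unfolding ip using f0(1) z(1) by (simp add: norm_mult)
    have n\<phi>: "nrm d \<phi> = M"
      unfolding M_def nrm_def by (rule L2_set_cong) (auto simp: \<phi>_def phase_tens_def norm_mult z)
    have nd: "nrm d (\<lambda>q. tens d U' q - 1 * tens d U q) = cmod (z' - z)"
    proof -
      have "nrm d (\<lambda>q. tens d U' q - 1 * tens d U q) = L2_set (\<lambda>q. if q = q0 then cmod (z' - z) else 0) (idx d)"
        unfolding nrm_def by (rule L2_set_cong) (auto simp: z tens_phase_mat phase_tens_def q0)
      also have "\<dots> = sqrt (\<Sum>q\<in>idx d. if q = q0 then (cmod (z' - z))\<^sup>2 else 0)"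
        unfolding L2_set_def by (intro arg_cong[of _ _ sqrt] sum.cong) auto
      finally show ?thesis using block_idx[OF q0] by simp
    qed
    have "\<rho> * (nrm d \<phi> * nrm d (\<lambda>q. tens d U' q - 1 * tens d U q)) \<le> cmod (ip d \<phi> (tens d U'))"
      unfolding cm n\<phi> nd using mult_right_mono[OF \<rho>(2), of "cmod (z' - z)"] by (simp add: mult_ac)
    moreover have "ip d \<phi> (tens d U') \<noteq> 0"
      using cm f0(1) z(5) by auto
    ultimately show "\<exists>\<phi> s. (\<forall>i<4. \<forall>X. ip d \<phi> (act d i X (tens d U)) = 0) \<and> ip d \<phi> (tens d U') \<noteq> 0 \<and>
      \<rho> * (nrm d \<phi> * nrm d (\<lambda>q. tens d U' q - s * tens d U q)) \<le> cmod (ip d \<phi> (tens d U'))"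
      using orth by blast
  qed
qed

end

section \<open>Orthogonal arrays of strength two with four columns\<close>

lemma orth_array_image:
  assumes rng: "\<And>k i. k \<in> K \<Longrightarrow> i < s \<Longrightarrow> f k i < n"
    and ex: "\<And>i j x y. i < s \<Longrightarrow> j < s \<Longrightarrow> i \<noteq> j \<Longrightarrow> x < n \<Longrightarrow> y < n \<Longrightarrow> \<exists>k\<in>K. f k i = x \<and> f k j = y"
    and inj: "\<And>i j k l. i < s \<Longrightarrow> j < s \<Longrightarrow> i \<noteq> j \<Longrightarrow> k \<in> K \<Longrightarrow> l \<in> K \<Longrightarrow> f k i = f l i \<Longrightarrow> f k j = f l j \<Longrightarrow> k = l"
  shows "orth_array s n ((\<lambda>k. restrict (f k) {..<s}) ` K)"
  unfolding orth_array_def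
proof (intro conjI allI impI)
  show "(\<lambda>k. restrict (f k) {..<s}) ` K \<subseteq> {..<s} \<rightarrow>\<^sub>E {..<n}"
    using rng by (intro image_subsetI) (simp add: restrict_PiE_iff)
next
  fix i j x y assume *: "i < s" "j < s" "i \<noteq> j" "x < n" "y < n"
  then obtain k where k: "k \<in> K" "f k i = x" "f k j = y" using ex by blast
  show "\<exists>!q. q \<in> (\<lambda>k. restrict (f k) {..<s}) ` K \<and> q i = x \<and> q j = y"
  proof (rule ex1I[of _ "restrict (f k) {..<s}"])
    fix q assume "q \<in> (\<lambda>k. restrict (f k) {..<s}) ` K \<and> q i = x \<and> q j = y"
    then obtain l where "l \<in> K" "q = restrict (f l) {..<s}" "f l i = x" "f l j = y" using * by auto
    then show "q = restrict (f k) {..<s}" using inj[OF *(1-3) _ k(1), of l] k by simp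
  qed (use k * in auto)
qed

text \<open>Any two columns map the n squared rows injectively into as many pairs of symbols, so
  every pair occurs by counting.\<close>

lemma orth_array_inj:
  assumes K: "finite K" "card K = n * n" and rng: "\<And>k i. k \<in> K \<Longrightarrow> i < s \<Longrightarrow> f k i < n"
    and inj: "\<And>i j k l. i < j \<Longrightarrow> j < s \<Longrightarrow> k \<in> K \<Longrightarrow> l \<in> K \<Longrightarrow> f k i = f l i \<Longrightarrow> f k j = f l j \<Longrightarrow> k = l"
  shows "orth_array s n ((\<lambda>k. restrict (f k) {..<s}) ` K)"
proof (rule orth_array_image[OF rng])
  show inj': "k = l" if "i < s" "j < s" "i \<noteq> j" "k \<in> K" "l \<in> K" "f k i = f l i" "f k j = f l j" for i j k l
    using inj[of i j k l] inj[of j i k l] that by (cases "i < j") auto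
  fix i j x y assume *: "i < s" "j < s" "i \<noteq> j" "x < n" "y < n"
  have "inj_on (\<lambda>k. (f k i, f k j)) K" using inj'[OF *(1-3)] by (auto simp: inj_on_def)
  then have "card ((\<lambda>k. (f k i, f k j)) ` K) = card ({..<n} \<times> {..<n})" using K by (simp add: card_image)
  then have "(\<lambda>k. (f k i, f k j)) ` K = {..<n} \<times> {..<n}"
    using rng * by (intro card_subset_eq) auto
  then have "(x, y) \<in> (\<lambda>k. (f k i, f k j)) ` K" using * by simp
  then show "\<exists>k\<in>K. f k i = x \<and> f k j = y" by auto
qed

definition has_orth_array :: "nat \<Rightarrow> nat \<Rightarrow> bool" where
  "has_orth_array s n \<longleftrightarrow> (\<exists>B. orth_array s n B)"

lemma orth_arrayE:
  assumes "orth_array s n B" "i < s" "j < s" "i \<noteq> j" "x < n" "y < n"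
  obtains q where "q \<in> B" "q i = x" "q j = y"
proof -
  have "\<exists>!q. q \<in> B \<and> q i = x \<and> q j = y" using assms unfolding orth_array_def by blast
  then show ?thesis using that by blast
qed

lemma orth_array_less: "orth_array s n B \<Longrightarrow> q \<in> B \<Longrightarrow> i < s \<Longrightarrow> q i < n"
  unfolding orth_array_def by (auto simp: PiE_iff subset_iff)

lemma orth_array_unique:
  assumes "orth_array s n B" "q \<in> B" "r \<in> B" "i < s" "j < s" "i \<noteq> j" "q i = r i" "q j = r j"
  shows "q = r"
proof -
  have "r i < n" "r j < n" using assms orth_array_less by auto
  then have "\<exists>!q. q \<in> B \<and> q i = r i \<and> q j = r j" using assms(1,4-6) unfolding orth_array_def by blast
  then show ?thesis using assms by blast
qed

section \<open>Linear arrays modulo n and direct products\<close>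

text \<open>Columns are linear forms in x and y modulo n. Two of them determine x and y as soon as
  their determinant is invertible modulo n.\<close>

lemma linear_orth_array:
  fixes a b :: "nat \<Rightarrow> int"
  assumes n: "0 < n" and det: "\<And>i j. i < j \<Longrightarrow> j < s \<Longrightarrow> coprime (a i * b j - a j * b i) (int n)"
  shows "has_orth_array s n"
proof -
  define f where "f = (\<lambda>(x, y) i. nat ((a i * int x + b i * int y) mod int n))"
  have "orth_array s n ((\<lambda>k. restrict (f k) {..<s}) ` ({..<n} \<times> {..<n}))"
  proof (rule orth_array_inj)
    show "f k i < n" for k i using n unfolding f_def by (cases k) (simp add: nat_less_iff)
  next
    fix i j k l assume ij: "i < j" "j < s" and k: "k \<in> {..<n} \<times> {..<n}" "l \<in> {..<n} \<times> {..<n}"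
      and eq: "f k i = f l i" "f k j = f l j"
    obtain x y where xy: "k = (x, y)" "x < n" "y < n" using k by auto
    obtain x' y' where xy': "l = (x', y')" "x' < n" "y' < n" using k by auto
    define D where "D = a i * b j - a j * b i"
    have e: "(a h * int x + b h * int y) mod int n = (a h * int x' + b h * int y') mod int n" if "f k h = f l h" for h
      using that n unfolding f_def xy xy' by (simp add: nat_eq_iff2)
    have dvd: "int n dvd a h * (int x - int x') + b h * (int y - int y')" if "f k h = f l h" for h
    proof -
      have "int n dvd (a h * int x + b h * int y) - (a h * int x' + b h * int y')"
        using e[OF that] by (simp only: mod_eq_dvd_iff)
      then show ?thesis by (simp add: algebra_simps)
    qed
    \<comment> \<open>Cramer's rule: eliminating one unknown leaves the determinant D times the
      other.\<close>
    have "int n dvd b j * (a i * (int x - int x') + b i * (int y - int y')) - b i * (a j * (int x - int x') + b j * (int y - int y'))"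
      by (intro dvd_diff dvd_mult dvd eq)
    moreover have "b j * (a i * (int x - int x') + b i * (int y - int y')) - b i * (a j * (int x - int x') + b j * (int y - int y')) = D * (int x - int x')"
      unfolding D_def by (simp add: algebra_simps)
    ultimately have "int n dvd D * (int x - int x')" by simp
    moreover have "int n dvd a i * (a j * (int x - int x') + b j * (int y - int y')) - a j * (a i * (int x - int x') + b i * (int y - int y'))"
      by (intro dvd_diff dvd_mult dvd eq)
    moreover have "a i * (a j * (int x - int x') + b j * (int y - int y')) - a j * (a i * (int x - int x') + b i * (int y - int y')) = D * (int y - int y')"
      unfolding D_def by (simp add: algebra_simps)
    ultimately have "int n dvd D * (int x - int x')" "int n dvd D * (int y - int y')" by simp_all
    moreover have "coprime (int n) D" using det[OF ij] unfolding D_def by (simp add: coprime_commute)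
    ultimately have "int n dvd int x - int x'" "int n dvd int y - int y'"
      by (simp_all add: coprime_dvd_mult_right_iff)
    moreover have "z = z'" if "int n dvd int z - int z'" "z < n" "z' < n" for z z' :: nat
    proof -
      have "int z mod int n = int z' mod int n" using that(1) by (simp only: mod_eq_dvd_iff)
      then show ?thesis using that(2,3) by simp
    qed
    ultimately show "k = l" using xy xy' by blast
  qed simp_all
  then show ?thesis unfolding has_orth_array_def by blast
qed

text \<open>The columns are x, y, x + y and x + 2 y, with all determinants among 1, -1 and
  2.\<close>

lemma orth_array_odd:
  assumes "odd n"
  shows "has_orth_array 4 n"
proof (rule linear_orth_array[where a = "\<lambda>i. if i = 1 then 0 else 1" and b = "\<lambda>i. int i - (if i \<le> 1 then 0 else 1)"])
  show "0 < n" using assms by (cases n) auto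
next
  fix i j :: nat assume ij: "i < j" "j < 4"
  have c: "coprime 2 (int n)" using assms by simp
  have "i = 0 \<and> j = 1 \<or> i = 0 \<and> j = 2 \<or> i = 0 \<and> j = 3 \<or> i = 1 \<and> j = 2 \<or> i = 1 \<and> j = 3 \<or> i = 2 \<and> j = 3"
    using ij by auto
  then show "coprime ((if i = 1 then 0 else 1) * (int j - (if j \<le> 1 then 0 else 1))
      - (if j = 1 then 0 else 1) * (int i - (if i \<le> 1 then 0 else 1))) (int n)"
    using c by (elim disjE) simp_all
qed

text \<open>The fifth column x - y brings in the determinant -3, hence the condition modulo 3. Five
  columns are needed as input for \<open>orth_array_Wilson\<close>, whose fifth group is
  truncated.\<close>

lemma orth_array_coprime_6:
  assumes n: "odd n" "n mod 3 \<noteq> 0"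
  shows "has_orth_array 5 n"
proof (rule linear_orth_array[where a = "\<lambda>i. if i = 1 then 0 else 1" and b = "\<lambda>i. [0, 1, 1, 2, -1] ! i"])
  have "n mod 3 = 1 \<or> n mod 3 = 2" using n(2) mod_less_divisor[of 3 n] by linarith
  moreover have "gcd n 3 = gcd 3 (n mod 3)" by (rule gcd_red_nat)
  moreover have "gcd (3::nat) 2 = 1" by (simp add: gcd_red_nat[of 3 2])
  ultimately have "gcd 3 n = 1" unfolding gcd.commute[of 3 n] by (elim disjE) simp_all
  then have "coprime 3 n" by (simp only: coprime_iff_gcd_eq_1)
  then have "coprime (int 3) (int n)" by (simp only: coprime_int_iff)
  then have c3: "coprime 3 (int n)" by (simp only: of_nat_numeral)
  have c2: "coprime 2 (int n)" using n(1) by simp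
  show "0 < n" using n(1) by (cases n) auto
  fix i j :: nat assume ij: "i < j" "j < 5"
  have "\<forall>j\<in>set [0..<5]. \<forall>i\<in>set [0..<j]. (if i = 1 then 0 else 1) * [0, 1, 1, 2, -1] ! j - (if j = 1 then 0 else 1) * [0, 1, 1, 2, -1] ! i
      \<in> {1, -1, 2, -2, -3 :: int}"
    by code_simp
  then have D: "(if i = 1 then 0 else 1) * [0, 1, 1, 2, -1] ! j - (if j = 1 then 0 else 1) * [0, 1, 1, 2, -1] ! i
      \<in> {1, -1, 2, -2, -3 :: int}"
    using ij by (simp only: set_upt atLeastLessThan_iff Ball_def zero_le)
  have cop: "coprime x (int n)" if "x \<in> {1, -1, 2, -2, -3}" for x
    using that c2 c3 by (elim insertE) (simp_all only: coprime_minus_left_iff coprime_1_left empty_iff)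
  show "coprime ((if i = 1 then 0 else 1) * [0, 1, 1, 2, -1] ! j - (if j = 1 then 0 else 1) * [0, 1, 1, 2, -1] ! i) (int n)"
    by (rule cop[OF D])
qed

text \<open>MacNeish's direct product; a pair of symbols is encoded in base n, so quotient and
  remainder recover the two factors.\<close>

lemma orth_array_product:
  assumes "has_orth_array s m" "has_orth_array s n"
  shows "has_orth_array s (m * n)"
proof -
  obtain A B where A: "orth_array s m A" and B: "orth_array s n B" using assms unfolding has_orth_array_def by blast
  define f :: "(nat \<Rightarrow> nat) \<times> (nat \<Rightarrow> nat) \<Rightarrow> nat \<Rightarrow> nat" where "f = (\<lambda>(q, r) i. q i * n + r i)"
  have "orth_array s (m * n) ((\<lambda>k. restrict (f k) {..<s}) ` (A \<times> B))"
  proof (rule orth_array_image)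
    fix k i assume "k \<in> A \<times> B" "i < s"
    then have "fst k i < m" "snd k i < n" using orth_array_less[OF A] orth_array_less[OF B] by auto
    then have "fst k i * n + snd k i < Suc (fst k i) * n" "Suc (fst k i) * n \<le> m * n" by (simp, intro mult_right_mono) auto
    then show "f k i < m * n" unfolding f_def by (simp add: split_def)
  next
    fix i j x y assume *: "i < s" "j < s" "i \<noteq> j" "x < m * n" "y < m * n"
    then have n: "0 < n" by (cases n) auto
    have "x div n < m" "y div n < m" using * by (simp_all add: less_mult_imp_div_less)
    then obtain q where q: "q \<in> A" "q i = x div n" "q j = y div n" using orth_arrayE[OF A *(1-3)] by blast
    obtain r where r: "r \<in> B" "r i = x mod n" "r j = y mod n"
      using orth_arrayE[OF B *(1-3), of "x mod n" "y mod n"] n by auto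
    show "\<exists>k\<in>A \<times> B. f k i = x \<and> f k j = y"
      using q r by (intro bexI[of _ "(q, r)"]) (simp_all add: f_def)
  next
    fix i j k l assume *: "i < s" "j < s" "i \<noteq> j" "k \<in> A \<times> B" "l \<in> A \<times> B" "f k i = f l i" "f k j = f l j"
    have e: "fst k h = fst l h \<and> snd k h = snd l h" if "h < s" "f k h = f l h" for h
    proof -
      have "snd k h < n" "snd l h < n" using * that(1) orth_array_less[OF B] by auto
      then have "f k h div n = fst k h" "f k h mod n = snd k h" "f l h div n = fst l h" "f l h mod n = snd l h"
        unfolding f_def by (simp_all add: split_def)
      then show ?thesis using that(2) by metis
    qed
    have "fst k = fst l" by (rule orth_array_unique[OF A _ _ *(1-3)]) (use * e in auto)
    moreover have "snd k = snd l" by (rule orth_array_unique[OF B _ _ *(1-3)]) (use * e in auto)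
    ultimately show "k = l" by (simp add: prod_eq_iff)
  qed
  then show ?thesis unfolding has_orth_array_def by blast
qed

text \<open>Wilson's construction: every point of the first four groups of the array on \<open>t\<close> points is
  tripled, and \<open>u\<close> points of the fifth group survive as points at infinity, encoded by the symbol
  \<open>0\<close> of the order-4 array.\<close>

lemma orth_array_Wilson:
  assumes "has_orth_array 5 t" "has_orth_array 4 u" "u \<le> t" "has_orth_array 4 3"
    and D: "orth_array 4 4 D" and zero: "restrict (\<lambda>_. 0) {..<4} \<in> D"
  shows "has_orth_array 4 (3 * t + u)"
proof -
  obtain A where A: "orth_array 5 t A" using assms unfolding has_orth_array_def by blast
  obtain B where B: "orth_array 4 u B" using assms unfolding has_orth_array_def by blast
  obtain C where C: "orth_array 4 3 C" using assms unfolding has_orth_array_def by blast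
  define z :: "nat \<Rightarrow> nat" where "z = restrict (\<lambda>_. 0) {..<4}"
  define K :: "(nat \<times> (nat \<Rightarrow> nat) \<times> (nat \<Rightarrow> nat)) set" where
    \<comment> \<open>Tag 0: a block missing the surviving points receives an array of order 3. Tag
      1: a block through a surviving point receives the array of order 4 without its zero row, which
      would put that point into all four columns. Tag 2: the pairs of points at infinity are covered
      once, by the array of order u.\<close>
    "K = {(0, q, r) | q r. q \<in> A \<and> u \<le> q 4 \<and> r \<in> C} \<union> {(1, q, r) | q r. q \<in> A \<and> q 4 < u \<and> r \<in> D \<and> r \<noteq> z}
       \<union> {(2, q, z) | q. q \<in> B}"
  define f :: "nat \<times> (nat \<Rightarrow> nat) \<times> (nat \<Rightarrow> nat) \<Rightarrow> nat \<Rightarrow> nat" where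
    "f = (\<lambda>(g, q, r) i. if g = 0 then 3 * q i + r i
       else if g = 1 then (if r i = 0 then 3 * t + q 4 else 3 * q i + (r i - 1)) else 3 * t + q i)"
  have lt: "q i < t" if "q \<in> A" "i < 4" for q i using orth_array_less[OF A that(1)] that(2) by simp
  have F0: "f (0, q, r) i < 3 * t" "f (0, q, r) i div 3 = q i" "f (0, q, r) i mod 3 = r i"
    if "q \<in> A" "r \<in> C" "i < 4" for q r i
    using lt[OF that(1,3)] orth_array_less[OF C that(2,3)] unfolding f_def by simp_all
  have F1: "f (1, q, r) i = 3 * t + q 4" if "r i = 0" for q r i
    using that unfolding f_def by simp
  have F1': "f (1, q, r) i < 3 * t" "f (1, q, r) i div 3 = q i" "Suc (f (1, q, r) i mod 3) = r i"
    if "q \<in> A" "r \<in> D" "i < 4" "r i \<noteq> 0" for q r i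
  proof -
    have "r i < 4" "r i \<noteq> 0" using orth_array_less[OF D that(2,3)] that(4) by auto
    then obtain m where m: "r i = Suc m" "m < 3" by (cases "r i") auto
    then show "f (1, q, r) i < 3 * t" "f (1, q, r) i div 3 = q i" "Suc (f (1, q, r) i mod 3) = r i"
      using lt[OF that(1,3)] unfolding f_def by simp_all
  qed
  have F2: "f (2, q, r) i = 3 * t + q i" for q r i unfolding f_def by simp
  have "orth_array 4 (3 * t + u) ((\<lambda>k. restrict (f k) {..<4}) ` K)"
  proof (rule orth_array_image)
    fix k i assume k: "k \<in> K" "i < (4::nat)"
    then consider q r where "k = (0, q, r)" "q \<in> A" "r \<in> C" | q r where "k = (1, q, r)" "q \<in> A" "q 4 < u" "r \<in> D"
      | q where "k = (2, q, z)" "q \<in> B"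
      unfolding K_def by blast
    then show "f k i < 3 * t + u"
    proof cases
      case 1
      then show ?thesis using F0(1)[of q r i] k by simp
    next
      case 2
      then show ?thesis using F1[of r i q] F1'(1)[of q r i] k by (cases "r i = 0") auto
    next
      case 3
      then show ?thesis using F2 orth_array_less[OF B] k by simp
    qed
  next
    fix i j x y assume ij: "i < (4::nat)" "j < (4::nat)" "i \<noteq> j" and xy: "x < 3 * t + u" "y < 3 * t + u"
    \<comment> \<open>A finite symbol fixes coordinate i of the block and a point at infinity fixes
      its fifth coordinate, so the block is determined.\<close>
    have mixed: "\<exists>k\<in>K. f k i = x \<and> f k j = y"
      if ij: "i < 4" "j < 4" "i \<noteq> j" and xy: "x < 3 * t" "3 * t \<le> y" "y < 3 * t + u" for i j x y
    proof -
      have "x div 3 < t" "y - 3 * t < t" using xy assms(3) by auto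
      then obtain q where q: "q \<in> A" "q i = x div 3" "q 4 = y - 3 * t" using orth_arrayE[OF A, of i 4 "x div 3" "y - 3 * t"] ij by auto
      have "x mod 3 < 3" by simp
      then obtain r where r: "r \<in> D" "r i = Suc (x mod 3)" "r j = 0" using orth_arrayE[OF D ij, of "Suc (x mod 3)" 0] by auto
      have "r \<noteq> z" using r(2) ij(1) unfolding z_def by auto
      then have "(1, q, r) \<in> K" using q r xy unfolding K_def by auto
      moreover have "f (1, q, r) i = x" "f (1, q, r) j = y" using q r xy unfolding f_def by simp_all
      ultimately show ?thesis by blast
    qed
    consider "x < 3 * t" "y < 3 * t" | "x < 3 * t" "3 * t \<le> y" | "3 * t \<le> x" "y < 3 * t" | "3 * t \<le> x" "3 * t \<le> y" by linarith
    then show "\<exists>k\<in>K. f k i = x \<and> f k j = y"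
    proof cases
      case 1
      then have "x div 3 < t" "y div 3 < t" by auto
      then obtain q where q: "q \<in> A" "q i = x div 3" "q j = y div 3" using orth_arrayE[OF A, of i j "x div 3" "y div 3"] ij by auto
      have m: "x mod 3 < 3" "y mod 3 < 3" by simp_all
      show ?thesis
      proof (cases "q 4 < u")
        case True
        obtain r where r: "r \<in> D" "r i = Suc (x mod 3)" "r j = Suc (y mod 3)"
          using orth_arrayE[OF D ij, of "Suc (x mod 3)" "Suc (y mod 3)"] m by auto
        have "r \<noteq> z" using r(2) ij(1) unfolding z_def by auto
        then have "(1, q, r) \<in> K" using q r True unfolding K_def by auto
        moreover have "f (1, q, r) i = x" "f (1, q, r) j = y" using q r unfolding f_def by simp_all
        ultimately show ?thesis by blast
      next
        case False
        obtain r where r: "r \<in> C" "r i = x mod 3" "r j = y mod 3"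
          using orth_arrayE[OF C ij m] by auto
        have "(0, q, r) \<in> K" using q r False unfolding K_def by auto
        moreover have "f (0, q, r) i = x" "f (0, q, r) j = y" using q r unfolding f_def by simp_all
        ultimately show ?thesis by blast
      qed
    next
      case 2
      then show ?thesis using mixed[OF ij] xy by blast
    next
      case 3
      then show ?thesis using mixed[OF ij(2,1) ij(3)[symmetric], of y x] xy by blast
    next
      case 4
      then have "x - 3 * t < u" "y - 3 * t < u" using xy by auto
      then obtain q where q: "q \<in> B" "q i = x - 3 * t" "q j = y - 3 * t" using orth_arrayE[OF B ij] by blast
      have "(2, q, z) \<in> K" using q unfolding K_def by auto
      moreover have "f (2, q, z) i = x" "f (2, q, z) j = y" using q 4 unfolding F2 by simp_all
      ultimately show ?thesis by blast
    qed
  next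
    fix i j k l assume ij: "i < (4::nat)" "j < (4::nat)" "i \<noteq> j" and kl: "k \<in> K" "l \<in> K" and eq: "f k i = f l i" "f k j = f l j"
    have tag: "(\<exists>q r. k = (0, q, r) \<and> q \<in> A \<and> u \<le> q 4 \<and> r \<in> C) \<or> (\<exists>q r. k = (1, q, r) \<and> q \<in> A \<and> q 4 < u \<and> r \<in> D \<and> r \<noteq> z)
      \<or> (\<exists>q. k = (2, q, z) \<and> q \<in> B)" if "k \<in> K" for k
      using that unfolding K_def by blast
    \<comment> \<open>Two zeros would force the zero row. Hence a row with tag 1 has a point at
      infinity in at most one of the columns i and j.\<close>
    have nz: "r i \<noteq> 0 \<or> r j \<noteq> 0" if "r \<in> D" "r \<noteq> z" for r
    proof (rule ccontr)
      assume "\<not> (r i \<noteq> 0 \<or> r j \<noteq> 0)"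
      then have "r = z" using orth_array_unique[OF D that(1) zero ij] ij unfolding z_def by simp
      then show False using that by simp
    qed
    have A_eq: "q = q'" if "q \<in> A" "q' \<in> A" "a < 5" "b < 5" "a \<noteq> b" "q a = q' a" "q b = q' b" for q q' a b
      using orth_array_unique[OF A] that by blast
    have core: "k = l" if "k = (1, q, r)" "q \<in> A" "q 4 < u" "r \<in> D" "r \<noteq> z" "l \<in> K" "f k i = f l i" "f k j = f l j" for k l q r
    proof -
      from tag[OF that(6)] show ?thesis
      proof (elim disjE exE conjE)
        fix q' r' assume l: "l = (0, q', r')" "q' \<in> A" "u \<le> q' 4" "r' \<in> C"
        have r: "r i \<noteq> 0" "r j \<noteq> 0" using that F1[of r i q] F1[of r j q] F0(1)[OF l(2,4) ij(1)] F0(1)[OF l(2,4) ij(2)] l(1) by fastforce+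
        have "q i = q' i" using F1'(2)[OF that(2,4) ij(1) r(1)] F0(2)[OF l(2,4) ij(1)] that l(1) by simp
        moreover have "q j = q' j" using F1'(2)[OF that(2,4) ij(2) r(2)] F0(2)[OF l(2,4) ij(2)] that l(1) by simp
        ultimately have "q = q'" using A_eq[OF that(2) l(2), of i j] ij by simp
        then show ?thesis using that l by simp
      next
        fix q' r' assume l: "l = (1, q', r')" "q' \<in> A" "q' 4 < u" "r' \<in> D" "r' \<noteq> z"
        have e: "r h = r' h \<and> (r h \<noteq> 0 \<longrightarrow> q h = q' h) \<and> (r h = 0 \<longrightarrow> q 4 = q' 4)" if h: "h < 4" "f k h = f l h" for h
        proof (cases "r h = 0")
          case True
          then have "r' h = 0" using F1[of r h q] F1'(1)[OF l(2,4) h(1)] h(2) \<open>k = _\<close> l(1) by fastforce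
          then show ?thesis using True F1[of r h q] F1[of r' h q'] h(2) \<open>k = _\<close> l(1) by simp
        next
          case False
          note F = F1'[OF \<open>q \<in> A\<close> \<open>r \<in> D\<close> h(1) False]
          have "r' h \<noteq> 0" using F1[of r' h q'] F(1) h(2) \<open>k = _\<close> l(1) by fastforce
          from F1'[OF l(2,4) h(1) this] show ?thesis using F False h(2) \<open>k = _\<close> l(1) by simp
        qed
        have "r = r'" using orth_array_unique[OF D that(4) l(4) ij] e[OF ij(1) that(7)] e[OF ij(2) that(8)] by blast
        moreover have "q = q'"
        proof (cases "r i \<noteq> 0 \<and> r j \<noteq> 0")
          case True
          then show ?thesis using A_eq[OF that(2) l(2), of i j] e[OF ij(1) that(7)] e[OF ij(2) that(8)] ij by auto
        next
          case False
          then show ?thesis using nz[OF that(4,5)] A_eq[OF that(2) l(2), of i 4] A_eq[OF that(2) l(2), of j 4]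
              e[OF ij(1) that(7)] e[OF ij(2) that(8)] ij by auto
        qed
        ultimately show ?thesis using that(1) l(1) by simp
      next
        fix q' assume l: "l = (2, q', z)" "q' \<in> B"
        have "f k i \<ge> 3 * t" "f k j \<ge> 3 * t" using that l(1) F2 by simp_all
        then have "r i = 0" "r j = 0" using F1'(1)[OF that(2,4) ij(1)] F1'(1)[OF that(2,4) ij(2)] that(1) by fastforce+
        then show ?thesis using nz[OF that(4,5)] by simp
      qed
    qed
    from tag[OF kl(1)] show "k = l"
    proof (elim disjE exE conjE)
      fix q r assume k: "k = (0, q, r)" "q \<in> A" "u \<le> q 4" "r \<in> C"
      from tag[OF kl(2)] show "k = l"
      proof (elim disjE exE conjE)
        fix q' r' assume l: "l = (0, q', r')" "q' \<in> A" "u \<le> q' 4" "r' \<in> C"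
        have e: "q h = q' h \<and> r h = r' h" if "h < 4" "f k h = f l h" for h
          using F0[OF k(2,4) that(1)] F0[OF l(2,4) that(1)] that(2) k(1) l(1) by simp
        have "r = r'" using orth_array_unique[OF C k(4) l(4) ij] e ij eq by blast
        moreover have "q = q'" using A_eq[OF k(2) l(2), of i j] e ij eq by simp
        ultimately show ?thesis using k(1) l(1) by simp
      next
        fix q' r' assume l: "l = (1, q', r')" "q' \<in> A" "q' 4 < u" "r' \<in> D" "r' \<noteq> z"
        show ?thesis using core[OF l kl(1) eq[symmetric]] by simp
      next
        fix q' assume l: "l = (2, q', z)" "q' \<in> B"
        show ?thesis using F0(1)[OF k(2,4) ij(1)] eq(1) F2[of q' z i] k(1) l(1) by simp
      qed
    next
      fix q r assume k: "k = (1, q, r)" "q \<in> A" "q 4 < u" "r \<in> D" "r \<noteq> z"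
      show ?thesis by (rule core[OF k kl(2) eq])
    next
      fix q assume k: "k = (2, q, z)" "q \<in> B"
      from tag[OF kl(2)] show "k = l"
      proof (elim disjE exE conjE)
        fix q' r' assume l: "l = (0, q', r')" "q' \<in> A" "u \<le> q' 4" "r' \<in> C"
        show ?thesis using F0(1)[OF l(2,4) ij(1)] eq(1) F2[of q z i] k(1) l(1) by simp
      next
        fix q' r' assume l: "l = (1, q', r')" "q' \<in> A" "q' 4 < u" "r' \<in> D" "r' \<noteq> z"
        show ?thesis using core[OF l kl(1) eq[symmetric]] by simp
      next
        fix q' assume l: "l = (2, q', z)" "q' \<in> B"
        have "q = q'" using orth_array_unique[OF B k(2) l(2) ij] eq F2 k(1) l(1) by simp
        then show ?thesis using k(1) l(1) by simp
      qed
    qed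
  qed
  then show ?thesis unfolding has_orth_array_def by blast
qed

section \<open>Small orders by explicit tables\<close>

definition orth_table :: "nat \<Rightarrow> nat list list \<Rightarrow> bool" where
  "orth_table n L \<longleftrightarrow> length L = n * n \<and> (\<forall>r\<in>set L. \<forall>i\<in>set [0..<4]. r ! i < n) \<and>
     (\<forall>j\<in>set [0..<4]. \<forall>i\<in>set [0..<j]. distinct (map (\<lambda>r. (r ! i, r ! j)) L))"

lemma orth_table_array:
  assumes "orth_table n L"
  shows "orth_array 4 n ((\<lambda>r. restrict ((!) r) {..<4}) ` set L)"
proof -
  have "orth_array 4 n ((\<lambda>k. restrict ((!) (L ! k)) {..<4}) ` {..<n * n})"
  proof (rule orth_array_inj)
    fix i j k l assume ij: "i < j" "j < (4::nat)" and kl: "k \<in> {..<n * n}" "l \<in> {..<n * n}"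
      and eq: "L ! k ! i = L ! l ! i" "L ! k ! j = L ! l ! j"
    have "distinct (map (\<lambda>r. (r ! i, r ! j)) L)" using assms ij unfolding orth_table_def by simp
    then show "k = l"
      using kl eq assms nth_eq_iff_index_eq[of "map (\<lambda>r. (r ! i, r ! j)) L" k l] unfolding orth_table_def by simp
  qed (use assms in \<open>auto simp: orth_table_def\<close>)
  moreover have "(\<lambda>k. restrict ((!) (L ! k)) {..<4}) ` {..<n * n} = (\<lambda>r. restrict ((!) r) {..<4}) ` set L"
    using assms unfolding orth_table_def by (auto simp: set_conv_nth image_iff)
  ultimately show ?thesis by simp
qed

text \<open>In a field of characteristic 2 addition is \<open>xor\<close>; the list is the multiplication by a generator.\<close>

definition field_table :: "nat list \<Rightarrow> nat list list" where
  "field_table m = concat (map (\<lambda>a. map (\<lambda>b. [a, b, semiring_bit_operations_class.xor a b, semiring_bit_operations_class.xor a (m ! b)]) [0..<length m]) [0..<length m])"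

text \<open>Multiplication by x modulo x^2 + x + 1, the bits of a number being its
  coefficients.\<close>

lemma orth_table_4: "orth_table 4 (field_table [0, 2, 3, 1])"
  by code_simp

text \<open>Multiplication by x modulo x^3 + x + 1.\<close>

lemma orth_table_8: "orth_table 8 (field_table [0, 2, 4, 6, 3, 1, 7, 5])"
  by code_simp

text \<open>A label for the orbit of the pair in positions i and j under translation modulo m.
  Differences occupy 0 to m - 1, a fixed symbol in position i gives m to m + 2, one in position j
  gives m + 3 to m + 5, so the three kinds do not collide.\<close>

definition column_key :: "nat \<Rightarrow> nat \<Rightarrow> nat \<Rightarrow> nat list \<Rightarrow> int" where
  "column_key m i j c = (if m \<le> c ! i then int (c ! i) else if m \<le> c ! j then int (c ! j) + 3
     else (int (c ! i) - int (c ! j)) mod int m)"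

text \<open>A quasi-difference matrix. The length condition amounts to m + 6 columns, as many as
  there are keys, so distinct keys means that every key occurs once. The 9 pairs of fixed symbols
  are left to the subarray of order 3.\<close>

definition orth_columns :: "nat \<Rightarrow> nat list list \<Rightarrow> bool" where
  "orth_columns m C \<longleftrightarrow> length C * m + 9 = (m + 3) * (m + 3) \<and> (\<forall>c\<in>set C. \<forall>i\<in>set [0..<4]. c ! i < m + 3) \<and>
     (\<forall>j\<in>set [0..<4]. \<forall>i\<in>set [0..<j]. (\<forall>c\<in>set C. c ! i < m \<or> c ! j < m) \<and> distinct (map (column_key m i j) C))"

definition table_3 :: "nat \<Rightarrow> nat \<Rightarrow> nat list" where
  "table_3 a b = [a, b, (a + b) mod 3, (a + 2 * b) mod 3]"

text \<open>The finite entries of each column are developed modulo \<open>m\<close>; the symbols \<open>m\<close>, \<open>m + 1\<close>, \<open>m + 2\<close>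
  stay fixed and carry a subarray of order 3.\<close>

lemma orth_array_columns:
  assumes C: "orth_columns m C" and m: "0 < m"
  shows "has_orth_array 4 (m + 3)"
proof -
  define f :: "nat \<times> nat + nat \<times> nat \<Rightarrow> nat \<Rightarrow> nat" where
    "f = case_sum (\<lambda>(k, t) i. if C ! k ! i < m then (C ! k ! i + t) mod m else C ! k ! i) (\<lambda>(a, b) i. m + table_3 a b ! i)"
  define K :: "(nat \<times> nat + nat \<times> nat) set" where "K = ({..<length C} \<times> {..<m}) <+> ({..<3} \<times> {..<3})"
  have t3: "table_3 a b ! i < 3" if "a < 3" "b < 3" "i < 4" for a b i
    using that unfolding table_3_def less4_cases by auto
  have "\<forall>a\<in>set [0..<3]. \<forall>b\<in>set [0..<3]. \<forall>a'\<in>set [0..<3]. \<forall>b'\<in>set [0..<3]. \<forall>j\<in>set [0..<4]. \<forall>i\<in>set [0..<j].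
      table_3 a b ! i = table_3 a' b' ! i \<longrightarrow> table_3 a b ! j = table_3 a' b' ! j \<longrightarrow> a = a' \<and> b = b'"
    by code_simp
  then have t3_inj: "a = a' \<and> b = b'"
    if "a < 3" "b < 3" "a' < 3" "b' < 3" "i < j" "j < 4" "table_3 a b ! i = table_3 a' b' ! i" "table_3 a b ! j = table_3 a' b' ! j"
    for a b a' b' i j
    using that by (simp only: set_upt atLeastLessThan_iff Ball_def zero_le)
  have len: "length C * m + 9 = (m + 3) * (m + 3)" using C unfolding orth_columns_def by simp
  have fin: "C ! k ! i < m \<or> C ! k ! j < m" if "k < length C" "i < j" "j < 4" for k i j
    using C that unfolding orth_columns_def by simp
  have dist: "distinct (map (column_key m i j) C)" if "i < j" "j < 4" for i j
    using C that unfolding orth_columns_def by simp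
  have key: "k = l" if "column_key m i j (C ! k) = column_key m i j (C ! l)" "k < length C" "l < length C" "i < j" "j < 4" for i j k l
    using dist[OF that(4,5)] that(1-3) nth_eq_iff_index_eq[of "map (column_key m i j) C" k l] by simp
  have dvd: "int m dvd (int x + int t) - (int x' + int t')" if "(x + t) mod m = (x' + t') mod m" for x t x' t'
    using that by (metis mod_eq_dvd_iff of_nat_add of_nat_mod)
  have shift: "t = t'" if "(x + t) mod m = (x + t') mod m" "t < m" "t' < m" for x t t'
  proof -
    have "int m dvd int t - int t'" using dvd[OF that(1)] by simp
    then have "int t mod int m = int t' mod int m" by (simp only: mod_eq_dvd_iff)
    then show ?thesis using that(2,3) by simp
  qed
  have "orth_array 4 (m + 3) ((\<lambda>k. restrict (f k) {..<4}) ` K)"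
  proof (rule orth_array_inj)
    show "card K = (m + 3) * (m + 3)"
      unfolding K_def using len by (simp add: card_Plus)
  next
    fix k i assume k: "k \<in> K" and i: "i < (4::nat)"
    note k = k[unfolded K_def]
    show "f k i < m + 3"
    proof (cases k)
      case (Inl p)
      then have "C ! fst p \<in> set C" using k by auto
      then have "C ! fst p ! i < m + 3" using C i unfolding orth_columns_def by simp
      moreover have "(C ! fst p ! i + snd p) mod m < m" using m by simp
      ultimately show ?thesis using Inl unfolding f_def by (simp add: split_def)
    next
      case (Inr p)
      then show ?thesis using k t3[of "fst p" "snd p" i] i unfolding f_def by (auto simp: split_def)
    qed
  next
    fix i j k l assume ij: "i < j" "j < (4::nat)"
      and k: "k \<in> K" and l: "l \<in> K"
      and eq: "f k i = f l i" "f k j = f l j"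
    note k = k[unfolded K_def] and l = l[unfolded K_def]
    have f1: "f (Inl (k, t)) h < m \<longleftrightarrow> C ! k ! h < m" for k t h using m unfolding f_def by simp
    have f2: "\<not> f (Inr p) h < m" for p h unfolding f_def by (simp add: split_def)
    have mix: False if "k < length C" "f (Inl (k, t)) i = f (Inr p) i" "f (Inl (k, t)) j = f (Inr p) j" for k t p
      using fin[OF that(1) ij] f1[of k t i] f1[of k t j] f2[of p i] f2[of p j] that(2,3) by simp
    show "k = l"
    proof (cases k; cases l)
      fix p q assume kl: "k = Inl p" "l = Inl q"
      obtain a t where p: "p = (a, t)" "a < length C" "t < m" using k kl by auto
      obtain b s where q: "q = (b, s)" "b < length C" "s < m" using l kl by auto
      have e: "(C ! a ! h < m \<longleftrightarrow> C ! b ! h < m) \<and> (C ! a ! h < m \<longrightarrow> (C ! a ! h + t) mod m = (C ! b ! h + s) mod m)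
          \<and> (\<not> C ! a ! h < m \<longrightarrow> C ! a ! h = C ! b ! h)" if "f k h = f l h" for h
      proof -
        have iff: "C ! a ! h < m \<longleftrightarrow> C ! b ! h < m" using that f1[of a t h] f1[of b s h] unfolding kl p q by simp
        have "(if C ! a ! h < m then (C ! a ! h + t) mod m else C ! a ! h) = (if C ! b ! h < m then (C ! b ! h + s) mod m else C ! b ! h)"
          using that unfolding kl p q f_def by simp
        then show ?thesis unfolding iff by (cases "C ! b ! h < m") (simp_all only: if_True if_False simp_thms)
      qed
      have "column_key m i j (C ! a) = column_key m i j (C ! b)"
      proof (cases "C ! a ! i < m \<and> C ! a ! j < m")
        case True
        then have "int m dvd ((int (C ! a ! i) + int t) - (int (C ! b ! i) + int s)) - ((int (C ! a ! j) + int t) - (int (C ! b ! j) + int s))"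
          using e[OF eq(1)] e[OF eq(2)] by (intro dvd_diff dvd) auto
        moreover have "((int (C ! a ! i) + int t) - (int (C ! b ! i) + int s)) - ((int (C ! a ! j) + int t) - (int (C ! b ! j) + int s))
            = (int (C ! a ! i) - int (C ! a ! j)) - (int (C ! b ! i) - int (C ! b ! j))"
          by simp
        ultimately have "(int (C ! a ! i) - int (C ! a ! j)) mod int m = (int (C ! b ! i) - int (C ! b ! j)) mod int m"
          by (simp only: mod_eq_dvd_iff)
        moreover have "C ! b ! i < m" "C ! b ! j < m" using True e[OF eq(1)] e[OF eq(2)] by blast+
        ultimately show ?thesis using True unfolding column_key_def by (simp only: not_le[symmetric] if_False simp_thms)
      next
        case False
        show ?thesis
        proof (cases "C ! a ! i < m")
          case True
          then have "\<not> C ! a ! j < m" "C ! b ! i < m" using False e[OF eq(1)] by blast+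
          moreover from this have "\<not> C ! b ! j < m" "C ! a ! j = C ! b ! j" using e[OF eq(2)] by blast+
          ultimately show ?thesis using True unfolding column_key_def by simp
        next
          case False
          then have "\<not> C ! b ! i < m" "C ! a ! i = C ! b ! i" using e[OF eq(1)] by blast+
          then show ?thesis using False unfolding column_key_def by simp
        qed
      qed
      from key[OF this p(2) q(2) ij] have ab: "a = b" .
      \<comment> \<open>One of the two positions holds a finite symbol, and from it the translation
        can be read off.\<close>
      obtain h where "C ! a ! h < m" "f k h = f l h" using fin[OF p(2) ij] eq by auto
      then have "(C ! a ! h + t) mod m = (C ! a ! h + s) mod m" using e[of h] unfolding ab by simp
      from shift[OF this p(3) q(3)] have "t = s" .
      then show ?thesis using kl p q ab by simp
    next
      fix p q assume kl: "k = Inl p" "l = Inr q"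
      then have "fst p < length C" using k by auto
      from mix[OF this, of "snd p" q] show ?thesis using eq kl by simp
    next
      fix p q assume kl: "k = Inr p" "l = Inl q"
      then have "fst q < length C" using l by auto
      from mix[OF this, of "snd q" p] show ?thesis using eq kl by simp
    next
      fix p q assume kl: "k = Inr p" "l = Inr q"
      obtain a b where p: "p = (a, b)" "a < 3" "b < 3" using k kl by auto
      obtain a' b' where q: "q = (a', b')" "a' < 3" "b' < 3" using l kl by auto
      show ?thesis using t3_inj[OF p(2,3) q(2,3) ij] eq unfolding kl p q f_def by simp
    qed
  qed (simp add: K_def)
  then show ?thesis unfolding has_orth_array_def by blast
qed

text \<open>Cyclic symmetry in the four positions: a base column gives four columns, and the key
  condition for positions i and j depends only on their cyclic distance.\<close>

definition rotations :: "nat list \<Rightarrow> nat list list" where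
  "rotations c = map (\<lambda>k. rotate k c) [0..<4]"

lemma orth_columns_7: "orth_columns 7 (concat (map rotations [[7, 0, 2, 1], [8, 0, 4, 2], [9, 0, 1, 4]]) @ [[0, 0, 0, 0]])"
  by code_simp

lemma orth_columns_11:
  "orth_columns 11 (concat (map rotations [[11, 0, 4, 1], [12, 0, 6, 2], [13, 0, 9, 8], [0, 1, 4, 6]]) @ [[0, 0, 0, 0]])"
  by code_simp

lemma has_orth_array_table: "orth_table n L \<Longrightarrow> has_orth_array 4 n"
  unfolding has_orth_array_def using orth_table_array by blast

lemma orth_array_4_zero:
  "\<exists>D. orth_array 4 4 D \<and> restrict (\<lambda>_. 0) {..<4} \<in> D"
proof (intro exI conjI)
  let ?L = "field_table [0, 2, 3, 1]"
  show "orth_array 4 4 ((\<lambda>r. restrict ((!) r) {..<4}) ` set ?L)"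
    by (rule orth_table_array[OF orth_table_4])
  have "[0, 0, 0, 0] \<in> set ?L" by code_simp
  moreover have "restrict (\<lambda>_. 0) {..<4} = restrict ((!) [0, 0, 0, 0 :: nat]) {..<4}"
    by (rule restrict_ext) (auto simp: less4_cases)
  ultimately show "restrict (\<lambda>_. 0) {..<4} \<in> (\<lambda>r. restrict ((!) r) {..<4}) ` set ?L"
    by (simp only: image_eqI)
qed

section \<open>Covering all even orders\<close>

text \<open>With n even and t odd the number \<open>n - 3 * t\<close> of points at infinity is odd,
  so its array is a linear one; the upper bound on n says that there are at most t of them.\<close>

lemma orth_array_between:
  assumes n: "even n" and t: "odd t" "t mod 3 \<noteq> 0" "3 * t < n" "n \<le> 4 * t"
  shows "has_orth_array 4 n"
proof -
  obtain D where D: "orth_array 4 4 D" "restrict (\<lambda>_. 0) {..<4} \<in> D" using orth_array_4_zero by blast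
  have "odd (n - 3 * t)" using n t by simp
  then have "has_orth_array 4 (3 * t + (n - 3 * t))"
    using t by (intro orth_array_Wilson[OF orth_array_coprime_6 orth_array_odd _ orth_array_odd D]) auto
  then show ?thesis using t by simp
qed

lemma orth_array_large:
  assumes n: "even n" "46 \<le> n"
  shows "has_orth_array 4 n"
proof -
  define m where "m = (n + 3) div 4"
  have m: "n \<le> 4 * m" "4 * m \<le> n + 3" unfolding m_def by linarith+
  \<comment> \<open>The distance from m to the next number congruent to 1 or 5 modulo 6, hence
    coprime to 6; starting from the least m with \<open>n \<le> 4 * m\<close>, the upper bound is
    safe.\<close>
  define k :: nat where "k = [1, 0, 3, 2, 1, 0] ! (m mod 6)"
  have "m mod 6 < 6" by simp
  then have "m mod 6 = 0 \<or> m mod 6 = 1 \<or> m mod 6 = 2 \<or> m mod 6 = 3 \<or> m mod 6 = 4 \<or> m mod 6 = 5" by linarith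
  then have k: "k \<le> 3" and "(m mod 6 + k) mod 6 = 1 \<or> (m mod 6 + k) mod 6 = 5"
    unfolding k_def by (elim disjE; simp)+
  then have t: "(m + k) mod 6 = 1 \<or> (m + k) mod 6 = 5" by (simp only: mod_add_left_eq)
  have "(m + k) mod 6 mod 2 = (m + k) mod 2" "(m + k) mod 6 mod 3 = (m + k) mod 3"
    by (simp_all add: mod_mod_cancel)
  with t have "(m + k) mod 2 = 1" and m3: "(m + k) mod 3 \<noteq> 0" by (elim disjE; simp)+
  then have odd: "odd (m + k)" by (simp only: odd_iff_mod_2_eq_one)
  \<comment> \<open>In the worst case k = 3 and 4 m = n + 3 the claim reads 3 n + 45 < 4 n; this is
    where 46 comes from.\<close>
  have "3 * (m + k) < n" using n(2) m k by arith
  moreover have "n \<le> 4 * (m + k)" using m by arith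
  ultimately show ?thesis by (rule orth_array_between[OF n(1) odd m3])
qed

lemma orth_array_exists:
  assumes "4 \<le> d" "d \<noteq> 6"
  shows "has_orth_array 4 d"
proof (cases "odd d")
  case True
  then show ?thesis by (rule orth_array_odd)
next
  case False
  then have even: "even d" by simp
  note four = has_orth_array_table[OF orth_table_4] and eight = has_orth_array_table[OF orth_table_8]
  have ten: "has_orth_array 4 10" using orth_array_columns[OF orth_columns_7] by simp
  have fourteen: "has_orth_array 4 14" using orth_array_columns[OF orth_columns_11] by simp
  have between: "has_orth_array 4 d" if "3 * t < d \<and> d \<le> 4 * t" "t \<in> {5, 7, 11}" for t
    using that by (intro orth_array_between[OF even, of t]) auto
  have prods: "has_orth_array 4 12" "has_orth_array 4 30" "has_orth_array 4 32"
    using orth_array_product[OF orth_array_odd[of 3] four] orth_array_product[OF orth_array_odd[of 3] ten]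
      orth_array_product[OF four eight] by simp_all
  \<comment> \<open>The three intervals are those of \<open>orth_array_between\<close> for t = 11, 7
    and 5. The remaining even orders are 4 and 8 from fields, 10 and 14 from difference columns, and
    the products 12, 30 and 32.\<close>
  consider "46 \<le> d" | "33 < d" "d \<le> 44" | "21 < d" "d \<le> 28" | "15 < d" "d \<le> 20"
    | "d = 4" | "d = 8" | "d = 10" | "d = 12" | "d = 14" | "d = 30" | "d = 32"
  proof -
    obtain k where k: "d = 2 * k" using even by (rule evenE)
    have "46 \<le> d \<or> (33 < d \<and> d \<le> 44) \<or> (21 < d \<and> d \<le> 28) \<or> (15 < d \<and> d \<le> 20)
        \<or> k \<in> {2, 4, 5, 6, 7, 15, 16}"
      using assms unfolding k by (simp, arith)
    then show ?thesis using that unfolding k by (elim disjE conjE insertE) simp_all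
  qed
  then show ?thesis
  proof cases
    case 1
    then show ?thesis using orth_array_large[OF even] by simp
  next
    case 2
    then show ?thesis by (intro between[of 11]) auto
  next
    case 3
    then show ?thesis by (intro between[of 7]) auto
  next
    case 4
    then show ?thesis by (intro between[of 5]) auto
  qed (use four eight ten fourteen prods in simp_all)
qed

section \<open>A family of order six\<close>

text \<open>The conjugates of the v are treated as separate unknowns w with
  \<open>v * w = 1\<close>, which makes the correlations polynomial. For the shift by 3 the left
  side collapses to (1 + e) times (v0 + v1 + v2) (w0 + w1 + w2) - 3, which explains the sum
  \<open>sqrt 3\<close>. The sign of i is left open because both signs are used.\<close>

lemma latin_correlations:
  fixes v0 v1 v2 w0 w1 w2 r e i o1 o2 :: complex
  assumes "v0 * w0 = 1" "v1 * w1 = 1" "v2 * w2 = 1" "v0 + v1 + v2 = r" "w0 + w1 + w2 = r"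
    and "r * r = 3" "e * e = 1" "i * i = -1" "2 * o1 = -1 + i * r" "2 * o2 = -1 - i * r"
  shows "(v0+e*v1)*(w0+e*w1) + (v0+e*i)*(w0-e*i) + (v2+e*v0)*(w2+e*w0) + (v2+e*i)*(w2-e*i) + (v1+e*v2)*(w1+e*w2) + (v1+e*i)*(w1-e*i) = 12"
    "(v0+e*v1)*(w0-e*i) + o2*((v0+e*i)*(w2+e*w0)) + o1*((v2+e*v0)*(w2-e*i)) + (v2+e*i)*(w1+e*w2) + o2*((v1+e*v2)*(w1-e*i)) + o1*((v1+e*i)*(w0+e*w1)) = 0"
    "(v0+e*v1)*(w2+e*w0) + o1*((v0+e*i)*(w2-e*i)) + o2*((v2+e*v0)*(w1+e*w2)) + (v2+e*i)*(w1-e*i) + o1*((v1+e*v2)*(w0+e*w1)) + o2*((v1+e*i)*(w0-e*i)) = 0"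
    "(v0+e*v1)*(w2-e*i) + (v0+e*i)*(w1+e*w2) + (v2+e*v0)*(w1-e*i) + (v2+e*i)*(w0+e*w1) + (v1+e*v2)*(w0-e*i) + (v1+e*i)*(w2+e*w0) = 0"
    "(v0+e*v1)*(w1+e*w2) + o2*((v0+e*i)*(w1-e*i)) + o1*((v2+e*v0)*(w0+e*w1)) + (v2+e*i)*(w0-e*i) + o2*((v1+e*v2)*(w2+e*w0)) + o1*((v1+e*i)*(w2-e*i)) = 0"
    "(v0+e*v1)*(w1-e*i) + o1*((v0+e*i)*(w0+e*w1)) + o2*((v2+e*v0)*(w0-e*i)) + (v2+e*i)*(w2+e*w0) + o1*((v1+e*v2)*(w2-e*i)) + o2*((v1+e*i)*(w1+e*w2)) = 0"
proof -
  have v2: "v2 = r - v0 - v1" "w2 = r - w0 - w1" 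
    using assms(4,5) by (auto simp: algebra_simps)
  note facts = assms(1-3) v2 assms(6-)
  show "(v0+e*v1)*(w0+e*w1) + (v0+e*i)*(w0-e*i) + (v2+e*v0)*(w2+e*w0) + (v2+e*i)*(w2-e*i) + (v1+e*v2)*(w1+e*w2) + (v1+e*i)*(w1-e*i) = 12"
    using facts by Groebner_Basis.algebra
  show "(v0+e*v1)*(w0-e*i) + o2*((v0+e*i)*(w2+e*w0)) + o1*((v2+e*v0)*(w2-e*i)) + (v2+e*i)*(w1+e*w2) + o2*((v1+e*v2)*(w1-e*i)) + o1*((v1+e*i)*(w0+e*w1)) = 0"
    using facts by Groebner_Basis.algebra
  show "(v0+e*v1)*(w2+e*w0) + o1*((v0+e*i)*(w2-e*i)) + o2*((v2+e*v0)*(w1+e*w2)) + (v2+e*i)*(w1-e*i) + o1*((v1+e*v2)*(w0+e*w1)) + o2*((v1+e*i)*(w0-e*i)) = 0"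
    using facts by Groebner_Basis.algebra
  show "(v0+e*v1)*(w2-e*i) + (v0+e*i)*(w1+e*w2) + (v2+e*v0)*(w1-e*i) + (v2+e*i)*(w0+e*w1) + (v1+e*v2)*(w0-e*i) + (v1+e*i)*(w2+e*w0) = 0"
    using facts by Groebner_Basis.algebra
  show "(v0+e*v1)*(w1+e*w2) + o2*((v0+e*i)*(w1-e*i)) + o1*((v2+e*v0)*(w0+e*w1)) + (v2+e*i)*(w0-e*i) + o2*((v1+e*v2)*(w2+e*w0)) + o1*((v1+e*i)*(w2-e*i)) = 0"
    using facts by Groebner_Basis.algebra
  show "(v0+e*v1)*(w1-e*i) + o1*((v0+e*i)*(w0+e*w1)) + o2*((v2+e*v0)*(w0-e*i)) + (v2+e*i)*(w2+e*w0) + o1*((v1+e*v2)*(w2-e*i)) + o2*((v1+e*i)*(w1+e*w2)) = 0"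
    using facts by Groebner_Basis.algebra
qed

section \<open>Cube roots of unity\<close>

definition omega :: complex where "omega = Complex (- 1 / 2) (sqrt 3 / 2)"

definition cub :: "nat \<Rightarrow> complex" where
  "cub n = (if n mod 3 = 0 then 1 else if n mod 3 = 1 then omega else cnj omega)"

lemma omega_simps: "omega * omega = cnj omega" "omega * cnj omega = 1" "cnj omega * omega = 1"
  "cnj omega * cnj omega = omega" "1 + omega + cnj omega = 0"
  unfolding omega_def by (simp_all add: complex_eq_iff)

lemma omega_sqrt3: "2 * omega = -1 + \<i> * of_real (sqrt 3)" "2 * cnj omega = -1 - \<i> * of_real (sqrt 3)"
  unfolding omega_def by (simp_all add: complex_eq_iff)

lemma cub_cong: "m mod 3 = n mod 3 \<Longrightarrow> cub m = cub n"
  unfolding cub_def by simp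

lemma cub_mult: "cub (m + n) = cub m * cub n"
proof -
  have "m mod 3 < 3" "n mod 3 < 3" by auto
  then have "m mod 3 = 0 \<or> m mod 3 = 1 \<or> m mod 3 = 2" "n mod 3 = 0 \<or> n mod 3 = 1 \<or> n mod 3 = 2" by auto
  then show ?thesis
    unfolding cub_def mod_add_eq[of m 3 n, symmetric] by (elim disjE) (simp_all add: omega_simps)
qed

lemma cub_zero [simp]: "cub 0 = 1"
  by (simp add: cub_def)

lemma cub_cnj: "cnj (cub n) = cub (2 * n)"
proof -
  have "n mod 3 < 3" by auto
  then have "n mod 3 = 0 \<or> n mod 3 = 1 \<or> n mod 3 = 2" by auto
  moreover have "2 * n mod 3 = 2 * (n mod 3) mod 3" by (simp add: mod_mult_right_eq)
  ultimately show ?thesis unfolding cub_def by (elim disjE) simp_all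
qed

lemma cub_unit: "cub n * cnj (cub n) = 1"
  unfolding cub_def by (simp add: omega_simps)

lemma cub_nonzero: "cub n \<noteq> 0"
  using cub_unit[of n] by auto

text \<open>For fixed \<open>s\<close> the values for even and odd \<open>p\<close> are the sum and the difference of two unit numbers. As
  \<open>s\<close> varies, these run through the circulant Latin square on \<open>v\<^sub>0, v\<^sub>1, v\<^sub>2\<close> completed by a constant row
  \<open>\<i>\<close>; the orthogonality relations then reduce to \<open>v\<^sub>0 + v\<^sub>1 + v\<^sub>2 = sqrt 3\<close>.\<close>

definition amp :: "(nat \<Rightarrow> complex) \<Rightarrow> nat \<Rightarrow> nat \<Rightarrow> complex" where
  "amp v p s = (if even s then v (s mod 3) + (-1) ^ p * v (Suc s mod 3) else v ((s + 2) mod 3) + (-1) ^ p * \<i>)"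

text \<open>The quadratic exponent is a chirp modulo 3: between two translates it changes by a term
  linear in the summation index, so a correlation becomes a sum over \<open>amp\<close> twisted by
  cube roots of unity. The squared moduli of \<open>amp\<close> along a line add up to 12, the
  square of \<open>2 * sqrt 3\<close>.\<close>

definition hex :: "(nat \<Rightarrow> complex) \<Rightarrow> nat \<Rightarrow> nat \<Rightarrow> complex" where
  "hex v p s = cub ((p + 2 * s)\<^sup>2 + s\<^sup>2) * amp v p s / of_real (2 * sqrt 3)"

text \<open>Differences modulo 6 are written with the factor 5 for \<open>-1\<close> to avoid truncated subtraction.\<close>

definition hex_tens :: "(nat \<Rightarrow> complex) \<Rightarrow> nat \<Rightarrow> nat \<Rightarrow> nat \<Rightarrow> nat \<Rightarrow> complex" where
  "hex_tens v a b c e = (if (a + e) mod 6 = (b + c) mod 6 then hex v (a + 5 * c) (a + 5 * b) else 0)"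

definition balanced :: "(nat \<Rightarrow> complex) \<Rightarrow> bool" where
  "balanced v \<longleftrightarrow> cmod (v 0) = 1 \<and> cmod (v 1) = 1 \<and> cmod (v 2) = 1 \<and> v 0 + v 1 + v 2 = of_real (sqrt 3)"

section \<open>Autocorrelations over the residues modulo 6\<close>

lemma sum6: "(\<Sum>s<6::nat. F s) = F 0 + F 1 + F 2 + F 3 + F 4 + F 5" for F :: "nat \<Rightarrow> complex"
  by (simp add: eval_nat_numeral)

lemma hex_mod: 
  assumes "p mod 6 = p' mod 6" "s mod 6 = s' mod 6"
  shows "hex v p s = hex v p' s'"
proof -
  have mm: "n mod 6 mod 3 = n mod 3" "n mod 6 mod 2 = n mod 2" for n :: nat
    by (simp_all add: mod_mod_cancel)
  have m3: "p mod 3 = p' mod 3" "s mod 3 = s' mod 3" using assms mm(1) by metis+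
  have ev: "even p = even p'" "even s = even s'" using assms mm(2) by (metis even_iff_mod_2_eq_zero)+
  have "(-1) ^ p = ((-1) ^ p' :: complex)" using ev by (simp add: uminus_power_if)
  moreover have "Suc s mod 3 = Suc s' mod 3" "(s + 2) mod 3 = (s' + 2) mod 3"
    using m3(2) by (metis mod_Suc_eq, metis mod_add_left_eq)
  moreover have "cub ((p + 2 * s)\<^sup>2 + s\<^sup>2) = cub ((p' + 2 * s')\<^sup>2 + s'\<^sup>2)"
  proof (rule cub_cong)
    have sq: "x\<^sup>2 mod 3 = y\<^sup>2 mod 3" if "x mod 3 = y mod 3" for x y :: nat
      using that by (metis power_mod)
    have "2 * s mod 3 = 2 * s' mod 3" using m3(2) by (metis mod_mult_right_eq)
    then have "(p + 2 * s) mod 3 = (p' + 2 * s') mod 3" by (rule mod_add_cong[OF m3(1)])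
    from sq[OF this] sq[OF m3(2)] show "((p + 2 * s)\<^sup>2 + s\<^sup>2) mod 3 = ((p' + 2 * s')\<^sup>2 + s'\<^sup>2) mod 3"
      by (rule mod_add_cong)
  qed
  ultimately show ?thesis unfolding hex_def amp_def by (simp add: m3 ev)
qed

lemma sum6_affine:
  fixes F :: "nat \<Rightarrow> complex" and a :: nat
  assumes "\<And>m n. m mod 6 = n mod 6 \<Longrightarrow> F m = F n"
  shows "(\<Sum>c<6. F (a + 5 * c)) = (\<Sum>p<6. F p)" "(\<Sum>c<6. F (c + a)) = (\<Sum>p<6. F p)"
proof -
  have inv: "(a + 5 * ((a + 5 * c) mod 6)) mod 6 = c" if "c < 6" for c :: nat
  proof -
    have "(a + 5 * ((a + 5 * c) mod 6)) mod 6 = (a + 5 * (a + 5 * c)) mod 6"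
      by (metis mod_add_right_eq mod_mult_right_eq)
    also have "a + 5 * (a + 5 * c) = c + 6 * (a + 4 * c)" by simp
    finally show ?thesis using that by (simp only: mod_mult_self2 mod_less)
  qed
  show "(\<Sum>c<6. F (a + 5 * c)) = (\<Sum>p<6. F p)"
    by (rule sum.reindex_bij_witness[of _ "\<lambda>p. (a + 5 * p) mod 6" "\<lambda>c. (a + 5 * c) mod 6"])
      (auto simp: inv intro!: assms)
  have inv: "((c + a) mod 6 + 5 * a) mod 6 = c" "((c + 5 * a) mod 6 + a) mod 6 = c" if "c < 6" for c :: nat
  proof -
    have "((c + a) mod 6 + 5 * a) mod 6 = (c + 6 * a) mod 6" "((c + 5 * a) mod 6 + a) mod 6 = (c + 6 * a) mod 6"
      by (simp_all add: mod_simps algebra_simps)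
    then show "((c + a) mod 6 + 5 * a) mod 6 = c" "((c + 5 * a) mod 6 + a) mod 6 = c" using that by (simp_all only: mod_mult_self2 mod_less)
  qed
  show "(\<Sum>c<6. F (c + a)) = (\<Sum>p<6. F p)"
    by (rule sum.reindex_bij_witness[of _ "\<lambda>p. (p + 5 * a) mod 6" "\<lambda>c. (c + a) mod 6"])
      (auto simp: inv intro!: assms)
qed

context
  fixes v :: "nat \<Rightarrow> complex"
  assumes balanced: "balanced v"
begin

lemma v_unit: "v 0 * cnj (v 0) = 1" "v 1 * cnj (v 1) = 1" "v 2 * cnj (v 2) = 1"
  using balanced complex_norm_square[of "v 0"] complex_norm_square[of "v 1"] complex_norm_square[of "v 2"]
  unfolding balanced_def by simp_all

lemma v_sum: "v 0 + v 1 + v 2 = of_real (sqrt 3)" "cnj (v 0) + cnj (v 1) + cnj (v 2) = of_real (sqrt 3)"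
proof -
  show "v 0 + v 1 + v 2 = of_real (sqrt 3)" using balanced unfolding balanced_def by simp
  then have "cnj (v 0 + v 1 + v 2) = of_real (sqrt 3)" by simp
  then show "cnj (v 0) + cnj (v 1) + cnj (v 2) = of_real (sqrt 3)" by simp
qed

text \<open>Conjugating a cube root of unity doubles its exponent, hence the factor 2 before the
  second quadratic form.\<close>

lemma hex_product:
  "hex v p s * cnj (hex v p' s') = cub ((p + 2 * s)\<^sup>2 + s\<^sup>2 + 2 * ((p' + 2 * s')\<^sup>2 + s'\<^sup>2)) * (amp v p s * cnj (amp v p' s')) / 12"
proof -
  have "2 * sqrt 3 * (2 * sqrt 3) = 12" by simp
  then have "of_real (2 * sqrt 3) * of_real (2 * sqrt 3) = (12 :: complex)"
    by (metis of_real_mult of_real_numeral)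
  then show ?thesis
    unfolding hex_def complex_cnj_mult complex_cnj_divide cub_cnj complex_cnj_complex_of_real
      cub_mult[of "(p + 2 * s)\<^sup>2 + s\<^sup>2"] times_divide_times_eq by (simp only: mult_ac)
qed

lemma less6_cases: "\<delta> < 6 \<Longrightarrow> \<delta> = 0 \<or> \<delta> = 1 \<or> \<delta> = 2 \<or> \<delta> = 3 \<or> \<delta> = 4 \<or> \<delta> = 5" for \<delta> :: nat
  by linarith

text \<open>Even and odd p carry x + y and x - y. Unless 3 divides \<delta>, each parity class sums
  three distinct cube roots of unity to zero. For \<delta> = 3 the two classes cancel because x and
  y have equal modulus.\<close>

lemma hex_correlation_p_less:
  assumes "\<delta> < 6"
  shows "(\<Sum>p<6. hex v p s * cnj (hex v (p + \<delta>) s)) = (if \<delta> = 0 then 1 else 0)"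
proof -
  obtain x y where amp: "\<And>p. amp v p s = x + (-1) ^ p * y" and xy: "x * cnj x = 1" "y * cnj y = 1"
  proof -
    have u: "v (n mod 3) * cnj (v (n mod 3)) = 1" for n
    proof -
      have "n mod 3 < 3" by simp
      then have "n mod 3 = 0 \<or> n mod 3 = 1 \<or> n mod 3 = 2" by linarith
      then show ?thesis using v_unit by auto
    qed
    show ?thesis
      by (rule that[of "if even s then v (s mod 3) else v ((s + 2) mod 3)" "if even s then v (Suc s mod 3) else \<i>"])
        (auto simp: amp_def u)
  qed
  \<comment> \<open>The terms quadratic in p have total coefficient 1 + 2 = 3, so modulo 3 only a
    linear phase remains.\<close>
  have "(p + 2 * s)\<^sup>2 + s\<^sup>2 + 2 * ((p + \<delta> + 2 * s)\<^sup>2 + s\<^sup>2)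
      = (\<delta> * p + (2 * s * \<delta> + 2 * \<delta>\<^sup>2)) + 3 * (p\<^sup>2 + 4 * p * s + 5 * s\<^sup>2 + p * \<delta> + 2 * s * \<delta>)" for p
    by (simp add: power2_eq_square algebra_simps)
  then have "cub ((p + 2 * s)\<^sup>2 + s\<^sup>2 + 2 * ((p + \<delta> + 2 * s)\<^sup>2 + s\<^sup>2)) = cub (\<delta> * p) * cub (2 * s * \<delta> + 2 * \<delta>\<^sup>2)" for p
    unfolding cub_mult[symmetric] by (intro cub_cong) (metis mod_mult_self2)
  then have "(\<Sum>p<6. hex v p s * cnj (hex v (p + \<delta>) s))
      = cub (2 * s * \<delta> + 2 * \<delta>\<^sup>2) / 12 * (\<Sum>p<6. cub (\<delta> * p) * ((x + (-1) ^ p * y) * cnj (x + (-1) ^ (p + \<delta>) * y)))"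
    unfolding hex_product amp sum_distrib_left by (intro sum.cong refl) simp
  moreover have "(\<Sum>p<6. cub (\<delta> * p) * ((x + (-1) ^ p * y) * cnj (x + (-1) ^ (p + \<delta>) * y))) = (if \<delta> = 0 then 12 else 0)"
  proof -
    have "(\<Sum>p<6. cub (\<delta> * p) * ((x + (-1) ^ p * y) * cnj (x + (-1) ^ (p + \<delta>) * y)))
        = (x + y) * cnj (x + (-1) ^ \<delta> * y) * (1 + cub (\<delta> * 2) + cub (\<delta> * 4))
        + (x - y) * cnj (x - (-1) ^ \<delta> * y) * (cub \<delta> + cub (\<delta> * 3) + cub (\<delta> * 5))"
      by (simp add: sum6 power_add algebra_simps)
    moreover have "1 + cnj omega + omega = 0" "omega + 1 + cnj omega = 0" "cnj omega + 1 + omega = 0"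
      using omega_simps(5) by (simp_all add: add_ac)
    ultimately show ?thesis
      using less6_cases[OF assms] xy omega_simps(5) by (elim disjE) (simp_all add: cub_def, simp_all add: algebra_simps)
  qed
  ultimately show ?thesis by (cases "\<delta> = 0") simp_all
qed

lemma hex_correlation_s_less:
  assumes "\<delta> < 6"
  shows "(\<Sum>s<6. hex v p s * cnj (hex v p (s + \<delta>))) = (if \<delta> = 0 then 1 else 0)"
proof -
  define e :: complex where "e = (-1) ^ p"
  have e: "e * e = 1" "cnj e = e" unfolding e_def by (simp_all add: uminus_power_if)
  have "(p + 2 * s)\<^sup>2 + s\<^sup>2 + 2 * ((p + 2 * (s + \<delta>))\<^sup>2 + (s + \<delta>)\<^sup>2)
      = (2 * \<delta> * s + (2 * \<delta> * p + \<delta>\<^sup>2)) + 3 * (p\<^sup>2 + 4 * p * s + 5 * s\<^sup>2 + 3 * \<delta>\<^sup>2 + 2 * p * \<delta> + 6 * s * \<delta>)" for s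
    by (simp add: power2_eq_square algebra_simps)
  then have "cub ((p + 2 * s)\<^sup>2 + s\<^sup>2 + 2 * ((p + 2 * (s + \<delta>))\<^sup>2 + (s + \<delta>)\<^sup>2)) = cub (2 * \<delta> * s) * cub (2 * \<delta> * p + \<delta>\<^sup>2)" for s
    unfolding cub_mult[symmetric] by (intro cub_cong) (metis mod_mult_self2)
  then have "(\<Sum>s<6. hex v p s * cnj (hex v p (s + \<delta>)))
      = cub (2 * \<delta> * p + \<delta>\<^sup>2) / 12 * (\<Sum>s<6. cub (2 * \<delta> * s) * (amp v p s * cnj (amp v p (s + \<delta>))))"
    unfolding hex_product sum_distrib_left by (intro sum.cong refl) (simp only: times_divide_eq_left times_divide_eq_right mult_ac)
  moreover have "(\<Sum>s<6. cub (2 * \<delta> * s) * (amp v p s * cnj (amp v p (s + \<delta>)))) = (if \<delta> = 0 then 12 else 0)"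
    using less6_cases[OF assms]
      latin_correlations[OF v_unit v_sum _ e(1) _ omega_sqrt3]
    by (elim disjE) (simp_all add: sum6 cub_def amp_def e_def[symmetric] e(2) numeral_2_eq_2[symmetric] flip: of_real_mult)
  ultimately show ?thesis by (cases "\<delta> = 0") simp_all
qed

text \<open>Along this line the sign \<open>(-1) ^ p\<close> flips with the parity of t. That
  affects only the constant row of the square, so the identities apply with -\<i> in place of \<i>
  and the two primitive cube roots exchanged.\<close>

lemma hex_correlation_ps_less:
  assumes "\<delta> < 6"
  shows "(\<Sum>t<6. hex v (\<tau> + 5 * t) t * cnj (hex v (\<tau> + 5 * t + \<delta>) (t + \<delta>))) = (if \<delta> = 0 then 1 else 0)"
proof -
  define e :: complex where "e = (-1) ^ \<tau>"
  have e: "e * e = 1" "cnj e = e" unfolding e_def by (simp_all add: uminus_power_if)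
  have "(P + 2 * t)\<^sup>2 + t\<^sup>2 + 2 * ((P + \<delta> + 2 * (t + \<delta>))\<^sup>2 + (t + \<delta>)\<^sup>2)
      = (\<delta> * t + 2 * \<delta>\<^sup>2) + 3 * ((P + 2 * t)\<^sup>2 + 4 * (P + 2 * t) * \<delta> + 6 * \<delta>\<^sup>2 + t\<^sup>2 + t * \<delta>)" for t P
    by (simp add: power2_eq_square algebra_simps)
  then have H: "cub ((P + 2 * t)\<^sup>2 + t\<^sup>2 + 2 * ((P + \<delta> + 2 * (t + \<delta>))\<^sup>2 + (t + \<delta>)\<^sup>2)) = cub (\<delta> * t) * cub (2 * \<delta>\<^sup>2)" for t P
    unfolding cub_mult[symmetric] by (intro cub_cong) (metis mod_mult_self2)
  have "(\<Sum>t<6. hex v (\<tau> + 5 * t) t * cnj (hex v (\<tau> + 5 * t + \<delta>) (t + \<delta>)))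
      = cub (2 * \<delta>\<^sup>2) / 12 * (\<Sum>t<6. cub (\<delta> * t) * (amp v (\<tau> + 5 * t) t * cnj (amp v (\<tau> + 5 * t + \<delta>) (t + \<delta>))))"
    unfolding hex_product H sum_distrib_left by (intro sum.cong refl) (simp only: times_divide_eq_left times_divide_eq_right mult_ac)
  moreover have "(\<Sum>t<6. cub (\<delta> * t) * (amp v (\<tau> + 5 * t) t * cnj (amp v (\<tau> + 5 * t + \<delta>) (t + \<delta>)))) = (if \<delta> = 0 then 12 else 0)"
    using less6_cases[OF assms]
      latin_correlations[OF v_unit v_sum _ e(1), of "- \<i>" "cnj omega" omega] omega_sqrt3
    by (elim disjE) (simp_all add: sum6 cub_def amp_def power_add e_def[symmetric] e(2) numeral_2_eq_2[symmetric] flip: of_real_mult)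
  ultimately show ?thesis by (cases "\<delta> = 0") simp_all
qed

lemma hex_correlation:
  shows "(\<Sum>p<6. hex v p s * cnj (hex v (p + \<delta>) s)) = (if \<delta> mod 6 = 0 then 1 else 0)"
    "(\<Sum>s<6. hex v p s * cnj (hex v p (s + \<delta>))) = (if \<delta> mod 6 = 0 then 1 else 0)"
    "(\<Sum>t<6. hex v (\<tau> + 5 * t) t * cnj (hex v (\<tau> + 5 * t + \<delta>) (t + \<delta>))) = (if \<delta> mod 6 = 0 then 1 else 0)"
proof -
  have \<delta>: "\<delta> mod 6 < 6" by simp
  have m: "hex v (p + \<delta> mod 6) s = hex v (p + \<delta>) s" "hex v p (s + \<delta> mod 6) = hex v p (s + \<delta>)"
    "hex v (p + \<delta> mod 6) (s + \<delta> mod 6) = hex v (p + \<delta>) (s + \<delta>)" for p s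
    by (rule hex_mod; simp add: mod_simps)+
  show "(\<Sum>p<6. hex v p s * cnj (hex v (p + \<delta>) s)) = (if \<delta> mod 6 = 0 then 1 else 0)"
    using hex_correlation_p_less[OF \<delta>, of s] unfolding m .
  show "(\<Sum>s<6. hex v p s * cnj (hex v p (s + \<delta>))) = (if \<delta> mod 6 = 0 then 1 else 0)"
    using hex_correlation_s_less[OF \<delta>, of p] unfolding m .
  show "(\<Sum>t<6. hex v (\<tau> + 5 * t) t * cnj (hex v (\<tau> + 5 * t + \<delta>) (t + \<delta>))) = (if \<delta> mod 6 = 0 then 1 else 0)"
    using hex_correlation_ps_less[OF \<delta>, of \<tau>] unfolding m .
qed

end

section \<open>Two-unitarity of the order-six tensors\<close>

lemma sum_residue:
  fixes F :: "nat \<Rightarrow> complex"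
  assumes "a < 6"
  shows "(\<Sum>e<6. if (a + e) mod 6 = n mod 6 then F e else 0) = F ((n + 5 * a) mod 6)"
proof -
  have "(a + e) mod 6 = n mod 6 \<longleftrightarrow> e = (n + 5 * a) mod 6" if "e < 6" for e
  proof
    assume *: "(a + e) mod 6 = n mod 6"
    have "(n + 5 * a) mod 6 = (a + e + 5 * a) mod 6" using * by (metis mod_add_left_eq)
    also have "a + e + 5 * a = e + 6 * a" by simp
    finally show "e = (n + 5 * a) mod 6" using that by simp
  next
    assume "e = (n + 5 * a) mod 6"
    then have "(a + e) mod 6 = (a + (n + 5 * a)) mod 6" by (metis mod_add_right_eq)
    also have "a + (n + 5 * a) = n + 6 * a" by simp
    finally show "(a + e) mod 6 = n mod 6" by simp
  qed
  then have "(\<Sum>e<6. if (a + e) mod 6 = n mod 6 then F e else 0) = (\<Sum>e<6. if e = (n + 5 * a) mod 6 then F e else 0)"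
    by (intro sum.cong) auto
  then show ?thesis by simp
qed

lemma cancel6: "(m + c) mod 6 = (n + c) mod 6 \<longleftrightarrow> m mod 6 = n mod 6" for m n c :: nat
proof
  assume "(m + c) mod 6 = (n + c) mod 6"
  then have "(m + c + 5 * c) mod 6 = (n + c + 5 * c) mod 6" by (metis mod_add_left_eq)
  moreover have "m + c + 5 * c = m + 6 * c" "n + c + 5 * c = n + 6 * c" by simp_all
  ultimately show "m mod 6 = n mod 6" by simp
qed (metis mod_add_left_eq)

lemma diff6: "a < 6 \<Longrightarrow> a' < 6 \<Longrightarrow> (a' + 5 * a) mod 6 = 0 \<longleftrightarrow> a' = a" for a a' :: nat
  using cancel6[of a' "5 * a" a] by simp

context
  fixes v :: "nat \<Rightarrow> complex"
  assumes balanced: "balanced v"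
begin

text \<open>For a fixed row pair the free column index runs over a line on which the second row is a
  translate of the first, so each orthonormality relation is an autocorrelation of \<^const>\<open>hex\<close>.\<close>

lemma hex_tens_rows:
  shows "row_orthonormal 6 (hex_tens v)"
    and "row_orthonormal 6 (\<lambda>a b c e. hex_tens v a c b e)"
    and "row_orthonormal 6 (\<lambda>a b c e. hex_tens v a e c b)"
proof -
  show "row_orthonormal 6 (hex_tens v)"
    unfolding row_orthonormal_def
  proof (intro allI impI)
    fix a b a' b' :: nat assume lt: "a < 6" "b < 6" "a' < 6" "b' < 6"
    have cond: "(a' + (b + c + 5 * a) mod 6) mod 6 = (b' + c) mod 6 \<longleftrightarrow> (a' + b + 5 * a) mod 6 = b' mod 6" for c
    proof -
      have "(a' + (b + c + 5 * a) mod 6) mod 6 = ((a' + b + 5 * a) + c) mod 6"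
        by (simp add: mod_simps add_ac)
      then show ?thesis using cancel6 by metis
    qed
    have "(\<Sum>e<6. hex_tens v a b c e * cnj (hex_tens v a' b' c e))
        = (if (a' + b + 5 * a) mod 6 = b' mod 6 then hex v (a + 5 * c) (a + 5 * b) * cnj (hex v (a' + 5 * c) (a' + 5 * b')) else 0)" for c
    proof -
      have "(\<Sum>e<6. hex_tens v a b c e * cnj (hex_tens v a' b' c e))
        = (\<Sum>e<6. if (a + e) mod 6 = (b + c) mod 6 then hex v (a + 5 * c) (a + 5 * b) * cnj (hex_tens v a' b' c e) else 0)"
        by (intro sum.cong) (auto simp: hex_tens_def)
      then show ?thesis unfolding sum_residue[OF lt(1)] unfolding hex_tens_def cond by simp
    qed
    then have S: "(\<Sum>c<6. \<Sum>e<6. hex_tens v a b c e * cnj (hex_tens v a' b' c e))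
        = (if (a' + b + 5 * a) mod 6 = b' mod 6 then \<Sum>c<6. hex v (a + 5 * c) (a + 5 * b) * cnj (hex v (a' + 5 * c) (a' + 5 * b')) else 0)"
      by simp
    show "(\<Sum>c<6. \<Sum>e<6. hex_tens v a b c e * cnj (hex_tens v a' b' c e)) = (if a = a' \<and> b = b' then 1 else 0)"
    proof (cases "(a' + b + 5 * a) mod 6 = b' mod 6")
      case True
      have "(a' + 5 * b') mod 6 = (a' + 5 * (a' + b + 5 * a)) mod 6" using True by (metis mod_add_right_eq mod_mult_right_eq)
      also have "a' + 5 * (a' + b + 5 * a) = (a + 5 * b) + 6 * (a' + 4 * a)" by simp
      finally have s: "(a' + 5 * b') mod 6 = (a + 5 * b) mod 6" by (simp only: mod_mult_self2)
      have p: "(a' + 5 * c) mod 6 = (a + 5 * c + (a' + 5 * a)) mod 6" for c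
      proof -
        have "a + 5 * c + (a' + 5 * a) = (a' + 5 * c) + 6 * a" by simp
        then show ?thesis by (simp only: mod_mult_self2)
      qed
      have "(\<Sum>c<6. hex v (a + 5 * c) (a + 5 * b) * cnj (hex v (a' + 5 * c) (a' + 5 * b')))
        = (\<Sum>c<6. hex v (a + 5 * c) (a + 5 * b) * cnj (hex v (a + 5 * c + (a' + 5 * a)) (a + 5 * b)))"
        by (intro sum.cong refl arg_cong2[of _ _ _ _ "(*)"] arg_cong[of _ _ cnj] hex_mod p s)
      also have "\<dots> = (\<Sum>p<6. hex v p (a + 5 * b) * cnj (hex v (p + (a' + 5 * a)) (a + 5 * b)))"
        by (rule sum6_affine(1)[of "\<lambda>p. hex v p (a + 5 * b) * cnj (hex v (p + (a' + 5 * a)) (a + 5 * b))"])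
          (intro arg_cong2[of _ _ _ _ "(*)"] arg_cong[of _ _ cnj] hex_mod refl mod_add_cong, assumption+)
      also have "\<dots> = (if a' = a then 1 else 0)"
        unfolding hex_correlation(1)[OF balanced] diff6[OF lt(1,3)] ..
      finally show ?thesis
        using True S lt by (auto simp: add.commute[of b])
    next
      case False
      then show ?thesis using S by (auto simp: add.commute[of b])
    qed
  qed
  show "row_orthonormal 6 (\<lambda>a b c e. hex_tens v a c b e)"
    unfolding row_orthonormal_def
  proof (intro allI impI)
    fix a b a' b' :: nat assume lt: "a < 6" "b < 6" "a' < 6" "b' < 6"
    have cond: "(a' + (c + b + 5 * a) mod 6) mod 6 = (c + b') mod 6 \<longleftrightarrow> (a' + b + 5 * a) mod 6 = b' mod 6" for c
    proof -
      have "(a' + (c + b + 5 * a) mod 6) mod 6 = ((a' + b + 5 * a) + c) mod 6"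
        by (simp add: mod_simps add_ac)
      then show ?thesis using cancel6[of "a' + b + 5 * a" c b'] by (simp add: add.commute[of c])
    qed
    have "(\<Sum>e<6. hex_tens v a c b e * cnj (hex_tens v a' c b' e))
        = (if (a' + b + 5 * a) mod 6 = b' mod 6 then hex v (a + 5 * b) (a + 5 * c) * cnj (hex v (a' + 5 * b') (a' + 5 * c)) else 0)" for c
    proof -
      have "(\<Sum>e<6. hex_tens v a c b e * cnj (hex_tens v a' c b' e))
        = (\<Sum>e<6. if (a + e) mod 6 = (c + b) mod 6 then hex v (a + 5 * b) (a + 5 * c) * cnj (hex_tens v a' c b' e) else 0)"
        by (intro sum.cong) (auto simp: hex_tens_def)
      then show ?thesis unfolding sum_residue[OF lt(1)] unfolding hex_tens_def cond by simp
    qed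
    then have S: "(\<Sum>c<6. \<Sum>e<6. hex_tens v a c b e * cnj (hex_tens v a' c b' e))
        = (if (a' + b + 5 * a) mod 6 = b' mod 6 then \<Sum>c<6. hex v (a + 5 * b) (a + 5 * c) * cnj (hex v (a' + 5 * b') (a' + 5 * c)) else 0)"
      by simp
    show "(\<Sum>c<6. \<Sum>e<6. hex_tens v a c b e * cnj (hex_tens v a' c b' e)) = (if a = a' \<and> b = b' then 1 else 0)"
    proof (cases "(a' + b + 5 * a) mod 6 = b' mod 6")
      case True
      have "(a' + 5 * b') mod 6 = (a' + 5 * (a' + b + 5 * a)) mod 6" using True by (metis mod_add_right_eq mod_mult_right_eq)
      also have "a' + 5 * (a' + b + 5 * a) = (a + 5 * b) + 6 * (a' + 4 * a)" by simp
      finally have s: "(a' + 5 * b') mod 6 = (a + 5 * b) mod 6" by (simp only: mod_mult_self2)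
      have p: "(a' + 5 * c) mod 6 = (a + 5 * c + (a' + 5 * a)) mod 6" for c
      proof -
        have "a + 5 * c + (a' + 5 * a) = (a' + 5 * c) + 6 * a" by simp
        then show ?thesis by (simp only: mod_mult_self2)
      qed
      have "(\<Sum>c<6. hex v (a + 5 * b) (a + 5 * c) * cnj (hex v (a' + 5 * b') (a' + 5 * c)))
        = (\<Sum>c<6. hex v (a + 5 * b) (a + 5 * c) * cnj (hex v (a + 5 * b) (a + 5 * c + (a' + 5 * a))))"
        by (intro sum.cong refl arg_cong2[of _ _ _ _ "(*)"] arg_cong[of _ _ cnj] hex_mod p s)
      also have "\<dots> = (\<Sum>s<6. hex v (a + 5 * b) s * cnj (hex v (a + 5 * b) (s + (a' + 5 * a))))"
        by (rule sum6_affine(1)[of "\<lambda>s. hex v (a + 5 * b) s * cnj (hex v (a + 5 * b) (s + (a' + 5 * a)))"])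
          (intro arg_cong2[of _ _ _ _ "(*)"] arg_cong[of _ _ cnj] hex_mod refl mod_add_cong, assumption+)
      also have "\<dots> = (if a' = a then 1 else 0)"
        unfolding hex_correlation(2)[OF balanced] diff6[OF lt(1,3)] ..
      finally show ?thesis
        using True S lt by (auto simp: add.commute[of b])
    next
      case False
      then show ?thesis using S by (auto simp: add.commute[of b])
    qed
  qed
  show "row_orthonormal 6 (\<lambda>a b c e. hex_tens v a e c b)"
    unfolding row_orthonormal_def
  proof (intro allI impI)
    fix a b a' b' :: nat assume lt: "a < 6" "b < 6" "a' < 6" "b' < 6"
    have T: "hex_tens v x e c y = (if (c + e) mod 6 = (x + y) mod 6 then hex v (x + 5 * c) (x + 5 * e) else 0)" for x e c y
      unfolding hex_tens_def by (simp add: add.commute[of e] eq_commute)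
    have "(\<Sum>e<6. hex_tens v a e c b * cnj (hex_tens v a' e c b'))
        = (if (a' + b') mod 6 = (a + b) mod 6 then hex v (a + 5 * c) (c + 5 * b) * cnj (hex v (a' + 5 * c) (c + 5 * b')) else 0)" if c: "c < 6" for c
    proof -
      define e0 where "e0 = (a + b + 5 * c) mod 6"
      have "(\<Sum>e<6. hex_tens v a e c b * cnj (hex_tens v a' e c b'))
        = (\<Sum>e<6. if (c + e) mod 6 = (a + b) mod 6 then hex v (a + 5 * c) (a + 5 * e) * cnj (hex_tens v a' e c b') else 0)"
        by (intro sum.cong) (auto simp: T)
      also have "\<dots> = hex v (a + 5 * c) (a + 5 * e0) * cnj (hex_tens v a' e0 c b')"
        unfolding sum_residue[OF c] e0_def ..
      finally have 1: "(\<Sum>e<6. hex_tens v a e c b * cnj (hex_tens v a' e c b')) = hex v (a + 5 * c) (a + 5 * e0) * cnj (hex_tens v a' e0 c b')" .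
      have ce: "(c + e0) mod 6 = (a + b) mod 6"
      proof -
        have "(c + e0) mod 6 = (c + (a + b + 5 * c)) mod 6" unfolding e0_def by (simp only: mod_add_right_eq)
        also have "c + (a + b + 5 * c) = (a + b) + 6 * c" by simp
        finally show ?thesis by (simp only: mod_mult_self2)
      qed
      have s: "(x + 5 * e0) mod 6 = (c + 5 * y) mod 6" if "(x + y) mod 6 = (a + b) mod 6" for x y
      proof -
        have "(x + 5 * e0) mod 6 = (x + 5 * (a + b + 5 * c)) mod 6" unfolding e0_def by (metis mod_add_right_eq mod_mult_right_eq)
        also have "\<dots> = (x + 25 * c + 5 * (a + b)) mod 6" by (simp add: algebra_simps)
        also have "\<dots> = (x + 25 * c + 5 * (x + y)) mod 6" using that by (metis mod_add_right_eq mod_mult_right_eq)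
        also have "x + 25 * c + 5 * (x + y) = (c + 5 * y) + 6 * (x + 4 * c)" by simp
        finally show ?thesis by (simp only: mod_mult_self2)
      qed
      have "hex v (a + 5 * c) (a + 5 * e0) = hex v (a + 5 * c) (c + 5 * b)" by (rule hex_mod[OF refl s]) simp
      moreover have "hex_tens v a' e0 c b' = (if (a' + b') mod 6 = (a + b) mod 6 then hex v (a' + 5 * c) (c + 5 * b') else 0)"
        unfolding T ce using hex_mod[OF refl s, of a' b' v "a' + 5 * c"] by auto
      ultimately show ?thesis unfolding 1 by simp
    qed
    then have S: "(\<Sum>c<6. \<Sum>e<6. hex_tens v a e c b * cnj (hex_tens v a' e c b'))
        = (if (a' + b') mod 6 = (a + b) mod 6 then \<Sum>c<6. hex v (a + 5 * c) (c + 5 * b) * cnj (hex v (a' + 5 * c) (c + 5 * b')) else 0)"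
      by simp
    show "(\<Sum>c<6. \<Sum>e<6. hex_tens v a e c b * cnj (hex_tens v a' e c b')) = (if a = a' \<and> b = b' then 1 else 0)"
    proof (cases "(a' + b') mod 6 = (a + b) mod 6")
      case True
      \<comment> \<open>On the support the arguments of \<open>hex\<close> are a - c and c - b, with
        constant sum a - b. As a + b = a' + b' modulo 6, the second row shifts both by the same a' -
        a: the diagonal correlation.\<close>
      let ?\<delta> = "a' + 5 * a" and ?\<tau> = "a + 5 * b"
      have p: "(a + 5 * c) mod 6 = (?\<tau> + 5 * (c + 5 * b)) mod 6" for c
      proof -
        have "?\<tau> + 5 * (c + 5 * b) = (a + 5 * c) + 6 * (5 * b)" by simp
        then show ?thesis by (simp only: mod_mult_self2)
      qed
      have p': "(a' + 5 * c) mod 6 = (?\<tau> + 5 * (c + 5 * b) + ?\<delta>) mod 6" for c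
      proof -
        have "?\<tau> + 5 * (c + 5 * b) + ?\<delta> = (a' + 5 * c) + 6 * (a + 5 * b)" by simp
        then show ?thesis by (simp only: mod_mult_self2)
      qed
      have s': "(c + 5 * b') mod 6 = (c + 5 * b + ?\<delta>) mod 6" for c
      proof -
        have "(c + 5 * b') mod 6 = (c + a' + 5 * (a' + b')) mod 6"
        proof -
          have "c + a' + 5 * (a' + b') = (c + 5 * b') + 6 * a'" by simp
          then show ?thesis by (simp only: mod_mult_self2)
        qed
        also have "\<dots> = (c + a' + 5 * (a + b)) mod 6" using True by (metis mod_add_right_eq mod_mult_right_eq)
        finally show ?thesis by (simp add: algebra_simps)
      qed
      have "(\<Sum>c<6. hex v (a + 5 * c) (c + 5 * b) * cnj (hex v (a' + 5 * c) (c + 5 * b')))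
        = (\<Sum>c<6. hex v (?\<tau> + 5 * (c + 5 * b)) (c + 5 * b) * cnj (hex v (?\<tau> + 5 * (c + 5 * b) + ?\<delta>) (c + 5 * b + ?\<delta>)))"
        by (intro sum.cong refl arg_cong2[of _ _ _ _ "(*)"] arg_cong[of _ _ cnj] hex_mod p p' s')
      also have "\<dots> = (\<Sum>t<6. hex v (?\<tau> + 5 * t) t * cnj (hex v (?\<tau> + 5 * t + ?\<delta>) (t + ?\<delta>)))"
        by (rule sum6_affine(2)[of "\<lambda>t. hex v (?\<tau> + 5 * t) t * cnj (hex v (?\<tau> + 5 * t + ?\<delta>) (t + ?\<delta>))"])
          (intro arg_cong2[of _ _ _ _ "(*)"] arg_cong[of _ _ cnj] hex_mod refl mod_add_cong mod_mult_cong, assumption+)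
      also have "\<dots> = (if a' = a then 1 else 0)"
        unfolding hex_correlation(3)[OF balanced] diff6[OF lt(1,3)] ..
      finally show ?thesis
        using True S lt cancel6[of b' a b] by (auto simp: add.commute[of a])
    next
      case False
      then show ?thesis using S by auto
    qed
  qed
qed

lemma two_unitary_hex: "two_unitary 6 (of_tens 6 (hex_tens v))"
  unfolding two_unitary_of_tens_iff using hex_tens_rows by blast

end

lemma of_tens_eqI:
  assumes "\<And>q. q \<in> idx d \<Longrightarrow> tens d (of_tens d S) q = tens d (of_tens d T) q"
  shows "of_tens d S = of_tens d T"
proof (rule eq_matI)
  fix r c assume "r < dim_row (of_tens d T)" "c < dim_col (of_tens d T)"
  then have rc: "r < d*d" "c < d*d" by (auto simp: of_tens_def)
  then have d: "0 < d" by (cases d) auto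
  have "quad (r div d) (r mod d) (c div d) (c mod d) \<in> idx d"
    using rc d by (simp add: less_mult_imp_div_less)
  from assms[OF this] show "of_tens d S $$ (r, c) = of_tens d T $$ (r, c)"
    by (simp add: tens_def)
qed (auto simp: of_tens_def)

section \<open>Translation invariance and transversality\<close>

definition shift :: "nat \<Rightarrow> (nat \<Rightarrow> nat) \<Rightarrow> nat \<Rightarrow> nat" where
  "shift k q = (\<lambda>i\<in>{..<4}. (q i + k) mod 6)"

lemma shift_inverse: "q \<in> idx 6 \<Longrightarrow> (k + l) mod 6 = 0 \<Longrightarrow> shift k (shift l q) = q"
proof
  fix i assume q: "q \<in> idx 6" and kl: "(k + l) mod 6 = 0"
  show "shift k (shift l q) i = q i"
  proof (cases "i < 4")
    case True
    have "((q i + l) mod 6 + k) mod 6 = (q i + (k + l)) mod 6"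
      by (simp only: mod_add_left_eq) (simp only: add_ac)
    also have "\<dots> = (q i + (k + l) mod 6) mod 6" by (simp only: mod_add_right_eq)
    also have "\<dots> = q i" using kl idx_less[OF q True] by simp
    finally show ?thesis using True by (simp add: shift_def)
  next
    case False
    then have "q i = undefined" using q PiE_arb[of q "{..<4}" "\<lambda>_. {..<6}" i] by (simp add: idx_def)
    then show ?thesis using False by (simp add: shift_def)
  qed
qed

lemma shift_idx: "shift k q \<in> idx 6"
  unfolding shift_def idx_def by auto

lemma sum_shift: "(\<Sum>q\<in>idx 6. F (shift k q)) = (\<Sum>q\<in>idx 6. F q)" for F :: "(nat \<Rightarrow> nat) \<Rightarrow> complex"
proof -
  have "(k + 5 * k) mod 6 = 0" "(5 * k + k) mod 6 = 0" by simp_all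
  then show ?thesis
    by (intro sum.reindex_bij_witness[of _ "shift (5 * k)" "shift k"]) (auto simp: shift_inverse shift_idx)
qed

definition hex_state :: "(nat \<Rightarrow> complex) \<Rightarrow> (nat \<Rightarrow> nat) \<Rightarrow> complex" where
  "hex_state v = tens 6 (of_tens 6 (hex_tens v))"

lemma hex_state: "q \<in> idx 6 \<Longrightarrow> hex_state v q = hex_tens v (q 0) (q 1) (q 2) (q 3)"
  unfolding hex_state_def by (rule tens_of_tens)

lemma hex_state_shift:
  assumes q: "q \<in> idx 6"
  shows "hex_state v (shift k q) = hex_state v q"
proof -
  have m: "(((a + k) mod 6) + ((b + k) mod 6)) mod 6 = (a + b + (k + k)) mod 6" for a b :: nat
    unfolding mod_add_eq by (simp add: algebra_simps)
  have n: "((a + k) mod 6 + 5 * ((b + k) mod 6)) mod 6 = (a + 5 * b) mod 6" for a b :: nat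
  proof -
    have "((a + k) mod 6 + 5 * ((b + k) mod 6)) mod 6 = (a + k + 5 * (b + k)) mod 6"
      unfolding mod_add_left_eq by (metis mod_add_right_eq mod_mult_right_eq)
    also have "a + k + 5 * (b + k) = (a + 5 * b) + 6 * k" by simp
    finally show ?thesis by (simp only: mod_mult_self2)
  qed
  show ?thesis
    unfolding hex_state[OF q] hex_state[OF shift_idx] hex_tens_def
    by (simp add: shift_def m cancel6 hex_mod[OF n n])
qed

text \<open>The support is a linear condition in which every index has coefficient 1 or -1. This is
  the diagonal half of the Weyl-Heisenberg symmetry: off-diagonal entries of a local operator do not
  contribute.\<close>

lemma hex_tens_support:
  assumes "hex_state v q \<noteq> 0" "hex_state v' (q(i := x)) \<noteq> 0" "q \<in> idx 6" "i < 4" "x < 6"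
  shows "x = q i"
proof -
  have q: "(q 0 + q 3) mod 6 = (q 1 + q 2) mod 6"
    using assms(1) unfolding hex_state[OF assms(3)] hex_tens_def by (auto split: if_splits)
  have q': "((q(i := x)) 0 + (q(i := x)) 3) mod 6 = ((q(i := x)) 1 + (q(i := x)) 2) mod 6"
    using assms(2) unfolding hex_state[OF idx_upd[OF assms(3-5)]] hex_tens_def by (auto split: if_splits)
  have c: "m = n" if "(m + c) mod 6 = (n + c) mod 6" "m < 6" "n < 6" for m n c :: nat
    using that cancel6[of m c n] by simp
  have "q i < 6" by (rule idx_less[OF assms(3,4)])
  moreover have "\<exists>c. (x + c) mod 6 = (q i + c) mod 6"
  proof -
    consider "i = 0" | "i = 1" | "i = 2" | "i = 3" using assms(4) unfolding less4_cases by fastforce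
    then show ?thesis
    proof cases
      case 1
      then show ?thesis using q q' by (intro exI[of _ "q 3"]) simp
    next
      case 2
      then show ?thesis using q q' by (intro exI[of _ "q 2"]) simp
    next
      case 3
      then have "(q 1 + x) mod 6 = (q 1 + q 2) mod 6" using q q' by simp
      then show ?thesis using 3 by (metis add.commute)
    next
      case 4
      then have "(q 0 + x) mod 6 = (q 0 + q 3) mod 6" using q q' by simp
      then show ?thesis using 4 by (metis add.commute)
    qed
  qed
  ultimately show ?thesis using c assms(5) by blast
qed

text \<open>The symmetry projects X onto its scalar part: the support condition leaves only the
  diagonal of X, and averaging over translations leaves only its trace. Both tensors share the
  symmetry, hence the statement covers two different parameters.\<close>

lemma ip_act_hex:
  assumes i: "i < 4"
  shows "6 * ip 6 (hex_state v') (act 6 i X (hex_state v)) = (\<Sum>x<6. X x x) * ip 6 (hex_state v') (hex_state v)"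
proof -
  define G where "G = (\<lambda>q. cnj (hex_state v' q) * hex_state v q)"
  have G: "G (shift k q) = G q" if "q \<in> idx 6" for k q
    unfolding G_def using hex_state_shift[OF that] by simp
  have "cnj (hex_state v' q) * act 6 i X (hex_state v) q = X (q i) (q i) * G q" if q: "q \<in> idx 6" for q
  proof (cases "hex_state v' q = 0")
    case False
    have "act 6 i X (hex_state v) q = (\<Sum>x<6. if x = q i then X (q i) (q i) * hex_state v q else 0)"
      unfolding act_def using hex_tens_support[OF False _ q i] by (intro sum.cong) auto
    then show ?thesis using idx_less[OF q i] unfolding G_def by simp
  qed (simp add: G_def)
  then have S: "ip 6 (hex_state v') (act 6 i X (hex_state v)) = (\<Sum>q\<in>idx 6. X (q i) (q i) * G q)"
    unfolding ip_def by (intro sum.cong) auto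
  \<comment> \<open>Translating all four indices shifts the diagonal of X cyclically; the sum over
    the six translations then gives the trace.\<close>
  have eq: "(\<Sum>q\<in>idx 6. X (q i) (q i) * G q) = (\<Sum>q\<in>idx 6. X ((k + q i) mod 6) ((k + q i) mod 6) * G q)" for k
  proof -
    have "(\<Sum>q\<in>idx 6. X (q i) (q i) * G q) = (\<Sum>q\<in>idx 6. X (shift k q i) (shift k q i) * G (shift k q))"
      by (rule sum_shift[symmetric])
    also have "\<dots> = (\<Sum>q\<in>idx 6. X ((k + q i) mod 6) ((k + q i) mod 6) * G q)"
      using i by (intro sum.cong refl) (simp add: G, simp add: shift_def add.commute)
    finally show ?thesis .
  qed
  have "(\<Sum>k<6::nat. (\<Sum>q\<in>idx 6. X (q i) (q i) * G q)) = (\<Sum>k<6. \<Sum>q\<in>idx 6. X ((k + q i) mod 6) ((k + q i) mod 6) * G q)"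
    by (rule sum.cong[OF refl], rule eq)
  also have "\<dots> = (\<Sum>q\<in>idx 6. (\<Sum>k<6. X ((k + q i) mod 6) ((k + q i) mod 6)) * G q)"
    by (subst sum.swap) (simp add: sum_distrib_right)
  also have "\<dots> = (\<Sum>q\<in>idx 6. (\<Sum>x<6. X x x) * G q)"
  proof (rule sum.cong[OF refl])
    fix q :: "nat \<Rightarrow> nat"
    have "(\<Sum>k<6. X ((k + q i) mod 6) ((k + q i) mod 6)) = (\<Sum>x<6. X (x mod 6) (x mod 6))"
      by (rule sum6_affine(2)[of "\<lambda>n. X (n mod 6) (n mod 6)"]) simp
    then show "(\<Sum>k<6. X ((k + q i) mod 6) ((k + q i) mod 6)) * G q = (\<Sum>x<6. X x x) * G q" by simp
  qed
  finally show ?thesis unfolding S by (simp add: ip_def G_def sum_distrib_left)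
qed

text \<open>After removal of common factors these entries differ by the constant 2 \<i>, whatever v
  is. If two states are proportional, comparing the differences makes the factor 1.\<close>

lemma hex_state_values:
  shows "hex_state v (quad 3 0 3 0) = (v 2 + \<i>) / of_real (2 * sqrt 3)"
    and "hex_state v (quad 3 0 2 5) = cub 58 * (v 2 - \<i>) / of_real (2 * sqrt 3)"
proof -
  have "cub 585 = 1" "cub 370 = cub 58" by (simp_all add: cub_def)
  then show "hex_state v (quad 3 0 3 0) = (v 2 + \<i>) / of_real (2 * sqrt 3)"
    "hex_state v (quad 3 0 2 5) = cub 58 * (v 2 - \<i>) / of_real (2 * sqrt 3)"
    by (simp_all add: hex_state hex_tens_def hex_def amp_def numeral_2_eq_2[symmetric])
qed

section \<open>Parameters and separation for order six\<close>

text \<open>The other two parameters are unit numbers with midpoint m, namely m plus and minus a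
  perpendicular multiple of m. They exist because m is nonzero and, by positivity of
  \<open>Re z\<close>, has modulus at most 1.\<close>

lemma balanced_exists:
  assumes z: "cmod z = 1" "0 < Re z"
  shows "\<exists>v. balanced v \<and> v 2 = z"
proof -
  define m where "m = (of_real (sqrt 3) - z) / 2"
  have "(cmod (of_real (sqrt 3) - z))\<^sup>2 = 4 - 2 * sqrt 3 * Re z"
  proof -
    have "(Re z)\<^sup>2 + (Im z)\<^sup>2 = 1" using z(1) cmod_power2[of z] by simp
    then show ?thesis by (simp add: cmod_power2 power2_diff algebra_simps)
  qed
  then have m2: "(cmod m)\<^sup>2 = 1 - sqrt 3 * Re z / 2" unfolding m_def by (simp add: norm_divide power_divide)
  have m1: "(cmod m)\<^sup>2 \<le> 1" unfolding m2 using z by simp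
  have m0: "m \<noteq> 0"
  proof
    assume "m = 0"
    then have "of_real (sqrt 3) = z" unfolding m_def by simp
    then have "cmod (complex_of_real (sqrt 3)) = 1" using z by simp
    then show False by simp
  qed
  define t where "t = sqrt ((1 - (cmod m)\<^sup>2) / (cmod m)\<^sup>2)"
  have "t\<^sup>2 = (1 - (cmod m)\<^sup>2) / (cmod m)\<^sup>2" unfolding t_def using m1 by simp
  then have t: "(cmod m)\<^sup>2 * (1 + t\<^sup>2) = 1" using m0 by (simp add: field_simps)
  have n: "cmod (m * (1 + \<i> * of_real s)) = 1" if "s\<^sup>2 = t\<^sup>2" for s
  proof -
    have "(cmod (m * (1 + \<i> * of_real s)))\<^sup>2 = (cmod m)\<^sup>2 * (1 + s\<^sup>2)"
      by (simp add: norm_mult power_mult_distrib cmod_power2)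
    then have "(cmod (m * (1 + \<i> * of_real s)))\<^sup>2 = 1\<^sup>2" using t that by simp
    then show ?thesis by (rule power2_eq_imp_eq) simp_all
  qed
  define v where "v = (\<lambda>j::nat. if j = 0 then m * (1 + \<i> * of_real t) else if j = 1 then m * (1 + \<i> * of_real (- t)) else z)"
  have "v 0 + v 1 + v 2 = 2 * m + z" unfolding v_def by (simp add: algebra_simps)
  moreover have "2 * m = of_real (sqrt 3) - z" unfolding m_def by simp
  ultimately have "v 0 + v 1 + v 2 = of_real (sqrt 3)" by (metis diff_add_cancel)
  then have "balanced v \<and> v 2 = z" unfolding balanced_def using n[of t] n[of "- t"] z unfolding v_def by simp
  then show ?thesis by blast
qed

lemma infinite_LU_classes_6: "infinite ({U. two_unitary 6 U} // LU_rel 6)"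
proof -
  let ?F = "{of_tens 6 (hex_tens v) | v. balanced v}"
  let ?f = "\<lambda>U. tens 6 U (quad 3 0 3 0)"
  \<comment> \<open>The entry at \<open>quad 3 0 3 0\<close> depends on v only through
    \<open>v 2\<close>, here the unit number with imaginary part t; its imaginary part recovers
    t.\<close>
  define h where "h = (\<lambda>t::real. (Complex (sqrt (1 - t\<^sup>2)) t + \<i>) / of_real (2 * sqrt 3))"
  have "h ` {0<..<1} \<subseteq> ?f ` ?F"
  proof
    fix y assume "y \<in> h ` {0<..<1}"
    then obtain t where t: "0 < t" "t < 1" "y = h t" by auto
    then have "t\<^sup>2 < 1" by (simp add: power_less_one_iff)
    then have "cmod (Complex (sqrt (1 - t\<^sup>2)) t) = 1" "0 < Re (Complex (sqrt (1 - t\<^sup>2)) t)"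
      by (simp_all add: cmod_def)
    from balanced_exists[OF this] obtain v where v: "balanced v" "v 2 = Complex (sqrt (1 - t\<^sup>2)) t" by blast
    then have "y = ?f (of_tens 6 (hex_tens v))"
      using hex_state_values(1)[of v] t(3) unfolding h_def hex_state_def by (simp only:)
    then show "y \<in> ?f ` ?F" using v by blast
  qed
  moreover have "infinite (h ` {0<..<1})"
  proof
    assume "finite (h ` {0<..<1})"
    moreover have "inj_on h {0<..<1}"
    proof (rule inj_onI)
      fix t t' assume "h t = h t'"
      then have "complex_of_real (2 * sqrt 3) = 0 \<or>
          Complex (sqrt (1 - t\<^sup>2)) t + \<i> = Complex (sqrt (1 - t'\<^sup>2)) t' + \<i>"
        unfolding h_def divide_cancel_right .
      moreover have "complex_of_real (2 * sqrt 3) \<noteq> 0" by simp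
      ultimately have "Complex (sqrt (1 - t\<^sup>2)) t + \<i> = Complex (sqrt (1 - t'\<^sup>2)) t' + \<i>"
        by argo
      from arg_cong[OF this, of Im] show "t = t'" by simp
    qed
    ultimately have "finite {0<..<1::real}" by (rule finite_imageD)
    then show False using infinite_Ioo[of 0 "1::real"] by simp
  qed
  ultimately have "infinite (?f ` ?F)" by (rule infinite_super)
  then have inf: "infinite ?F" by (rule contrapos_nn) (rule finite_imageI)
  show ?thesis
  proof (rule infinite_LU_classes[OF inf, where \<rho> = 1])
    show "?F \<subseteq> {U. two_unitary 6 U}" using two_unitary_hex by auto
  next
    fix U U' assume "U \<in> ?F" "U' \<in> ?F" and ne: "U \<noteq> U'"
    then obtain v v' where v: "balanced v" "U = of_tens 6 (hex_tens v)" and v': "balanced v'" "U' = of_tens 6 (hex_tens v')" by blast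
    define \<psi> where "\<psi> = hex_state v"
    define \<psi>' where "\<psi>' = hex_state v'"
    have tens: "tens 6 U = \<psi>" "tens 6 U' = \<psi>'" unfolding \<psi>_def \<psi>'_def v v' hex_state_def by simp_all
    have "nrm 6 \<psi> = 6"
      using ame_nrm[OF two_unitary_imp_ame[OF two_unitary_hex[OF v(1)]]] unfolding \<psi>_def hex_state_def by simp
    then have n: "ip 6 \<psi> \<psi> = 36" by (simp add: ip_self)
    \<comment> \<open>The coefficient of the orthogonal projection onto \<open>\<psi>\<close>. The
      residual \<open>\<phi>\<close> is both the displacement and the test vector, so the separation
      inequality holds with equality for \<rho> = 1.\<close>
    define s where "s = ip 6 \<psi> \<psi>' / 36"
    define \<phi> where "\<phi> = (\<lambda>q. \<psi>' q - s * \<psi> q)"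
    have ip\<phi>: "ip 6 \<phi> \<chi> = ip 6 \<psi>' \<chi> - cnj s * ip 6 \<psi> \<chi>" for \<chi>
      unfolding \<phi>_def ip_def by (simp add: sum_subtractf sum_distrib_left algebra_simps)
    have "cnj s = ip 6 \<psi>' \<psi> / 36" unfolding s_def ip_def by (simp add: mult.commute)
    then have \<phi>\<psi>: "ip 6 \<phi> \<psi> = 0" using ip\<phi> n by simp
    have orth: "ip 6 \<phi> (act 6 i X \<psi>) = 0" if "i < 4" for i X
    proof -
      have "6 * ip 6 \<phi> (act 6 i X \<psi>) = (\<Sum>x<6. X x x) * ip 6 \<phi> \<psi>"
        using ip_act_hex[OF that, of v' X v] ip_act_hex[OF that, of v X v] unfolding ip\<phi> \<psi>_def \<psi>'_def
        by (simp add: algebra_simps)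
      then show ?thesis using \<phi>\<psi> by simp
    qed
    have "ip 6 \<phi> \<psi>' = ip 6 \<phi> (\<lambda>q. \<phi> q + s * \<psi> q)" unfolding \<phi>_def by simp
    also have "\<dots> = of_real ((nrm 6 \<phi>)\<^sup>2)" unfolding ip_add ip_scale \<phi>\<psi> ip_self by simp
    finally have ip: "ip 6 \<phi> \<psi>' = of_real ((nrm 6 \<phi>)\<^sup>2)" .
    have "nrm 6 \<phi> \<noteq> 0"
    proof
      assume "nrm 6 \<phi> = 0"
      then have z: "\<psi>' q = s * \<psi> q" if "q \<in> idx 6" for q
        using that unfolding nrm_def by (simp add: L2_set_eq_0_iff \<phi>_def)
      have cancel: "x = s * y" if "x / c = s * (y / c)" "c \<noteq> 0" for c x y :: complex
        using that by (metis divide_cancel_right times_divide_eq_right)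
      have c: "complex_of_real (2 * sqrt 3) \<noteq> 0" by simp
      have q: "quad 3 0 3 0 \<in> idx 6" "quad 3 0 2 5 \<in> idx 6" by simp_all
      note z' = z[OF q(1), unfolded \<psi>_def \<psi>'_def hex_state_values] z[OF q(2), unfolded \<psi>_def \<psi>'_def hex_state_values]
      have plus: "v' 2 + \<i> = s * (v 2 + \<i>)" by (rule cancel[OF z'(1) c])
      have "cub 58 * (v' 2 - \<i>) = s * (cub 58 * (v 2 - \<i>))" by (rule cancel[OF z'(2) c])
      then have "v' 2 - \<i> = s * (v 2 - \<i>)"
        using cub_nonzero[of 58] by (metis mult.left_commute mult_left_cancel)
      with plus have "(v' 2 + \<i>) - (v' 2 - \<i>) = s * (v 2 + \<i>) - s * (v 2 - \<i>)" by (rule arg_cong2[of _ _ _ _ "(-)"])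
      then have "2 * \<i> = s * (2 * \<i>)" by (simp add: algebra_simps)
      then have "s = 1" by simp
      then have "U = U'" unfolding v v' using z by (intro of_tens_eqI) (simp add: \<psi>_def \<psi>'_def hex_state_def)
      then show False using ne by simp
    qed
    then have "ip 6 \<phi> \<psi>' \<noteq> 0" unfolding ip by simp
    moreover have "1 * (nrm 6 \<phi> * nrm 6 (\<lambda>q. \<psi>' q - s * \<psi> q)) \<le> cmod (ip 6 \<phi> \<psi>')"
      unfolding ip \<phi>_def[symmetric] norm_of_real by (simp add: power2_eq_square)
    ultimately show "\<exists>\<phi> s. (\<forall>i<4. \<forall>X. ip 6 \<phi> (act 6 i X (tens 6 U)) = 0) \<and> ip 6 \<phi> (tens 6 U') \<noteq> 0 \<and>
      1 * (nrm 6 \<phi> * nrm 6 (\<lambda>q. tens 6 U' q - s * tens 6 U q)) \<le> cmod (ip 6 \<phi> (tens 6 U'))"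
      unfolding tens using orth by blast
  qed simp_all
qed

theorem theorem2:
  fixes d :: nat
  assumes "d \<ge> 4"
  shows "infinite ({U. two_unitary d U} // LU_rel d)"
proof (cases "d = 6")
  case True
  then show ?thesis using infinite_LU_classes_6 by simp
next
  case False
  then obtain B where "orth_array 4 d B" using orth_array_exists assms unfolding has_orth_array_def by blast
  then show ?thesis using assms by (rule infinite_LU_classes_orth_array)
qed

end
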